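(* Let $\mathcal Y$ be the complete set of inequivalent, irreducible representations of $\mathbb C R_n$ induced by Young's seminormal or orthogonal representations of the symmetric groups. If $f=\sum_{s\in R_n}f(s)s\in\mathbb C R_n$ is expressed with respect to $\mathcal Y$, then the coefficients $\{f(s):s\in R_n\}$ can be computed in no more than $O(|R_n|\log^2|R_n|)$ operations.
   Context: $R_n$ (rook monoid) is the inverse monoid of all injective partial functions from $\{1,\dots,n\}$ to itself (including the empty one), under composition of partial functions (right to left). The rank of $s$ is $|\mathrm{dom}(s)|$; subsets of $\{1,\dots,n\}$ are identified with the partial identities on them, which are the idempotents of $R_n$. In $\mathbb C R_n$ put $\lfloor s\rfloor=\sum_{t\leq s}(-1)^{\mathrm{rk}(s)-\mathrm{rk}(t)}t$, where $t\leq s$ means that $t$ is a restriction of $s$; these elements form a basis of $\mathbb C R_n$. Induced representations: for $0\leq k\leq n$ let $e_k$ be the partial identity on $\{1,\dots,k\}$, so that $G_k=\{s\in R_n:\mathrm{dom}(s)=\mathrm{ran}(s)=\{1,\dots,k\}\}\cong S_k$, and for each $a\subseteq\{1,\dots,n\}$ with $|a|=k$ let $p_a$ be the unique order-preserving bijection from $\{1,\dots,k\}$ to $a$. Let $\mathrm{IRR}(G_k)$ be the set of Young's seminormal representations (or the set of Young's orthogonal representations) of $S_k$. For $\rho\in\mathrm{IRR}(G_k)$ let $\bar\rho$ be the representation of $\mathbb C R_n$ of dimension $\binom nk d_\rho$ with $\bar\rho(\lfloor s\rfloor)=E_{\mathrm{ran}(s),\mathrm{dom}(s)}\otimes\rho(p_{\mathrm{ran}(s)}^{-1}\,s\,p_{\mathrm{dom}(s)})$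 if $s$ has rank $k$ and $\bar\rho(\lfloor s\rfloor)=0$ otherwise, where $E_{a,b}$ are the matrix units indexed by $k$-subsets. Then $\mathcal Y=\{\bar\rho:\rho\in\biguplus_{k=0}^n\mathrm{IRR}(G_k)\}$. Young's representations: for a partition $\lambda$ of $k$, take a basis $v_T$ indexed by standard tableaux $T$ of shape $\lambda$; let $a=c_T(i+1)-c_T(i)$, where $c_T(j)$ is the content (column minus row) of the box of $T$ containing $j$. The adjacent transposition $(i\ i{+}1)$ sends $v_T$ to $\frac1a v_T+(1+\frac1a)v_{T'}$ in the seminormal form, and to $\frac1a v_T+\sqrt{1-a^{-2}}\,v_{T'}$ in the orthogonal form, where $T'$ is $T$ with $i,i+1$ interchanged and $v_{T'}=0$ if $T'$ is not standard. $f$ being expressed with respect to $\mathcal Y$ means that all entries of the matrices $\hat f(\bar\rho)=\bar\rho(f)=\sum_{s}f(s)\bar\rho(s)$, $\bar\rho\in\mathcal Y$, are given. Operation: one complex multiplication together with one complex addition, i.e. one step forming $\alpha u+v$, where $\alpha\in\mathbb C$ is a constant and $u,v$ are inputs, previously computed values or $0$; constants not depending on $f$ may be precomputed at no cost. The $O$-bound is as $n\to\infty$. *)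

theory Defs
  imports Complex_Main "HOL-Combinatorics.Transposition" "HOL-Library.Landau_Symbols"
begin

section \<open>The rook monoid and its algebra\<close>

text \<open>
  Partial functions are maps \<open>nat \<rightharpoonup> nat\<close>. Their composition \<open>\<circ>\<^sub>m\<close> is right to left, and
  \<open>t \<subseteq>\<^sub>m s\<close> says that \<open>t\<close> is a restriction of \<open>s\<close>.
\<close>

definition rook :: "nat \<Rightarrow> (nat \<rightharpoonup> nat) set" where
  "rook n = {s. dom s \<subseteq> {1..n} \<and> ran s \<subseteq> {1..n} \<and> inj_on s (dom s)}"

definition rk :: "(nat \<rightharpoonup> nat) \<Rightarrow> nat" where
  "rk s = card (dom s)"

definition rook_algebra :: "nat \<Rightarrow> ((nat \<rightharpoonup> nat) \<Rightarrow> complex) set" where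
  "rook_algebra n = {f. \<forall>s. s \<notin> rook n \<longrightarrow> f s = 0}"

definition single :: "(nat \<rightharpoonup> nat) \<Rightarrow> (nat \<rightharpoonup> nat) \<Rightarrow> complex" where
  "single s = (\<lambda>u. of_bool (u = s))"

definition floor_elt :: "(nat \<rightharpoonup> nat) \<Rightarrow> (nat \<rightharpoonup> nat) \<Rightarrow> complex" where
  "floor_elt s = (\<lambda>u. \<Sum>t\<in>{t. t \<subseteq>\<^sub>m s}. (-1) ^ (rk s - rk t) * single t u)"

text \<open>
  The coordinates of \<open>f\<close> with respect to the basis \<open>floor_elt s\<close>, \<open>s \<in> rook n\<close>. They exist and
  are unique; see \<open>floor_coords_eq\<close> below.
\<close>

definition floor_coords ::
    "nat \<Rightarrow> ((nat \<rightharpoonup> nat) \<Rightarrow> complex) \<Rightarrow> (nat \<rightharpoonup> nat) \<Rightarrow> complex" where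
  "floor_coords n f =
     (THE c. c \<in> rook_algebra n \<and> f = (\<lambda>u. \<Sum>s\<in>rook n. c s * floor_elt s u))"


section \<open>Young's seminormal and orthogonal representations\<close>

definition partition_of :: "nat list \<Rightarrow> nat \<Rightarrow> bool" where
  "partition_of lam k \<longleftrightarrow> sorted_wrt (\<ge>) lam \<and> 0 \<notin> set lam \<and> sum_list lam = k"

text \<open>Boxes are pairs (row, column), numbered from 0.\<close>

definition diagram :: "nat list \<Rightarrow> (nat \<times> nat) set" where
  "diagram lam = {(r, c). r < length lam \<and> c < lam ! r}"

type_synonym tableau = "nat \<times> nat \<Rightarrow> nat"

text \<open>Tableaux take the dummy value 0 off the diagram, so that equal fillings are equal functions.\<close>

definition std_tableaux :: "nat list \<Rightarrow> tableau set" where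
  "std_tableaux lam = {T.
     bij_betw T (diagram lam) {1..sum_list lam} \<and>
     (\<forall>b. b \<notin> diagram lam \<longrightarrow> T b = 0) \<and>
     (\<forall>r c c'. (r, c) \<in> diagram lam \<and> (r, c') \<in> diagram lam \<and> c < c' \<longrightarrow> T (r, c) < T (r, c')) \<and>
     (\<forall>r r' c. (r, c) \<in> diagram lam \<and> (r', c) \<in> diagram lam \<and> r < r' \<longrightarrow> T (r, c) < T (r', c))}"

definition content_of :: "nat list \<Rightarrow> tableau \<Rightarrow> nat \<Rightarrow> int" where
  "content_of lam T j = (THE d. \<exists>r c. (r, c) \<in> diagram lam \<and> T (r, c) = j \<and> d = int c - int r)"

datatype young_form = Seminormal | Orthogonal

fun swap_coeff :: "young_form \<Rightarrow> int \<Rightarrow> complex" where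
  "swap_coeff Seminormal a = 1 + 1 / of_int a"
| "swap_coeff Orthogonal a = of_real (sqrt (1 - 1 / (of_int a)\<^sup>2))"

text \<open>
  The coefficient of \<open>v\<^sub>T\<close> in the image of \<open>v\<^sub>U\<close> under the adjacent transposition of \<open>i\<close> and
  \<open>i + 1\<close>. It is only used for standard \<open>T\<close>, so the second summand drops out when the tableau
  obtained from \<open>U\<close> by interchanging \<open>i\<close> and \<open>i + 1\<close> is not standard.
\<close>

definition young_entry :: "young_form \<Rightarrow> nat list \<Rightarrow> nat \<Rightarrow> tableau \<Rightarrow> tableau \<Rightarrow> complex" where
  "young_entry F lam i T U =
     (let a = content_of lam U (Suc i) - content_of lam U i
      in 1 / of_int a * of_bool (T = U) + swap_coeff F a * of_bool (T = transpose i (Suc i) \<circ> U))"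

text \<open>The maximal subgroup of the rook monoid at the idempotent \<open>e\<^sub>k\<close>; it is a copy of \<open>S\<^sub>k\<close>.\<close>

definition idem :: "nat \<Rightarrow> (nat \<rightharpoonup> nat)" where
  "idem k = Some |` {1..k}"

definition symgrp :: "nat \<Rightarrow> (nat \<rightharpoonup> nat) set" where
  "symgrp k = {s. inj_on s (dom s) \<and> dom s = {1..k} \<and> ran s = {1..k}}"

definition adj_transp :: "nat \<Rightarrow> nat \<Rightarrow> (nat \<rightharpoonup> nat)" where
  "adj_transp k i = (\<lambda>j. Some (transpose i (Suc i) j)) |` {1..k}"

text \<open>
  \<open>\<rho>\<close> is a matrix representation of the symmetric group, with rows and columns indexed by standard
  tableaux, that is given on adjacent transpositions by Young's formulas. As these generate, its
  entries are determined; that there is such a \<open>\<rho>\<close> is Young's classical theorem.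
\<close>

definition young_rep ::
    "young_form \<Rightarrow> nat \<Rightarrow> nat list \<Rightarrow> ((nat \<rightharpoonup> nat) \<Rightarrow> tableau \<Rightarrow> tableau \<Rightarrow> complex) \<Rightarrow> bool" where
  "young_rep F k lam \<rho> \<longleftrightarrow>
     (\<forall>T\<in>std_tableaux lam. \<forall>U\<in>std_tableaux lam. \<rho> (idem k) T U = of_bool (T = U)) \<and>
     (\<forall>s\<in>symgrp k. \<forall>t\<in>symgrp k. \<forall>T\<in>std_tableaux lam. \<forall>U\<in>std_tableaux lam.
        \<rho> (s \<circ>\<^sub>m t) T U = (\<Sum>V\<in>std_tableaux lam. \<rho> s T V * \<rho> t V U)) \<and>
     (\<forall>i. 1 \<le> i \<and> i < k \<longrightarrow>
        (\<forall>T\<in>std_tableaux lam. \<forall>U\<in>std_tableaux lam.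
           \<rho> (adj_transp k i) T U = young_entry F lam i T U))"


section \<open>Induced representations and the Fourier transform\<close>

definition pinv :: "(nat \<rightharpoonup> nat) \<Rightarrow> (nat \<rightharpoonup> nat)" where
  "pinv s = (\<lambda>y. if y \<in> ran s then Some (THE x. s x = Some y) else None)"

text \<open>The order-preserving bijection \<open>p\<^sub>a\<close> from \<open>{1..card a}\<close> to \<open>a\<close>.\<close>

definition order_bij :: "nat set \<Rightarrow> (nat \<rightharpoonup> nat)" where
  "order_bij a = (\<lambda>j. Some (sorted_list_of_set a ! (j - 1))) |` {1..card a}"

definition induced_index :: "nat \<Rightarrow> nat list \<Rightarrow> (nat set \<times> tableau) set" where
  "induced_index n lam = {a. a \<subseteq> {1..n} \<and> card a = sum_list lam} \<times> std_tableaux lam"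

text \<open>
  The matrix \<open>E \<otimes> \<rho>\<close> (or 0) assigned to a basis element \<open>floor_elt s\<close>; rows and columns are
  indexed by \<open>induced_index n lam\<close>, where \<open>lam\<close> is a partition of \<open>k\<close>.
\<close>

definition induced_block ::
    "nat \<Rightarrow> ((nat \<rightharpoonup> nat) \<Rightarrow> tableau \<Rightarrow> tableau \<Rightarrow> complex) \<Rightarrow> (nat \<rightharpoonup> nat) \<Rightarrow>
     nat set \<times> tableau \<Rightarrow> nat set \<times> tableau \<Rightarrow> complex" where
  "induced_block k \<rho> s = (\<lambda>(a, T) (b, U).
     if rk s = k \<and> a = ran s \<and> b = dom s
     then \<rho> (pinv (order_bij (ran s)) \<circ>\<^sub>m (s \<circ>\<^sub>m order_bij (dom s))) T U
     else 0)"

text \<open>Linear extension from the basis; see \<open>induced_rep_floor_elt\<close> below.\<close>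

definition induced_rep ::
    "nat \<Rightarrow> nat \<Rightarrow> ((nat \<rightharpoonup> nat) \<Rightarrow> tableau \<Rightarrow> tableau \<Rightarrow> complex) \<Rightarrow> ((nat \<rightharpoonup> nat) \<Rightarrow> complex) \<Rightarrow>
     nat set \<times> tableau \<Rightarrow> nat set \<times> tableau \<Rightarrow> complex" where
  "induced_rep n k \<rho> f I J = (\<Sum>s\<in>rook n. floor_coords n f s * induced_block k \<rho> s I J)"

definition fourier ::
    "nat \<Rightarrow> nat \<Rightarrow> ((nat \<rightharpoonup> nat) \<Rightarrow> tableau \<Rightarrow> tableau \<Rightarrow> complex) \<Rightarrow> ((nat \<rightharpoonup> nat) \<Rightarrow> complex) \<Rightarrow>
     nat set \<times> tableau \<Rightarrow> nat set \<times> tableau \<Rightarrow> complex" where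
  "fourier n k \<rho> f I J = (\<Sum>s\<in>rook n. f s * induced_rep n k \<rho> (single s) I J)"


section \<open>Linear straight-line programs\<close>

datatype 'i operand = Zero | Input 'i | Prev nat

text \<open>The step \<open>MulAdd \<alpha> u v\<close> computes \<open>\<alpha> * u + v\<close>; each step is one operation.\<close>

datatype 'i step = MulAdd complex "'i operand" "'i operand"

fun operand_value :: "('i \<Rightarrow> complex) \<Rightarrow> complex list \<Rightarrow> 'i operand \<Rightarrow> complex" where
  "operand_value x vs Zero = 0"
| "operand_value x vs (Input i) = x i"
| "operand_value x vs (Prev m) = vs ! m"

fun step_value :: "('i \<Rightarrow> complex) \<Rightarrow> complex list \<Rightarrow> 'i step \<Rightarrow> complex" where
  "step_value x vs (MulAdd \<alpha> u v) = \<alpha> * operand_value x vs u + operand_value x vs v"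

definition run :: "('i \<Rightarrow> complex) \<Rightarrow> 'i step list \<Rightarrow> complex list" where
  "run x P = foldl (\<lambda>vs st. vs @ [step_value x vs st]) [] P"

text \<open>\<open>X\<close> is the set of admissible inputs, and \<open>m\<close> the number of values computed so far.\<close>

fun operand_ok :: "'i set \<Rightarrow> nat \<Rightarrow> 'i operand \<Rightarrow> bool" where
  "operand_ok X m Zero \<longleftrightarrow> True"
| "operand_ok X m (Input i) \<longleftrightarrow> i \<in> X"
| "operand_ok X m (Prev j) \<longleftrightarrow> j < m"

fun step_ok :: "'i set \<Rightarrow> nat \<Rightarrow> 'i step \<Rightarrow> bool" where
  "step_ok X m (MulAdd \<alpha> u v) \<longleftrightarrow> operand_ok X m u \<and> operand_ok X m v"

definition program_ok :: "'i set \<Rightarrow> 'i step list \<Rightarrow> bool" where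
  "program_ok X P \<longleftrightarrow> (\<forall>m < length P. step_ok X m (P ! m))"

definition fourier_entries ::
    "nat \<Rightarrow> (nat list \<times> (nat set \<times> tableau) \<times> (nat set \<times> tableau)) set" where
  "fourier_entries n = {(lam, I, J).
     \<exists>k\<le>n. partition_of lam k \<and> I \<in> induced_index n lam \<and> J \<in> induced_index n lam}"

text \<open>
  At most \<open>N\<close> operations suffice to compute all \<open>f s\<close> from the entries of the Fourier transform of
  \<open>f\<close>. The program, with its constants and the places \<open>out s\<close> of the results, does not depend
  on \<open>f\<close>.
\<close>

definition inverse_fourier_within ::
    "nat \<Rightarrow> (nat list \<Rightarrow> (nat \<rightharpoonup> nat) \<Rightarrow> tableau \<Rightarrow> tableau \<Rightarrow> complex) \<Rightarrow> nat \<Rightarrow> bool" where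
  "inverse_fourier_within n \<rho> N \<longleftrightarrow>
     (\<exists>P out. length P \<le> N \<and> program_ok (fourier_entries n) P \<and>
        (\<forall>s\<in>rook n. operand_ok (fourier_entries n) (length P) (out s)) \<and>
        (\<forall>f\<in>rook_algebra n.
           let x = (\<lambda>(lam, I, J). fourier n (sum_list lam) (\<rho> lam) f I J)
           in \<forall>s\<in>rook n. operand_value x (run x P) (out s) = f s))"


section \<open>Consistency of the definitions\<close>

lemma finite_maps: "finite {s :: nat \<rightharpoonup> nat. dom s \<subseteq> {1..n} \<and> ran s \<subseteq> {1..n}}"
proof -
  have "{s :: nat \<rightharpoonup> nat. dom s \<subseteq> {1..n} \<and> ran s \<subseteq> {1..n}} =
        (\<Union>D\<in>Pow {1..n}. {s. dom s = D \<and> ran s \<subseteq> {1..n}})"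
    by auto
  moreover have "finite \<dots>"
    by (intro finite_UN_I) (auto intro!: finite_set_of_finite_maps intro: finite_subset)
  ultimately show ?thesis by simp
qed

lemma finite_rook: "finite (rook n)"
  by (rule finite_subset[OF _ finite_maps[of n]]) (auto simp: rook_def)

lemma finite_diagram: "finite (diagram lam)"
proof -
  have "diagram lam = (SIGMA r:{..<length lam}. {..<lam ! r})"
    by (auto simp: diagram_def)
  then show ?thesis by simp
qed

lemma finite_std_tableaux: "finite (std_tableaux lam)"
proof (rule finite_subset)
  show "std_tableaux lam \<subseteq> {T. \<forall>b. (b \<in> diagram lam \<longrightarrow> T b \<in> {1..sum_list lam}) \<and>
                                  (b \<notin> diagram lam \<longrightarrow> T b = 0)}"
    by (auto simp: std_tableaux_def dest!: bij_betw_imp_surj_on)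
  show "finite {T. \<forall>b. (b \<in> diagram lam \<longrightarrow> T b \<in> {1..sum_list lam}) \<and>
                       (b \<notin> diagram lam \<longrightarrow> T b = (0::nat))}"
    by (rule finite_set_of_finite_funs) (auto simp: finite_diagram)
qed

lemma alternating_sum_Pow:
  assumes "finite A"
  shows "(\<Sum>D\<in>Pow A. (-1) ^ card D :: complex) = of_bool (A = {})"
  using assms
proof (induction A rule: finite_induct)
  case (insert x A)
  have "(\<Sum>D\<in>Pow (insert x A). (-1) ^ card D :: complex) =
        (\<Sum>D\<in>Pow A. (-1) ^ card D) + (\<Sum>D\<in>insert x ` Pow A. (-1) ^ card D)"
    unfolding Pow_insert using insert by (intro sum.union_disjoint) auto
  also have "(\<Sum>D\<in>insert x ` Pow A. (-1) ^ card D :: complex) =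
             (\<Sum>D\<in>Pow A. (-1) ^ card (insert x D))"
    using insert by (intro sum.reindex_cong[of "insert x"]) (auto simp: inj_on_def)
  also have "\<dots> = (\<Sum>D\<in>Pow A. - ((-1) ^ card D))"
  proof (intro sum.cong refl)
    fix D assume "D \<in> Pow A"
    then have "finite D" "x \<notin> D" using insert finite_subset by auto
    then show "(-1) ^ card (insert x D) = - ((-1) ^ card D :: complex)" by simp
  qed
  finally show ?case by (simp add: sum_negf)
qed simp

lemma rook_restrict:
  assumes s: "s \<in> rook n" and le: "t \<subseteq>\<^sub>m s"
  shows "t \<in> rook n"
proof -
  have eq: "t x = s x" if "x \<in> dom t" for x
    using le that by (simp add: map_le_def)
  have d: "dom t \<subseteq> dom s" using le by (rule map_le_implies_dom_le)
  have r: "ran t \<subseteq> ran s"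
  proof
    fix y assume "y \<in> ran t"
    then obtain x where x: "t x = Some y" by (auto simp: ran_def)
    with eq[of x] have "s x = Some y" by (simp add: domI)
    then show "y \<in> ran s" by (rule ranI)
  qed
  have "inj_on t (dom t)"
  proof (rule inj_onI)
    fix x y assume "x \<in> dom t" "y \<in> dom t" "t x = t y"
    moreover from this have "s x = s y" "x \<in> dom s" "y \<in> dom s" using eq d by auto
    ultimately show "x = y" using s by (auto simp: rook_def dest: inj_onD)
  qed
  then show ?thesis using s d r by (auto simp: rook_def)
qed

lemma finite_dom_rook: "s \<in> rook n \<Longrightarrow> finite (dom s)"
  by (auto simp: rook_def intro: finite_subset)

lemma finite_below: "s \<in> rook n \<Longrightarrow> finite {t. t \<subseteq>\<^sub>m s}"
  by (rule finite_subset[OF _ finite_rook[of n]]) (auto intro: rook_restrict)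

lemma floor_elt_apply:
  assumes "s \<in> rook n"
  shows "floor_elt s u = (if u \<subseteq>\<^sub>m s then (-1) ^ (rk s - rk u) else 0)"
  using finite_below[OF assms] by (simp add: floor_elt_def single_def of_bool_def sum.delta if_distrib
      cong: if_cong)

text \<open>Moebius inversion for the restriction order, whose intervals are Boolean lattices.\<close>

lemma interval_sum:
  assumes s: "s \<in> rook n" and u: "u \<subseteq>\<^sub>m s"
  shows "(\<Sum>t\<in>{t. u \<subseteq>\<^sub>m t \<and> t \<subseteq>\<^sub>m s}. (-1) ^ (rk t - rk u) :: complex) = of_bool (u = s)"
    and "(\<Sum>t\<in>{t. u \<subseteq>\<^sub>m t \<and> t \<subseteq>\<^sub>m s}. (-1) ^ (rk s - rk t) :: complex) = of_bool (u = s)"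
proof -
  let ?A = "dom s - dom u"
  have fin: "finite (dom s)" using s by (rule finite_dom_rook)
  have du: "dom u \<subseteq> dom s" using u by (rule map_le_implies_dom_le)
  have eq: "(?A = {}) = (u = s)"
  proof
    assume "?A = {}"
    then have "dom s = dom u" using du by auto
    then show "u = s" using u by (metis map_le_antisym map_le_def)
  qed auto
  have inj: "inj_on (\<lambda>D. s |` (dom u \<union> D)) (Pow ?A)"
  proof (rule inj_onI)
    fix D E assume DE: "D \<in> Pow ?A" "E \<in> Pow ?A" and e: "s |` (dom u \<union> D) = s |` (dom u \<union> E)"
    have "dom s \<inter> (dom u \<union> D) = dom s \<inter> (dom u \<union> E)"
      using arg_cong[OF e, of dom] by (simp only: dom_restrict)
    moreover have "dom s \<inter> (dom u \<union> D) = dom u \<union> D" "dom s \<inter> (dom u \<union> E) = dom u \<union> E"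
      using DE du by blast+
    ultimately have "dom u \<union> D = dom u \<union> E" by (simp only:)
    then show "D = E" using DE by blast
  qed
  have img: "{t. u \<subseteq>\<^sub>m t \<and> t \<subseteq>\<^sub>m s} = (\<lambda>D. s |` (dom u \<union> D)) ` Pow ?A" (is "?L = ?R")
  proof (intro equalityI subsetI)
    fix t assume "t \<in> ?L"
    then have t: "u \<subseteq>\<^sub>m t" "t \<subseteq>\<^sub>m s" by auto
    have d: "dom u \<subseteq> dom t" "dom t \<subseteq> dom s"
      using t[THEN map_le_implies_dom_le] by simp_all
    have "t = s |` dom t"
    proof
      fix x show "t x = (s |` dom t) x"
      proof (cases "x \<in> dom t")
        case True then show ?thesis using t(2) by (simp add: map_le_def)
      next
        case False then show ?thesis by (simp add: domIff)
      qed
    qed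
    moreover have "dom t = dom u \<union> (dom t - dom u)" using d by auto
    ultimately have "t = s |` (dom u \<union> (dom t - dom u))" by (simp only: flip: \<open>dom t = _\<close>)
    then show "t \<in> ?R" using d by (rule_tac image_eqI[of _ _ "dom t - dom u"]) auto
  next
    fix t assume "t \<in> ?R"
    then obtain D where D: "D \<subseteq> ?A" "t = s |` (dom u \<union> D)" by auto
    have "t \<subseteq>\<^sub>m s" unfolding D(2) by (auto simp: map_le_def restrict_map_def split: if_splits)
    moreover have "u \<subseteq>\<^sub>m t" unfolding D(2) using u by (auto simp: map_le_def restrict_map_def)
    ultimately show "t \<in> ?L" by simp
  qed
  have rk: "rk (s |` (dom u \<union> D)) = rk u + card D" if "D \<in> Pow ?A" for D
  proof -
    have "D \<subseteq> dom s" "dom u \<inter> D = {}" using that by auto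
    then have fD: "finite D" "finite (dom u)" and e: "dom s \<inter> (dom u \<union> D) = dom u \<union> D"
      using fin du by (auto intro: finite_subset)
    show ?thesis
      unfolding rk_def dom_restrict e by (rule card_Un_disjoint) (use fD \<open>dom u \<inter> D = {}\<close> in auto)
  qed
  have rks: "rk s = rk u + card ?A"
    using card_Diff_subset[OF finite_subset[OF du fin] du] card_mono[OF fin du] by (simp add: rk_def)
  have "(\<Sum>t\<in>?L. (-1) ^ (rk t - rk u) :: complex) = (\<Sum>D\<in>Pow ?A. (-1) ^ card D)"
    unfolding img using rk by (subst sum.reindex[OF inj]) (auto intro!: sum.cong)
  also have "\<dots> = of_bool (u = s)" using fin eq by (simp add: alternating_sum_Pow)
  finally show "(\<Sum>t\<in>?L. (-1) ^ (rk t - rk u) :: complex) = of_bool (u = s)" .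
  have "(\<Sum>t\<in>?L. (-1) ^ (rk s - rk t) :: complex) = (\<Sum>D\<in>Pow ?A. (-1) ^ (card ?A - card D))"
    unfolding img using rk rks by (subst sum.reindex[OF inj]) (auto intro!: sum.cong)
  also have "\<dots> = (\<Sum>D\<in>Pow ?A. (-1) ^ card D)"
  proof (rule sum.reindex_bij_witness[of _ "\<lambda>D. ?A - D" "\<lambda>D. ?A - D"])
    fix D assume "D \<in> Pow ?A"
    then have "D \<subseteq> ?A" by auto
    moreover from this have "finite D" using fin by (auto intro: finite_subset)
    ultimately show "(-1) ^ card (?A - D) = ((-1) ^ (card ?A - card D) :: complex)"
      by (simp add: card_Diff_subset)
  qed auto
  also have "\<dots> = of_bool (u = s)" using fin eq by (simp add: alternating_sum_Pow)
  finally show "(\<Sum>t\<in>?L. (-1) ^ (rk s - rk t) :: complex) = of_bool (u = s)" .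
qed

lemma above_coords:
  assumes c: "c \<in> rook_algebra n" and s: "s \<in> rook n"
    and f: "f = (\<lambda>u. \<Sum>s\<in>rook n. c s * floor_elt s u)"
  shows "(\<Sum>t\<in>{t \<in> rook n. s \<subseteq>\<^sub>m t}. f t) = c s"
proof -
  have fin: "finite (rook n)" by (rule finite_rook)
  have "(\<Sum>t\<in>{t \<in> rook n. s \<subseteq>\<^sub>m t}. f t) =
        (\<Sum>w\<in>rook n. c w * (\<Sum>t\<in>{t \<in> rook n. s \<subseteq>\<^sub>m t}. floor_elt w t))"
    unfolding f by (subst sum.swap) (simp add: sum_distrib_left)
  also have "\<dots> = (\<Sum>w\<in>rook n. c w * of_bool (w = s))"
  proof (intro sum.cong refl arg_cong2[where f = "(*)"])
    fix w assume w: "w \<in> rook n"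
    have "(\<Sum>t\<in>{t \<in> rook n. s \<subseteq>\<^sub>m t}. floor_elt w t) =
          (\<Sum>t\<in>{t. s \<subseteq>\<^sub>m t \<and> t \<subseteq>\<^sub>m w}. (-1) ^ (rk w - rk t))"
      using w fin by (intro sum.mono_neutral_cong_right)
        (auto simp: floor_elt_apply[OF w] intro: rook_restrict)
    also have "\<dots> = of_bool (w = s)"
    proof (cases "s \<subseteq>\<^sub>m w")
      case True then show ?thesis using interval_sum(2)[OF w] by auto
    next
      case False
      then have "{t. s \<subseteq>\<^sub>m t \<and> t \<subseteq>\<^sub>m w} = {}" "w \<noteq> s" using map_le_trans by auto
      then show ?thesis by (simp only: sum.empty) simp
    qed
    finally show "(\<Sum>t\<in>{t \<in> rook n. s \<subseteq>\<^sub>m t}. floor_elt w t) = of_bool (w = s)" .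
  qed
  also have "\<dots> = c s" using s fin by (simp add: of_bool_def sum.delta if_distrib cong: if_cong)
  finally show ?thesis .
qed

lemma floor_expansion:
  assumes f: "f \<in> rook_algebra n"
  shows "f = (\<lambda>u. \<Sum>s\<in>rook n. (\<Sum>t\<in>{t \<in> rook n. s \<subseteq>\<^sub>m t}. f t) * floor_elt s u)"
proof
  fix u
  have fin: "finite (rook n)" by (rule finite_rook)
  have "(\<Sum>s\<in>rook n. (\<Sum>t\<in>{t \<in> rook n. s \<subseteq>\<^sub>m t}. f t) * floor_elt s u) =
        (\<Sum>s\<in>rook n. \<Sum>t\<in>rook n. f t * (if s \<subseteq>\<^sub>m t then floor_elt s u else 0))"
    using fin by (intro sum.cong refl)
      (auto simp: sum_distrib_right sum.inter_filter intro!: sum.cong)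
  also have "\<dots> = (\<Sum>t\<in>rook n. f t * (\<Sum>s\<in>rook n. if s \<subseteq>\<^sub>m t then floor_elt s u else 0))"
    by (subst sum.swap) (simp add: sum_distrib_left)
  also have "\<dots> = (\<Sum>t\<in>rook n. f t * of_bool (u = t))"
  proof (intro sum.cong refl arg_cong2[where f = "(*)"])
    fix t assume t: "t \<in> rook n"
    have "(\<Sum>s\<in>rook n. if s \<subseteq>\<^sub>m t then floor_elt s u else 0) =
          (\<Sum>s\<in>{s. u \<subseteq>\<^sub>m s \<and> s \<subseteq>\<^sub>m t}. (-1) ^ (rk s - rk u))"
      using fin by (intro sum.mono_neutral_cong_right)
        (auto simp: rook_restrict[OF t] floor_elt_apply[OF rook_restrict[OF t]] floor_elt_apply[of _ n]
              split: if_splits)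
    also have "\<dots> = of_bool (u = t)"
    proof (cases "u \<subseteq>\<^sub>m t")
      case True then show ?thesis using interval_sum(1)[OF t] by auto
    next
      case False
      then have "{s. u \<subseteq>\<^sub>m s \<and> s \<subseteq>\<^sub>m t} = {}" "u \<noteq> t" using map_le_trans by auto
      then show ?thesis by (simp only: sum.empty) simp
    qed
    finally show "(\<Sum>s\<in>rook n. if s \<subseteq>\<^sub>m t then floor_elt s u else 0) = of_bool (u = t)" .
  qed
  also have "\<dots> = f u"
    using f fin by (auto simp: of_bool_def sum.delta if_distrib rook_algebra_def cong: if_cong)
  finally show "f u = (\<Sum>s\<in>rook n. (\<Sum>t\<in>{t \<in> rook n. s \<subseteq>\<^sub>m t}. f t) * floor_elt s u)" by simp
qed

lemma floor_coords_unique: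
  assumes "c \<in> rook_algebra n" and "f = (\<lambda>u. \<Sum>s\<in>rook n. c s * floor_elt s u)"
  shows "floor_coords n f = c"
  unfolding floor_coords_def
proof (rule the_equality)
  fix d assume d: "d \<in> rook_algebra n \<and> f = (\<lambda>u. \<Sum>s\<in>rook n. d s * floor_elt s u)"
  have "d s = c s" for s
  proof (cases "s \<in> rook n")
    case True
    show ?thesis using above_coords[OF assms(1) True assms(2)] above_coords[of d n s f] d True by simp
  qed (use assms(1) d in \<open>simp add: rook_algebra_def\<close>)
  then show "d = c" by auto
qed (use assms in blast)

lemma floor_coords_eq:
  assumes f: "f \<in> rook_algebra n"
  shows "f = (\<lambda>u. \<Sum>s\<in>rook n. floor_coords n f s * floor_elt s u)"
    and "floor_coords n f \<in> rook_algebra n"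
    and "s \<in> rook n \<Longrightarrow> floor_coords n f s = (\<Sum>t\<in>{t \<in> rook n. s \<subseteq>\<^sub>m t}. f t)"
proof -
  define c where "c = (\<lambda>s. if s \<in> rook n then (\<Sum>t\<in>{t \<in> rook n. s \<subseteq>\<^sub>m t}. f t) else 0)"
  have c: "c \<in> rook_algebra n" by (simp add: c_def rook_algebra_def)
  have e: "f = (\<lambda>u. \<Sum>s\<in>rook n. c s * floor_elt s u)"
    using floor_expansion[OF f] by (simp add: c_def cong: sum.cong)
  have fc: "floor_coords n f = c" by (rule floor_coords_unique[OF c e])
  show "f = (\<lambda>u. \<Sum>s\<in>rook n. floor_coords n f s * floor_elt s u)"
    unfolding fc by (rule e)
  show "floor_coords n f \<in> rook_algebra n"
    unfolding fc by (rule c)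
  show "s \<in> rook n \<Longrightarrow> floor_coords n f s = (\<Sum>t\<in>{t \<in> rook n. s \<subseteq>\<^sub>m t}. f t)"
    unfolding fc by (simp add: c_def)
qed

lemma sum_single:
  assumes "s \<in> rook n"
  shows "(\<Sum>t\<in>rook n. single s t * g t) = g s"
proof -
  have "(\<Sum>t\<in>rook n. single s t * g t) = (\<Sum>t\<in>{s}. single s t * g t)"
    using assms by (intro sum.mono_neutral_right) (auto simp: finite_rook single_def)
  then show ?thesis by (simp add: single_def)
qed

lemma induced_rep_floor_elt:
  assumes "s \<in> rook n"
  shows "induced_rep n k \<rho> (floor_elt s) I J = induced_block k \<rho> s I J"
proof -
  have "single s \<in> rook_algebra n" using assms by (auto simp: single_def rook_algebra_def)
  then have "floor_coords n (floor_elt s) = single s"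
    using assms by (intro floor_coords_unique) (simp_all add: sum_single)
  then show ?thesis using assms by (simp add: induced_rep_def sum_single)
qed

lemma single_in_rook_algebra: "s \<in> rook n \<Longrightarrow> single s \<in> rook_algebra n"
  by (auto simp: single_def rook_algebra_def)

lemma fourier_eq_induced_rep:
  assumes "f \<in> rook_algebra n"
  shows "fourier n k \<rho> f I J = induced_rep n k \<rho> f I J"
proof -
  have fin: "finite (rook n)" by (rule finite_rook)
  have "fourier n k \<rho> f I J =
        (\<Sum>w\<in>rook n. (\<Sum>s\<in>rook n. f s * floor_coords n (single s) w) * induced_block k \<rho> w I J)"
    unfolding fourier_def induced_rep_def sum_distrib_left sum_distrib_right
    by (subst sum.swap) (simp add: mult.assoc)
  also have "\<dots> = (\<Sum>w\<in>rook n. floor_coords n f w * induced_block k \<rho> w I J)"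
  proof (intro sum.cong refl arg_cong2[where f = "(*)"])
    fix w assume w: "w \<in> rook n"
    have "floor_coords n (single s) w = of_bool (w \<subseteq>\<^sub>m s)" if "s \<in> rook n" for s
    proof -
      have "floor_coords n (single s) w = (\<Sum>t\<in>{t \<in> rook n. w \<subseteq>\<^sub>m t}. single s t)"
        using floor_coords_eq(3)[OF single_in_rook_algebra[OF that] w] .
      also have "\<dots> = (\<Sum>t\<in>rook n. single s t * of_bool (w \<subseteq>\<^sub>m t))"
        using fin by (intro sum.mono_neutral_cong_left) auto
      finally show ?thesis by (simp add: sum_single[OF that])
    qed
    then have "(\<Sum>s\<in>rook n. f s * floor_coords n (single s) w) = (\<Sum>s\<in>rook n. if w \<subseteq>\<^sub>m s then f s else 0)"
      by (intro sum.cong) auto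
    also have "\<dots> = floor_coords n f w"
      using fin w assms by (simp add: floor_coords_eq(3) sum.inter_filter)
    finally show "(\<Sum>s\<in>rook n. f s * floor_coords n (single s) w) = floor_coords n f w" .
  qed
  finally show ?thesis by (simp add: induced_rep_def)
qed

end

theory Submission
  imports Defs "HOL-Combinatorics.Permutations" "HOL-Computational_Algebra.Polynomial"
begin

text \<open>
  Let \<open>c\<^sub>s\<close> be the coefficients of \<open>f\<close> in the basis of the \<open>floor_elt s\<close>. Those with \<open>ran s = a\<close>
  and \<open>dom s = b\<close>, where \<open>a\<close> and \<open>b\<close> have \<open>k\<close> elements, occur only in the blocks with row \<open>a\<close> and
  column \<open>b\<close> of the representations induced from \<open>S\<^sub>k\<close>, and these blocks are the Fourier transform of
  a function on \<open>S\<^sub>k\<close>. Hence one inverse Fourier transform on \<open>S\<^sub>k\<close> for each pair \<open>(a, b)\<close> gives all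
  \<open>c\<^sub>s\<close>. As \<open>card (rook n)\<close> is the sum of \<open>k!\<close> over all these pairs, a method for \<open>S\<^sub>k\<close> with
  \<open>2 k\<^sup>2 k!\<close> operations (\<open>costs_symmetric_group\<close>) needs at most \<open>2 n\<^sup>2 card (rook n)\<close> altogether.
  Since \<open>c\<^sub>s\<close> is the sum of \<open>f t\<close> over the extensions \<open>t\<close> of \<open>s\<close>, Moebius inversion recovers \<open>f\<close>;
  doing this for one point of the domain at a time takes \<open>n\<^sup>2 card (rook n)\<close> operations
  (\<open>costs_moebius\<close>). Finally \<open>card (rook n) \<ge> 2\<^sup>n\<close>, so that \<open>n\<close> is \<open>O(ln (card (rook n)))\<close>.

  For \<open>S\<^sub>k\<close> the power \<open>k\<^sup>2\<close> matters: multiplying by the coset representatives of \<open>S\<^sub>m\<close> in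
  \<open>S\<^sub>m\<^sub>+\<^sub>1\<close> one after the other leads to \<open>k\<^sup>3 k!\<close>, which is too much. Let \<open>s\<^sub>i\<close> be the
  transposition of \<open>i\<close> and \<open>i + 1\<close>, and \<open>t\<^sub>i = s\<^sub>i \<dots> s\<^sub>m\<close> for \<open>i \<le> m + 1\<close>, so that the cosets are
  \<open>t\<^sub>i S\<^sub>m\<close>. Let \<open>V\<^sub>\<mu>\<close> be the module with Young's basis. Restriction to \<open>S\<^sub>m\<close> identifies \<open>V\<^sub>\<lambda>\<close> with
  the sum of the \<open>V\<^sub>\<nu>\<close>, \<open>\<nu>\<close> arising from \<open>\<lambda>\<close> by removal of a box. A column of the transform on
  \<open>S\<^sub>m\<^sub>+\<^sub>1\<close>, indexed by a tableau of shape \<open>\<lambda>\<close> whose restriction has shape \<open>\<mu>\<close>, is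
  \<open>v\<^sub>\<lambda> = (\<Sum>i. t\<^sub>i F\<^sub>i)\<close>, where \<open>F\<^sub>i \<in> V\<^sub>\<mu>\<close> is a column of the transform on the \<open>i\<close>-th coset. Thus the
  \<open>F\<^sub>i\<close> have to be found from the \<open>v\<^sub>\<lambda>\<close>, where \<open>\<lambda>\<close> runs through the shapes \<open>\<mu>\<close> plus one box; this
  inverts the decomposition of the module induced by \<open>V\<^sub>\<mu>\<close>.

  The idea is to do this by recursion on \<open>m\<close>. For \<open>i \<le> m\<close> write \<open>t\<^sub>i = t'\<^sub>i s\<^sub>m\<close>, where the \<open>t'\<^sub>i\<close> are the
  representatives for \<open>S\<^sub>m\<^sub>-\<^sub>1\<close> in \<open>S\<^sub>m\<close>, and split \<open>F\<^sub>i\<close> into its components in the modules \<open>V\<^sub>\<kappa>\<close>,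
  \<open>\<kappa>\<close> being \<open>\<mu>\<close> minus one box. For each \<open>\<kappa>\<close> let \<open>G\<^sub>\<kappa>\<^sub>,\<^sub>\<nu> \<in> V\<^sub>\<nu>\<close> be what the \<open>t'\<^sub>i\<close> make of these
  components, which is the same problem for \<open>\<kappa>\<close> in place of \<open>\<mu>\<close>. Since \<open>s\<^sub>m\<close> commutes with
  \<open>S\<^sub>m\<^sub>-\<^sub>1\<close>, it only mixes copies of \<open>V\<^sub>\<kappa>\<close> by scalars, and Young's formulas give
   \<^item> \<open>v\<^sub>\<lambda>\<close> has the component \<open>F\<^sub>m\<^sub>+\<^sub>1 + (\<Sum>\<kappa>. G\<^sub>\<kappa>\<^sub>,\<^sub>\<mu> / (x\<^sub>\<lambda> - y\<^sub>\<kappa>))\<close> in \<open>V\<^sub>\<mu>\<close>, where \<open>x\<^sub>\<lambda>\<close> and \<open>y\<^sub>\<kappa>\<close> are the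
    contents of the added and of the removed box (\<open>coset_sum_same_row\<close>);
   \<^item> its component in \<open>V\<^sub>\<nu>\<close> for \<open>\<nu> \<noteq> \<mu>\<close> is a nonzero multiple of one \<open>G\<^sub>\<kappa>\<^sub>,\<^sub>\<nu>\<close> (\<open>coset_sum_other_row\<close>).

  The matrix with entries \<open>1\<close> and \<open>1 / (x\<^sub>\<lambda> - y\<^sub>\<kappa>)\<close> is a bordered Cauchy matrix and has a left inverse
  (\<open>corner_matrix_left_inverse\<close>). It is small, as \<open>\<mu>\<close> has \<open>r\<close> corners only if \<open>m \<ge> 1 + \<dots> + r\<close>. So the
  \<open>G\<^sub>\<kappa>\<^sub>,\<^sub>\<nu>\<close> and \<open>F\<^sub>m\<^sub>+\<^sub>1\<close> are found with \<open>O(m)\<close> operations for each dimension of \<open>V\<^sub>\<mu>\<close>, and with the recursion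
  \<open>2 (m + 1)\<^sup>2\<close> operations for each dimension suffice (\<open>costs_coset_sum\<close>). Summed over all columns this
  is \<open>2 (m + 1)\<^sup>2 m!\<close>, because the squares of the dimensions add up to \<open>m!\<close>.

  A standard tableau is encoded as the word of the rows of its entries, the largest entry first.
  Restriction to the smaller symmetric group then drops the first letter, and the recursions above
  become recursions on lists.
\<close>

section \<open>Counting operations\<close>

text \<open>
  \<open>straight_line S T n\<close>: a program of \<open>n\<close> steps with inputs \<open>S\<close> computes exactly the values in \<open>T\<close>.
  A value is identified with the function that gives it in dependence on the data \<open>f\<close>. This makes
  programs compositional: there are no addresses to shift when two of them are combined.
\<close>

inductive straight_line :: "('f \<Rightarrow> complex) set \<Rightarrow> ('f \<Rightarrow> complex) set \<Rightarrow> nat \<Rightarrow> bool" for S where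
  init: "straight_line S (insert (\<lambda>_. 0) S) 0"
| step: "straight_line S T n \<Longrightarrow> u \<in> T \<Longrightarrow> v \<in> T \<Longrightarrow> straight_line S (insert (\<lambda>f. \<alpha> * u f + v f) T) (Suc n)"

definition costs :: "('f \<Rightarrow> complex) set \<Rightarrow> ('f \<Rightarrow> complex) set \<Rightarrow> nat \<Rightarrow> bool" where
  "costs S T n \<longleftrightarrow> (\<exists>U m. straight_line S U m \<and> m \<le> n \<and> T \<subseteq> U)"

lemma straight_line_input: "straight_line S T n \<Longrightarrow> insert (\<lambda>_. 0) S \<subseteq> T"
  by (induction rule: straight_line.induct) auto

text \<open>
  The program for \<open>U\<close> is run after the one for \<open>T\<close>, with all of \<open>T\<close> kept.
\<close>

lemma straight_line_compose:
  assumes "straight_line S' U m" "straight_line S T n" "S' \<subseteq> T"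
  shows "straight_line S (T \<union> U) (n + m)"
  using assms
proof (induction rule: straight_line.induct)
  case init
  then have "T \<union> insert (\<lambda>_. 0) S' = T" using straight_line_input[of S T n] by auto
  then show ?case using init by simp
next
  case (step U m u v \<alpha>)
  then have "straight_line S (T \<union> U) (n + m)" "u \<in> T \<union> U" "v \<in> T \<union> U" by auto
  from straight_line.step[OF this, of \<alpha>] show ?case by simp
qed

lemma costs_mono: "costs S T n \<Longrightarrow> S \<subseteq> S' \<Longrightarrow> T' \<subseteq> T \<Longrightarrow> n \<le> n' \<Longrightarrow> costs S' T' n'"
  unfolding costs_def
proof (elim exE conjE)
  fix U m
  assume *: "straight_line S U m" "S \<subseteq> S'" "T' \<subseteq> T" "n \<le> n'" "m \<le> n" "T \<subseteq> U"
  have "straight_line S' (insert (\<lambda>_. 0) S' \<union> U) (0 + m)"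
    by (rule straight_line_compose[OF *(1) straight_line.init]) (use * in auto)
  then show "\<exists>U m. straight_line S' U m \<and> m \<le> n' \<and> T' \<subseteq> U"
    using * by (intro exI[of _ "insert (\<lambda>_. 0) S' \<union> U"] exI[of _ m]) auto
qed

lemma costs_trans:
  assumes "costs S T n" "costs (S \<union> T) U m"
  shows "costs S (T \<union> U) (n + m)"
proof -
  obtain T' n' where T': "straight_line S T' n'" "n' \<le> n" "T \<subseteq> T'" using assms(1) by (auto simp: costs_def)
  obtain U' m' where U': "straight_line (S \<union> T) U' m'" "m' \<le> m" "U \<subseteq> U'"
    using assms(2) by (auto simp: costs_def)
  have "straight_line S (T' \<union> U') (n' + m')"
    using T' straight_line_input[OF T'(1)] by (intro straight_line_compose[OF U'(1) T'(1)]) auto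
  with T' U' show ?thesis
    unfolding costs_def by (intro exI[of _ "T' \<union> U'"] exI[of _ "n' + m'"]) auto
qed

lemma costs_free: "T \<subseteq> S \<Longrightarrow> costs S T n"
  unfolding costs_def using straight_line.init by blast

lemma costs_UN:
  assumes "finite I" "\<And>i. i \<in> I \<Longrightarrow> costs S (T i) (n i)"
  shows "costs S (\<Union>i\<in>I. T i) (\<Sum>i\<in>I. n i)"
  using assms
proof (induction I rule: finite_induct)
  case empty
  then show ?case by (simp add: costs_free)
next
  case (insert i I)
  have "costs (S \<union> T i) (\<Union>i\<in>I. T i) (\<Sum>i\<in>I. n i)"
    by (rule costs_mono[OF insert.IH[OF insert.prems]]) auto
  from costs_trans[OF insert.prems[of i] this] insert.hyps show ?case by simp
qed

lemma costs_UN_le: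
  assumes "finite I" "\<And>i. i \<in> I \<Longrightarrow> costs S (T i) k" "card I * k \<le> N"
  shows "costs S (\<Union>i\<in>I. T i) N"
  by (rule costs_mono[OF costs_UN[OF assms(1,2)]]) (use assms(3) in auto)

lemma costs_sum:
  assumes "finite I" "\<And>i. i \<in> I \<Longrightarrow> u i \<in> S" "v \<in> insert (\<lambda>_. 0) S"
  shows "costs S {\<lambda>f. v f + (\<Sum>i\<in>I. \<alpha> i * u i f)} (card I)"
proof -
  have "\<exists>U. straight_line S U (card I) \<and> (\<lambda>f. v f + (\<Sum>i\<in>I. \<alpha> i * u i f)) \<in> U"
    using assms(1,2)
  proof (induction I rule: finite_induct)
    case empty
    show ?case using straight_line.init[of S] assms(3) by (intro exI[of _ "insert (\<lambda>_. 0) S"]) auto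
  next
    case (insert i I)
    then obtain U where U: "straight_line S U (card I)" "(\<lambda>f. v f + (\<Sum>i\<in>I. \<alpha> i * u i f)) \<in> U"
      by auto
    have "u i \<in> U" using insert.prems straight_line_input[OF U(1)] by auto
    from straight_line.step[OF U(1) this U(2), of "\<alpha> i"] insert show ?case
      by (intro exI) (auto simp: algebra_simps)
  qed
  then show ?thesis by (auto simp: costs_def)
qed

lemma length_run [simp]: "length (run x P) = length P"
  by (induction P rule: rev_induct) (auto simp: run_def)

lemma run_snoc: "run x (P @ [st]) = run x P @ [step_value x (run x P) st]"
  by (simp add: run_def)

lemma operand_value_append:
  "operand_ok X (length vs) u \<Longrightarrow> operand_value x (vs @ ws) u = operand_value x vs u"
  by (cases u) (auto simp: nth_append)

lemma operand_ok_mono: "operand_ok X m u \<Longrightarrow> m \<le> n \<Longrightarrow> operand_ok X n u"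
  by (cases u) auto

text \<open>
  The way back from sets of values to programs in the sense of \<^const>\<open>run\<close>, with an operand for
  each value.
\<close>

lemma straight_line_program:
  assumes "straight_line ((\<lambda>i f. x f i) ` X) U m"
  shows "\<exists>P. length P = m \<and> program_ok X P \<and>
           (\<forall>u\<in>U. \<exists>w. operand_ok X m w \<and> (\<forall>f. operand_value (x f) (run (x f) P) w = u f))"
  using assms
proof (induction rule: straight_line.induct)
  case init
  show ?case
  proof (intro exI[of _ "[]"] conjI ballI)
    fix u assume "u \<in> insert (\<lambda>_. 0) ((\<lambda>i f. x f i) ` X)"
    then consider "u = (\<lambda>_. 0)" | i where "i \<in> X" "u = (\<lambda>f. x f i)" by auto
    then show "\<exists>w. operand_ok X 0 w \<and> (\<forall>f. operand_value (x f) (run (x f) []) w = u f)"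
    proof cases
      case 1 then show ?thesis by (intro exI[of _ Zero]) simp
    next
      case 2 then show ?thesis by (intro exI[of _ "Input i"]) simp
    qed
  qed (auto simp: program_ok_def)
next
  case (step T n u v \<alpha>)
  from step.IH obtain P where P: "length P = n" "program_ok X P"
    and out: "\<And>t. t \<in> T \<Longrightarrow>
      \<exists>w. operand_ok X n w \<and> (\<forall>f. operand_value (x f) (run (x f) P) w = t f)"
    by blast
  obtain wu where wu: "operand_ok X n wu" "\<And>f. operand_value (x f) (run (x f) P) wu = u f"
    using out[OF step.hyps(2)] by blast
  obtain wv where wv: "operand_ok X n wv" "\<And>f. operand_value (x f) (run (x f) P) wv = v f"
    using out[OF step.hyps(3)] by blast
  let ?Q = "P @ [MulAdd \<alpha> wu wv]"
  show ?case
  proof (intro exI[of _ ?Q] conjI ballI)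
    show "length ?Q = Suc n" using P by simp
    show "program_ok X ?Q"
      using P wu(1) wv(1) by (auto simp: program_ok_def nth_append less_Suc_eq)
    fix t assume "t \<in> insert (\<lambda>f. \<alpha> * u f + v f) T"
    then consider "t = (\<lambda>f. \<alpha> * u f + v f)" | "t \<in> T" by auto
    then show "\<exists>w. operand_ok X (Suc n) w \<and> (\<forall>f. operand_value (x f) (run (x f) ?Q) w = t f)"
    proof cases
      case 1
      then show ?thesis using P wu wv
        by (intro exI[of _ "Prev n"]) (auto simp: run_snoc nth_append)
    next
      case 2
      from out[OF this] obtain w where "operand_ok X n w"
        "\<And>f. operand_value (x f) (run (x f) P) w = t f" by blast
      then show ?thesis using P operand_value_append[of X "run (x _) P" w]
        by (intro exI[of _ w]) (auto simp: run_snoc intro: operand_ok_mono)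
    qed
  qed
qed

lemma costs_program:
  assumes "costs ((\<lambda>i f. x f i) ` X) T N"
  shows "\<exists>P. length P \<le> N \<and> program_ok X P \<and>
           (\<forall>u\<in>T. \<exists>w. operand_ok X (length P) w \<and> (\<forall>f. operand_value (x f) (run (x f) P) w = u f))"
proof -
  obtain U m where "straight_line ((\<lambda>i f. x f i) ` X) U m" "m \<le> N" "T \<subseteq> U"
    using assms by (auto simp: costs_def)
  from straight_line_program[OF this(1)] this(2,3) show ?thesis by blast
qed

section \<open>Left inverses of matrices\<close>

text \<open>
  Induction on the set of columns. If \<open>B\<close> is a left inverse for the columns in \<open>J\<close>, then the new
  column minus its projection along \<open>B\<close> is nonzero, since otherwise it would be a combination
  of the columns in \<open>J\<close>. A row where it does not vanish gives the functional \<open>\<beta>\<close>, which is \<open>1\<close> on the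
  new column and \<open>0\<close> on the old ones, and with \<open>\<beta>\<close> the rows of \<open>B\<close> are corrected.
\<close>

lemma left_inverse_matrix:
  fixes A :: "'i \<Rightarrow> 'j \<Rightarrow> 'a :: field"
  assumes "finite I" "finite J"
    and "\<And>c. (\<And>i. i \<in> I \<Longrightarrow> (\<Sum>j\<in>J. A i j * c j) = 0) \<Longrightarrow> (\<forall>j\<in>J. c j = 0)"
  shows "\<exists>B. \<forall>j\<in>J. \<forall>j'\<in>J. (\<Sum>i\<in>I. B j i * A i j') = of_bool (j = j')"
  using assms(2,3)
proof (induction J rule: finite_induct)
  case empty
  then show ?case by simp
next
  case (insert k J)
  have "\<exists>B. \<forall>j\<in>J. \<forall>j'\<in>J. (\<Sum>i\<in>I. B j i * A i j') = of_bool (j = j')"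
  proof (rule insert.IH)
    fix c assume c: "\<And>i. i \<in> I \<Longrightarrow> (\<Sum>j\<in>J. A i j * c j) = 0"
    have "\<forall>j\<in>insert k J. (c(k := 0)) j = 0"
    proof (rule insert.prems)
      fix i assume "i \<in> I"
      have "(\<Sum>j\<in>J. A i j * (c(k := 0)) j) = (\<Sum>j\<in>J. A i j * c j)"
        using insert.hyps by (intro sum.cong) auto
      then show "(\<Sum>j\<in>insert k J. A i j * (c(k := 0)) j) = 0"
        using c[OF \<open>i \<in> I\<close>] insert.hyps by simp
    qed
    then show "\<forall>j\<in>J. c j = 0" using insert.hyps by (auto split: if_splits)
  qed
  then obtain B where B: "\<And>j j'. j \<in> J \<Longrightarrow> j' \<in> J \<Longrightarrow> (\<Sum>i\<in>I. B j i * A i j') = of_bool (j = j')"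
    by blast
  define t where "t j = (\<Sum>i\<in>I. B j i * A i k)" for j
  define r where "r i = A i k - (\<Sum>j\<in>J. A i j * t j)" for i
  have "\<exists>i\<in>I. r i \<noteq> 0"
  proof (rule ccontr)
    assume "\<not> (\<exists>i\<in>I. r i \<noteq> 0)"
    then have r0: "\<And>i. i \<in> I \<Longrightarrow> r i = 0" by blast
    have "\<forall>j\<in>insert k J. ((\<lambda>j. - t j)(k := 1)) j = 0"
    proof (rule insert.prems)
      fix i assume "i \<in> I"
      have "(\<Sum>j\<in>J. A i j * ((\<lambda>j. - t j)(k := 1)) j) = (\<Sum>j\<in>J. - (A i j * t j))"
        using insert.hyps by (intro sum.cong) auto
      then show "(\<Sum>j\<in>insert k J. A i j * ((\<lambda>j. - t j)(k := 1)) j) = 0"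
        using r0[OF \<open>i \<in> I\<close>] insert.hyps by (simp add: r_def sum_negf)
    qed
    then show False by auto
  qed
  then obtain i0 where i0: "i0 \<in> I" "r i0 \<noteq> 0" by blast
  define \<beta> where "\<beta> i = (of_bool (i = i0) - (\<Sum>j\<in>J. A i0 j * B j i)) / r i0" for i
  have \<beta>: "(\<Sum>i\<in>I. \<beta> i * A i l) = (A i0 l - (\<Sum>j\<in>J. A i0 j * (\<Sum>i\<in>I. B j i * A i l))) / r i0" for l
  proof -
    have "(\<Sum>i\<in>I. \<beta> i * A i l) =
        (\<Sum>i\<in>I. of_bool (i = i0) * A i l - (\<Sum>j\<in>J. A i0 j * B j i) * A i l) / r i0"
      unfolding sum_divide_distrib by (intro sum.cong) (auto simp: \<beta>_def algebra_simps)
    also have "(\<Sum>i\<in>I. of_bool (i = i0) * A i l - (\<Sum>j\<in>J. A i0 j * B j i) * A i l) =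
        A i0 l - (\<Sum>i\<in>I. \<Sum>j\<in>J. A i0 j * B j i * A i l)"
      using i0(1) assms(1)
      by (simp add: sum_subtractf sum_distrib_right)
    also have "(\<Sum>i\<in>I. \<Sum>j\<in>J. A i0 j * B j i * A i l) = (\<Sum>j\<in>J. A i0 j * (\<Sum>i\<in>I. B j i * A i l))"
      by (subst sum.swap) (simp add: sum_distrib_left mult.assoc)
    finally show ?thesis .
  qed
  have \<beta>J: "(\<Sum>i\<in>I. \<beta> i * A i l) = 0" if "l \<in> J" for l
  proof -
    have "(\<Sum>j\<in>J. A i0 j * (\<Sum>i\<in>I. B j i * A i l)) = (\<Sum>j\<in>J. A i0 j * of_bool (j = l))"
      using B that by (intro sum.cong) auto
    also have "\<dots> = A i0 l" using that insert.hyps by (simp add: of_bool_def if_distrib sum.delta cong: if_cong)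
    finally show ?thesis by (simp add: \<beta>)
  qed
  have \<beta>k: "(\<Sum>i\<in>I. \<beta> i * A i k) = 1"
    unfolding \<beta> using i0 by (simp add: r_def t_def)
  define B' where "B' j i = (if j = k then \<beta> i else B j i - t j * \<beta> i)" for j i
  have "(\<Sum>i\<in>I. B' j i * A i j') = of_bool (j = j')" if "j \<in> insert k J" "j' \<in> insert k J" for j j'
  proof (cases "j = k")
    case True
    then show ?thesis using \<beta>J \<beta>k that insert.hyps by (auto simp: B'_def)
  next
    case False
    then have "(\<Sum>i\<in>I. B' j i * A i j') = (\<Sum>i\<in>I. B j i * A i j') - t j * (\<Sum>i\<in>I. \<beta> i * A i j')"
      by (simp add: B'_def algebra_simps sum_subtractf sum_distrib_left)
    then show ?thesis using \<beta>J \<beta>k that insert.hyps B False by (cases "j' = k") (auto simp: t_def)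
  qed
  then show ?case by blast
qed

section \<open>Young diagrams and their corners\<close>

text \<open>
  Diagrams with \<open>m\<close> boxes are given by the function of their row lengths. As functions they can be
  changed in one place, and the shape of a word is simply \<^term>\<open>count_list w\<close>.
\<close>

definition young :: "(nat \<Rightarrow> nat) \<Rightarrow> nat \<Rightarrow> bool" where
  "young \<mu> m \<longleftrightarrow> antimono \<mu> \<and> finite {r. \<mu> r \<noteq> 0} \<and> sum \<mu> {r. \<mu> r \<noteq> 0} = m"

definition add_box :: "(nat \<Rightarrow> nat) \<Rightarrow> nat \<Rightarrow> nat \<Rightarrow> nat" where
  "add_box \<mu> p = \<mu>(p := Suc (\<mu> p))"

definition del_box :: "(nat \<Rightarrow> nat) \<Rightarrow> nat \<Rightarrow> nat \<Rightarrow> nat" where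
  "del_box \<mu> q = \<mu>(q := \<mu> q - 1)"

definition removable :: "(nat \<Rightarrow> nat) \<Rightarrow> nat set" where
  "removable \<mu> = {q. \<mu> (Suc q) < \<mu> q}"

text \<open>
  A box can be added to the row below a corner, and to row 0. This form makes
  \<open>card_addable\<close> immediate.
\<close>

definition addable :: "(nat \<Rightarrow> nat) \<Rightarrow> nat set" where
  "addable \<mu> = insert 0 (Suc ` removable \<mu>)"

text \<open>
  The content of the box that is added to row \<open>r\<close> of \<open>\<mu>\<close>.
\<close>

definition content :: "(nat \<Rightarrow> nat) \<Rightarrow> nat \<Rightarrow> int" where
  "content \<mu> r = int (\<mu> r) - int r"

lemma antimonoD_Suc: "antimono (\<mu> :: nat \<Rightarrow> nat) \<Longrightarrow> \<mu> (Suc r) \<le> \<mu> r"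
  by (simp add: antimono_iff_le_Suc)

lemma youngD: "young \<mu> m \<Longrightarrow> r \<le> s \<Longrightarrow> \<mu> s \<le> \<mu> r"
  by (auto simp: young_def antimono_def)

lemma young_sum:
  assumes "finite S" "{r. \<mu> r \<noteq> 0} \<subseteq> S"
  shows "sum \<mu> S = sum \<mu> {r. \<mu> r \<noteq> 0}"
  by (rule sum.mono_neutral_right) (use assms in auto)

lemma mem_addable: "p \<in> addable \<mu> \<longleftrightarrow> (p = 0 \<or> \<mu> p < \<mu> (p - 1))"
  by (cases p) (auto simp: addable_def removable_def)

lemma antimono_add_box: "antimono \<mu> \<Longrightarrow> antimono (add_box \<mu> p) \<longleftrightarrow> p \<in> addable \<mu>"
  unfolding antimono_iff_le_Suc add_box_def mem_addable
  by (cases p) (force simp: Suc_le_eq not_less_eq_eq le_Suc_eq split: if_splits)+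

lemma antimono_del_box: "antimono \<mu> \<Longrightarrow> q \<in> removable \<mu> \<Longrightarrow> antimono (del_box \<mu> q)"
  unfolding antimono_iff_le_Suc del_box_def removable_def
  by (auto simp: le_diff_conv intro: le_SucI)

lemma young_add_box:
  assumes "young \<mu> m" "p \<in> addable \<mu>"
  shows "young (add_box \<mu> p) (Suc m)"
proof -
  let ?S = "insert p {r. \<mu> r \<noteq> 0}"
  have fin: "finite ?S" using assms by (simp add: young_def)
  have S: "{r. add_box \<mu> p r \<noteq> 0} \<subseteq> ?S" by (auto simp: add_box_def)
  have "sum (add_box \<mu> p) {r. add_box \<mu> p r \<noteq> 0} = sum (add_box \<mu> p) ?S"
    by (rule young_sum[symmetric]) (use fin S in auto)
  also have "\<dots> = Suc (\<mu> p) + sum (add_box \<mu> p) (?S - {p})"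
    using fin by (subst sum.remove[of _ p]) (auto simp: add_box_def)
  also have "sum (add_box \<mu> p) (?S - {p}) = sum \<mu> (?S - {p})"
    by (intro sum.cong) (auto simp: add_box_def)
  also have "Suc (\<mu> p) + \<dots> = Suc (sum \<mu> ?S)"
    using fin by (subst (2) sum.remove[of _ p]) auto
  also have "sum \<mu> ?S = m"
    using assms fin by (subst young_sum) (auto simp: young_def)
  finally show ?thesis
    using assms finite_subset[OF S fin] by (auto simp: young_def antimono_add_box)
qed

lemma add_del_box: "q \<in> removable \<mu> \<Longrightarrow> add_box (del_box \<mu> q) q = \<mu>"
  by (auto simp: add_box_def del_box_def removable_def fun_eq_iff)

lemma del_add_box: "del_box (add_box \<mu> p) p = \<mu>"
  by (auto simp: add_box_def del_box_def)

lemma del_add_box_commute: "p \<noteq> q \<Longrightarrow> del_box (add_box \<mu> p) q = add_box (del_box \<mu> q) p"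
  by (auto simp: add_box_def del_box_def)

lemma addable_del_box: "antimono \<mu> \<Longrightarrow> q \<in> removable \<mu> \<Longrightarrow> q \<in> addable (del_box \<mu> q)"
  using antimono_add_box[of "del_box \<mu> q" q] antimono_del_box[of \<mu> q] by (simp add: add_del_box)

lemma removable_finite: "finite {r. \<mu> r \<noteq> 0} \<Longrightarrow> finite (removable \<mu>)"
  by (rule finite_subset[rotated]) (auto simp: removable_def)

lemma young_del_box:
  assumes "young \<mu> (Suc m)" "q \<in> removable \<mu>"
  shows "young (del_box \<mu> q) m"
proof -
  have mono: "antimono (del_box \<mu> q)" using assms by (auto simp: young_def antimono_del_box)
  have fin: "finite {r. del_box \<mu> q r \<noteq> 0}"
    by (rule finite_subset[of _ "{r. \<mu> r \<noteq> 0}"]) (use assms in \<open>auto simp: young_def del_box_def\<close>)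
  then have "young (del_box \<mu> q) (sum (del_box \<mu> q) {r. del_box \<mu> q r \<noteq> 0})" using mono by (simp add: young_def)
  then have "young (add_box (del_box \<mu> q) q) (Suc (sum (del_box \<mu> q) {r. del_box \<mu> q r \<noteq> 0}))"
    using addable_del_box[of \<mu> q] assms by (intro young_add_box) (auto simp: young_def)
  with assms have "m = sum (del_box \<mu> q) {r. del_box \<mu> q r \<noteq> 0}" by (simp add: young_def add_del_box)
  then show ?thesis using mono fin by (simp add: young_def)
qed

lemma young_0: "young \<mu> 0 \<longleftrightarrow> \<mu> = (\<lambda>_. 0)"
  by (auto simp: young_def fun_eq_iff antimono_def)

lemma removable_0 [simp]: "removable (\<lambda>_. 0) = {}"
  by (simp add: removable_def)

text \<open>
  The diamond property of Young's lattice: for \<open>p \<noteq> q\<close>, the two ways from \<open>\<mu>\<close> to the diagram with a box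
  more in row \<open>p\<close> and a box less in row \<open>q\<close> are possible or impossible together.
\<close>

lemma corner_swap:
  assumes "antimono \<mu>" "p \<noteq> q"
  shows "p \<in> addable \<mu> \<and> q \<in> removable (add_box \<mu> p) \<longleftrightarrow> q \<in> removable \<mu> \<and> p \<in> addable (del_box \<mu> q)"
proof -
  have 1: "\<mu> (Suc q) \<le> \<mu> q" using assms by (rule_tac antimonoD_Suc)
  have 2: "\<mu> p \<le> \<mu> (p - 1)" using assms by (simp add: antimono_def)
  show ?thesis
    using assms(2) 1 2 by (cases p) (auto simp: mem_addable removable_def add_box_def del_box_def)
qed

section \<open>Words in place of standard tableaux\<close>

text \<open>
  The words of standard tableaux: letter \<open>i\<close>, counted from the end and from 1, is the row of the entry \<open>i\<close>. The
  suffixes of the word are the words of the restrictions to \<open>{1..i}\<close>.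
\<close>

fun ballot :: "nat list \<Rightarrow> bool" where
  "ballot [] = True"
| "ballot (x # w) \<longleftrightarrow> ballot w \<and> x \<in> addable (count_list w)"

definition words :: "(nat \<Rightarrow> nat) \<Rightarrow> nat list set" where
  "words \<mu> = {w. ballot w \<and> count_list w = \<mu>}"

lemma count_list_Cons: "count_list (x # w) = add_box (count_list w) x"
  by (auto simp: add_box_def)

declare count_list.simps(2) [simp del]

lemma ballot_young: "ballot w \<Longrightarrow> young (count_list w) (length w)"
proof (induction w)
  case Nil
  then show ?case by (simp add: young_def monotone_def)
next
  case (Cons x w)
  then show ?case by (auto simp: count_list_Cons intro: young_add_box)
qed

lemma words_young: "w \<in> words \<mu> \<Longrightarrow> young \<mu> (length w)"
  using ballot_young by (auto simp: words_def)

lemma young_unique: "young \<mu> m \<Longrightarrow> young \<mu> n \<Longrightarrow> m = n"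
  by (auto simp: young_def)

lemma length_words: "w \<in> words \<mu> \<Longrightarrow> young \<mu> m \<Longrightarrow> length w = m"
  using words_young young_unique by blast

lemma removable_add_box: "antimono \<mu> \<Longrightarrow> p \<in> addable \<mu> \<Longrightarrow> p \<in> removable (add_box \<mu> p)"
  using antimonoD_Suc[of \<mu> p] by (auto simp: removable_def add_box_def)

lemma Cons_in_words:
  assumes "young \<mu> m"
  shows "x # w \<in> words \<mu> \<longleftrightarrow> x \<in> removable \<mu> \<and> w \<in> words (del_box \<mu> x)"
proof
  assume "x # w \<in> words \<mu>"
  then have w: "ballot w" "x \<in> addable (count_list w)" "\<mu> = add_box (count_list w) x"
    by (auto simp: words_def count_list_Cons)
  then show "x \<in> removable \<mu> \<and> w \<in> words (del_box \<mu> x)"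
    using ballot_young[OF w(1)] by (auto simp: words_def del_add_box young_def intro: removable_add_box)
next
  assume *: "x \<in> removable \<mu> \<and> w \<in> words (del_box \<mu> x)"
  then show "x # w \<in> words \<mu>"
    using assms addable_del_box[of \<mu> x] 
    by (auto simp: words_def count_list_Cons add_del_box young_def)
qed

lemma finite_removable: "young \<mu> m \<Longrightarrow> finite (removable \<mu>)"
  by (rule removable_finite) (simp add: young_def)

lemma words_0: "words (\<lambda>_. 0) = {[]}"
proof -
  have "w = []" if "w \<in> words (\<lambda>_. 0)" for w
    using length_words[OF that, of 0] by (simp add: young_0)
  then show ?thesis by (auto simp: words_def)
qed

lemma words_Suc:
  assumes "young \<mu> (Suc m)"
  shows "words \<mu> = (\<Union>x\<in>removable \<mu>. (#) x ` words (del_box \<mu> x))"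
proof -
  have "w \<noteq> []" if "w \<in> words \<mu>" for w using length_words[OF that assms] by auto
  then show ?thesis
    using Cons_in_words[OF assms] by (auto simp: neq_Nil_conv image_iff) metis
qed

lemma finite_words: "young \<mu> m \<Longrightarrow> finite (words \<mu>)"
proof (induction m arbitrary: \<mu>)
  case 0
  then show ?case by (simp add: young_0 words_0)
next
  case (Suc m)
  then show ?case
    by (auto simp: words_Suc intro!: finite_UN_I finite_imageI Suc.IH young_del_box finite_removable)
qed

lemma card_words_Suc:
  assumes "young \<mu> (Suc m)"
  shows "card (words \<mu>) = (\<Sum>x\<in>removable \<mu>. card (words (del_box \<mu> x)))"
proof -
  have "card (words \<mu>) = (\<Sum>x\<in>removable \<mu>. card ((#) x ` words (del_box \<mu> x)))"
    unfolding words_Suc[OF assms] using assms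
    by (intro card_UN_disjoint) (auto intro: finite_removable finite_imageI finite_words young_del_box)
  also have "\<dots> = (\<Sum>x\<in>removable \<mu>. card (words (del_box \<mu> x)))"
    by (intro sum.cong) (auto intro!: card_image)
  finally show ?thesis .
qed

lemma finite_addable: "young \<mu> m \<Longrightarrow> finite (addable \<mu>)"
  by (simp add: addable_def finite_removable)

lemma card_addable: "young \<mu> m \<Longrightarrow> card (addable \<mu>) = Suc (card (removable \<mu>))"
  unfolding addable_def by (subst card_insert_disjoint) (auto simp: card_image finite_removable)

text \<open>
  The dimension of the module induced from \<open>S\<^sub>m\<close> to \<open>S\<^sub>m\<^sub>+\<^sub>1\<close>. Count the words with the last box added
  in row \<open>p\<close> by the row \<open>q\<close> of their first letter. For \<open>p = q\<close> there are \<open>card (words \<mu>)\<close> of them,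
  for each addable \<open>p\<close>. By the diamond property, those with \<open>p \<noteq> q\<close> correspond to first removing
  \<open>q\<close> and then adding \<open>p \<noteq> q\<close>, and the induction hypothesis counts these. The surplus comes
  from there being one more addable row than removable ones.
\<close>

lemma sum_card_words_add_box:
  "young \<mu> m \<Longrightarrow> (\<Sum>p\<in>addable \<mu>. card (words (add_box \<mu> p))) = Suc m * card (words \<mu>)"
proof (induction m arbitrary: \<mu>)
  case 0
  then have \<mu>: "\<mu> = (\<lambda>_. 0)" by (simp add: young_0)
  have "addable \<mu> = {0}" by (simp add: addable_def \<mu>)
  moreover have "removable (add_box \<mu> 0) = {0}" by (auto simp: removable_def add_box_def \<mu>)
  moreover have "young (add_box \<mu> 0) (Suc 0)" using young_add_box[OF 0, of 0] by (simp add: addable_def)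
  ultimately show ?case by (simp add: card_words_Suc del_add_box)
next
  case (Suc m)
  let ?d = "\<lambda>\<mu>. card (words \<mu>)"
  have anti: "antimono \<mu>" using Suc.prems by (simp add: young_def)
  let ?S = "\<lambda>p. removable (add_box \<mu> p) - {p}" and ?T = "\<lambda>q. addable (del_box \<mu> q) - {q}"
  have fr: "finite (removable \<mu>)" using Suc.prems by (rule finite_removable)
  have fa: "finite (addable \<mu>)" using Suc.prems by (rule finite_addable)
  have A: "?d (add_box \<mu> p) = ?d \<mu> + (\<Sum>q\<in>?S p. ?d (add_box (del_box \<mu> q) p))" if p: "p \<in> addable \<mu>" for p
  proof -
    have "?d (add_box \<mu> p) = (\<Sum>q\<in>removable (add_box \<mu> p). ?d (del_box (add_box \<mu> p) q))"
      using young_add_box[OF Suc.prems p] by (rule card_words_Suc)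
    also have "\<dots> = ?d \<mu> + (\<Sum>q\<in>?S p. ?d (del_box (add_box \<mu> p) q))"
      using finite_removable[OF young_add_box[OF Suc.prems p]] removable_add_box[OF anti p]
      by (subst sum.remove[of _ p]) (auto simp: del_add_box)
    also have "(\<Sum>q\<in>?S p. ?d (del_box (add_box \<mu> p) q)) = (\<Sum>q\<in>?S p. ?d (add_box (del_box \<mu> q) p))"
      by (intro sum.cong) (auto simp: del_add_box_commute)
    finally show ?thesis .
  qed
  have B: "Suc m * ?d (del_box \<mu> q) = ?d \<mu> + (\<Sum>p\<in>?T q. ?d (add_box (del_box \<mu> q) p))" if q: "q \<in> removable \<mu>" for q
  proof -
    have "Suc m * ?d (del_box \<mu> q) = (\<Sum>p\<in>addable (del_box \<mu> q). ?d (add_box (del_box \<mu> q) p))"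
      using Suc.IH[OF young_del_box[OF Suc.prems q]] by simp
    also have "\<dots> = ?d \<mu> + (\<Sum>p\<in>?T q. ?d (add_box (del_box \<mu> q) p))"
      using finite_addable[OF young_del_box[OF Suc.prems q]] addable_del_box[OF anti q]
      by (subst sum.remove[of _ q]) (auto simp: add_del_box q)
    finally show ?thesis .
  qed
  have "(\<Sum>p\<in>addable \<mu>. ?d (add_box \<mu> p)) =
      card (addable \<mu>) * ?d \<mu> + (\<Sum>p\<in>addable \<mu>. \<Sum>q\<in>?S p. ?d (add_box (del_box \<mu> q) p))"
    using A by (simp add: sum.distrib)
  also have "(\<Sum>p\<in>addable \<mu>. \<Sum>q\<in>?S p. ?d (add_box (del_box \<mu> q) p)) =
      (\<Sum>q\<in>removable \<mu>. \<Sum>p\<in>?T q. ?d (add_box (del_box \<mu> q) p))"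
  proof -
    have "finite (?S p)" if "p \<in> addable \<mu>" for p
      using finite_removable[OF young_add_box[OF Suc.prems that]] by simp
    moreover have "finite (?T q)" if "q \<in> removable \<mu>" for q
      using finite_addable[OF young_del_box[OF Suc.prems that]] by simp
    moreover have "(p \<in> addable \<mu> \<and> q \<in> ?S p) \<longleftrightarrow> (q \<in> removable \<mu> \<and> p \<in> ?T q)" for p q
      using corner_swap[OF anti, of p q] by auto
    ultimately show ?thesis
      using fa fr by (simp add: sum.Sigma) (rule sum.reindex_bij_witness[of _ prod.swap prod.swap], auto, metis+)
  qed
  finally have 1: "(\<Sum>p\<in>addable \<mu>. ?d (add_box \<mu> p)) = card (addable \<mu>) * ?d \<mu> + \<dots>" .
  have "Suc m * ?d \<mu> = (\<Sum>q\<in>removable \<mu>. Suc m * ?d (del_box \<mu> q))"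
    by (simp add: card_words_Suc[OF Suc.prems] sum_distrib_left)
  also have "\<dots> = card (removable \<mu>) * ?d \<mu> + (\<Sum>q\<in>removable \<mu>. \<Sum>p\<in>?T q. ?d (add_box (del_box \<mu> q) p))"
    using B by (simp add: sum.distrib)
  finally show ?case
    using 1 by (simp add: card_addable[OF Suc.prems])
qed

lemma sum_distinct_ge: "finite (A :: nat set) \<Longrightarrow> card A * (card A - 1) \<le> 2 * \<Sum> A"
proof (induction "card A" arbitrary: A)
  case (Suc k)
  let ?M = "Max A"
  have M: "?M \<in> A" using Suc by (intro Max_in) auto
  have "A \<subseteq> {..?M}" using Suc by auto
  then have "card A \<le> card {..?M}" by (intro card_mono) auto
  then have "card A \<le> Suc ?M" by simp
  moreover have c: "card (A - {?M}) = k" using Suc M by simp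
  moreover have "k * (k - 1) \<le> 2 * \<Sum> (A - {?M})" using Suc.hyps(1)[of "A - {?M}"] c Suc.prems by simp
  moreover have "\<Sum> A = ?M + \<Sum> (A - {?M})" using M Suc.prems by (simp add: sum.remove)
  moreover have "card A = Suc k" using Suc by simp
  ultimately have "k \<le> ?M" "k * (k - 1) + 2 * k \<le> 2 * \<Sum> A" by linarith+
  moreover have "k * (k - 1) + 2 * k = card A * (card A - 1)"
    using \<open>card A = Suc k\<close> by (cases k) (auto simp: algebra_simps)
  ultimately show ?case by simp
qed simp

text \<open>
  The row lengths at the corners are distinct and positive, so \<open>r\<close> corners need \<open>r (r + 1) / 2\<close> boxes.
\<close>

lemma corners_bound:
  assumes "young \<mu> m"
  shows "(Suc (card (removable \<mu>)))\<^sup>2 \<le> 3 * m + 1"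
proof -
  let ?R = "removable \<mu>" let ?r = "card ?R"
  have inj: "inj_on \<mu> ?R"
  proof (rule linorder_inj_onI)
    fix x y assume "x < y" "x \<in> ?R" "y \<in> ?R"
    then show "\<mu> x \<noteq> \<mu> y" using youngD[OF assms, of "Suc x" y] by (auto simp: removable_def)
  qed auto
  have fin: "finite ?R" using assms by (rule finite_removable)
  \<comment> \<open>Without the element \<open>0\<close> the lemma on distinct numbers would only give \<open>r (r - 1) \<le> 2 m\<close>.\<close>
  let ?A = "insert 0 (\<mu> ` ?R)"
  have "0 \<notin> \<mu> ` ?R" by (auto simp: removable_def)
  then have "card ?A = Suc ?r" using fin inj by (simp add: card_image)
  moreover have "\<Sum> ?A = sum \<mu> ?R"
    using \<open>0 \<notin> \<mu> ` ?R\<close> fin inj by (simp add: sum.reindex)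
  moreover have "sum \<mu> ?R \<le> m"
    using assms unfolding young_def by (auto intro!: sum_mono2 simp: removable_def)
  ultimately have 1: "Suc ?r * ?r \<le> 2 * m" using sum_distinct_ge[of ?A] fin by simp
  have "?r \<le> Suc ?r * ?r div 2"
    by (cases ?r) (auto simp: algebra_simps div_le_mono less_eq_div_iff_mult_less_eq)
  then have "?r \<le> m" using 1 by linarith
  then show ?thesis using 1 by (simp add: power2_eq_square)
qed

section \<open>Action of the coset representatives\<close>

text \<open>
  The content of the box that is added to row \<open>p\<close> of \<open>\<mu>\<close>, minus that of the last box in row \<open>q\<close> of \<open>\<mu>\<close>.
\<close>

definition axial :: "(nat \<Rightarrow> nat) \<Rightarrow> nat \<Rightarrow> nat \<Rightarrow> int" where
  "axial \<mu> p q = content \<mu> p - content (del_box \<mu> q) q"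

text \<open>
  Young's formula for the transposition of the two largest entries, applied to the vector with
  coordinates \<open>v\<close>. For \<open>x = y\<close> the axial distance is 1 and the word equals its swapped version,
  although the swapped tableau is not standard; therefore \<open>x \<noteq> y\<close> is required in the second
  summand.
\<close>

definition swap_top :: "young_form \<Rightarrow> (nat list \<Rightarrow> complex) \<Rightarrow> nat list \<Rightarrow> complex" where
  "swap_top F v w = (case w of
     x # y # u \<Rightarrow>
       v w / of_int (axial (count_list (y # u)) x y) +
       (if x \<noteq> y \<and> ballot (y # x # u)
        then swap_coeff F (axial (count_list (x # u)) y x) * v (y # x # u) else 0)
   | _ \<Rightarrow> v w)"

text \<open>
  The action of \<open>s\<^sub>m\<^sub>+\<^sub>1\<^sub>-\<^sub>d \<dots> s\<^sub>m\<close>, with \<open>d\<close> factors, in words of length \<open>m + 1\<close>. Its rightmost factor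
  acts first and moves the two largest entries. The other factors fix the largest entry, so they leave the first
  letter alone and form the same element for words of length \<open>m\<close>. The value for the empty word is a dummy.
\<close>

fun cyc_act :: "young_form \<Rightarrow> nat \<Rightarrow> (nat list \<Rightarrow> complex) \<Rightarrow> nat list \<Rightarrow> complex" where
  "cyc_act F 0 v w = v w"
| "cyc_act F (Suc d) v [] = 0"
| "cyc_act F (Suc d) v (q # w) = cyc_act F d (\<lambda>w'. swap_top F v (q # w')) w"

text \<open>
  The inclusion of \<open>V\<^sub>\<mu>\<close> in \<open>V\<^sub>\<lambda>\<close>, where \<open>\<lambda>\<close> is \<open>\<mu>\<close> with a box added to row \<open>p\<close>.
\<close>

definition embed :: "nat \<Rightarrow> (nat list \<Rightarrow> complex) \<Rightarrow> nat list \<Rightarrow> complex" where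
  "embed p v w = (case w of [] \<Rightarrow> 0 | x # u \<Rightarrow> if x = p then v u else 0)"

text \<open>
  The vector \<open>v\<^sub>\<lambda> = (\<Sum>i. t\<^sub>i F\<^sub>i)\<close> with \<open>i = m + 1 - d\<close> and \<open>F\<^sub>i = G d\<close>, for the diagram \<open>\<lambda>\<close> with a box
  more than \<open>\<mu>\<close> in row \<open>p\<close>. If \<open>\<mu>\<close> has \<open>m\<close> boxes, then \<open>M = m + 1\<close> gives the sum over all cosets.
\<close>

definition coset_sum :: "young_form \<Rightarrow> nat \<Rightarrow> nat \<Rightarrow> (nat \<Rightarrow> nat list \<Rightarrow> complex) \<Rightarrow> nat list \<Rightarrow> complex" where
  "coset_sum F M p G w = (\<Sum>d<M. cyc_act F d (embed p (G d)) w)"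

lemma add_box_commute: "add_box (add_box \<mu> p) q = add_box (add_box \<mu> q) p"
  by (auto simp: add_box_def)

lemma swap_top_linear:
  assumes "finite I"
  shows "swap_top F (\<lambda>w. \<Sum>i\<in>I. a i * v i w) w = (\<Sum>i\<in>I. a i * swap_top F (v i) w)"
  using assms
  by (auto simp: swap_top_def sum_divide_distrib sum_distrib_left sum.distrib distrib_left mult_ac
      split: list.split intro!: sum.cong)

lemma cyc_act_linear:
  assumes "finite I"
  shows "cyc_act F d (\<lambda>w. \<Sum>i\<in>I. a i * v i w) w = (\<Sum>i\<in>I. a i * cyc_act F d (v i) w)"
  using assms
proof (induction d arbitrary: v w)
  case (Suc d)
  then show ?case by (cases w) (simp_all add: swap_top_linear)
qed simp

text \<open>
  The modules of different diagrams do not mix. The scalars in Young's formula depend on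
  the word only through the diagram, so this lemma lets them be treated as constants.
\<close>

lemma cyc_act_cong:
  assumes "\<And>u. ballot u \<Longrightarrow> count_list u = count_list w \<Longrightarrow> v u = v' u" and "ballot w"
  shows "cyc_act F d v w = cyc_act F d v' w"
  using assms
proof (induction d arbitrary: v v' w)
  case (Suc d)
  show ?case
  proof (cases w)
    case (Cons q w')
    have "swap_top F v (q # u) = swap_top F v' (q # u)"
      if u: "ballot u" "count_list u = count_list w'" for u
    proof -
      have "ballot (q # u)" "count_list (q # u) = count_list w"
        using u Suc.prems(2) Cons by (auto simp: count_list_Cons)
      then have "v (q # u) = v' (q # u)" using Suc.prems(1) by blast
      moreover have "v (y # q # u') = v' (y # q # u')" if "u = y # u'" "ballot (y # q # u')" for y u'
        using Suc.prems(1)[of "y # q # u'"] that u(2) Cons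
        by (simp add: count_list_Cons add_box_commute[of _ q y])
      ultimately show ?thesis by (auto simp: swap_top_def split: list.split)
    qed
    then have "cyc_act F d (\<lambda>u. swap_top F v (q # u)) w' = cyc_act F d (\<lambda>u. swap_top F v' (q # u)) w'"
      using Suc.prems(2) Cons by (intro Suc.IH) auto
    then show ?thesis by (simp add: Cons)
  qed simp
qed simp

lemma cyc_act_0: "cyc_act F d (\<lambda>_. 0) w = 0"
  using cyc_act_linear[of "{}" F d "\<lambda>_. 0" "\<lambda>_ _. 0" w] by simp

lemma cyc_act_scale: "cyc_act F d (\<lambda>w. a * v w) w = a * cyc_act F d v w"
  using cyc_act_linear[of "{()}" F d "\<lambda>_. a" "\<lambda>_. v" w] by simp

text \<open>
  The component of \<open>v\<^sub>\<lambda>\<close> in \<open>V\<^sub>\<mu>\<close>: the summand \<open>d = 0\<close> contributes \<open>G 0\<close>, and in the others only the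
  diagonal part of \<open>s\<^sub>m\<close> stays in \<open>V\<^sub>\<mu>\<close>. It divides the part of \<open>G (Suc d)\<close> with first letter \<open>y\<close> by the axial
  distance; the sums that remain belong to \<open>\<mu>\<close> with a box removed from row \<open>y\<close>.
\<close>

lemma coset_sum_same_row:
  assumes \<mu>: "young \<mu> m" and w: "w \<in> words \<mu>" and M: "M \<le> m"
  shows "coset_sum F (Suc M) p G (p # w) = G 0 w +
    (\<Sum>y\<in>removable \<mu>. coset_sum F M y (\<lambda>d u. G (Suc d) (y # u)) w / of_int (axial \<mu> p y))"
proof -
  let ?a = "\<lambda>y. 1 / of_int (axial \<mu> p y) :: complex"
  have fin: "finite (removable \<mu>)" using \<mu> by (rule finite_removable)
  have len: "length w = m" using length_words[OF w \<mu>] .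
  have "cyc_act F (Suc d) (embed p (G (Suc d))) (p # w) =
      (\<Sum>y\<in>removable \<mu>. ?a y * cyc_act F d (embed y (\<lambda>u. G (Suc d) (y # u))) w)" if dM: "d < M" for d
  proof -
    have "cyc_act F (Suc d) (embed p (G (Suc d))) (p # w) =
        cyc_act F d (\<lambda>w'. \<Sum>y\<in>removable \<mu>. ?a y * embed y (\<lambda>u. G (Suc d) (y # u)) w') w"
      unfolding cyc_act.simps
    proof (rule cyc_act_cong)
      show "ballot w" using w by (simp add: words_def)
      fix u assume "ballot u" "count_list u = count_list w"
      then have u: "u \<in> words \<mu>" using w by (simp add: words_def)
      then have "length u = m" using length_words \<mu> by blast
      then obtain x u' where ux: "u = x # u'" using dM M by (cases u) auto
      then have x: "x \<in> removable \<mu>" using u Cons_in_words[OF \<mu>] by simp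
      have "swap_top F (embed p (G (Suc d))) (p # u) = ?a x * G (Suc d) (x # u')"
        using u by (auto simp: swap_top_def ux embed_def words_def)
      also have "\<dots> = (\<Sum>y\<in>removable \<mu>. if y = x then ?a x * G (Suc d) (x # u') else 0)"
        using x fin by simp
      also have "\<dots> = (\<Sum>y\<in>removable \<mu>. ?a y * embed y (\<lambda>u. G (Suc d) (y # u)) u)"
        by (intro sum.cong) (auto simp: ux embed_def)
      finally show "swap_top F (embed p (G (Suc d))) (p # u) = \<dots>" .
    qed
    also have "\<dots> = (\<Sum>y\<in>removable \<mu>. ?a y * cyc_act F d (embed y (\<lambda>u. G (Suc d) (y # u))) w)"
      by (rule cyc_act_linear[OF fin])
    finally show ?thesis .
  qed
  then have "coset_sum F (Suc M) p G (p # w) = embed p (G 0) (p # w) +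
      (\<Sum>d<M. \<Sum>y\<in>removable \<mu>. ?a y * cyc_act F d (embed y (\<lambda>u. G (Suc d) (y # u))) w)"
    unfolding coset_sum_def sum.lessThan_Suc_shift by simp
  also have "(\<Sum>d<M. \<Sum>y\<in>removable \<mu>. ?a y * cyc_act F d (embed y (\<lambda>u. G (Suc d) (y # u))) w) =
      (\<Sum>y\<in>removable \<mu>. coset_sum F M y (\<lambda>d u. G (Suc d) (y # u)) w / of_int (axial \<mu> p y))"
    by (subst sum.swap) (simp add: coset_sum_def sum_distrib_left sum_divide_distrib)
  finally show ?thesis by (simp add: embed_def)
qed

text \<open>
  A word of \<open>v\<^sub>\<lambda>\<close> that starts with \<open>q \<noteq> p\<close> can only come from the off-diagonal part of \<open>s\<^sub>m\<close>, which
  exchanges \<open>p\<close> with \<open>q\<close>.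
\<close>

lemma coset_sum_other_row:
  assumes \<mu>: "young \<mu> m" and p: "p \<in> addable \<mu>" and q: "q \<noteq> p" "q \<in> removable (add_box \<mu> p)"
    and w: "w \<in> words (del_box (add_box \<mu> p) q)"
  shows "coset_sum F (Suc M) p G (q # w) =
    swap_coeff F (axial \<mu> p q) * coset_sum F M p (\<lambda>d u. G (Suc d) (q # u)) w"
proof -
  have anti: "antimono \<mu>" using \<mu> by (simp add: young_def)
  have q': "q \<in> removable \<mu>" "p \<in> addable (del_box \<mu> q)"
    using corner_swap[OF anti, of p q] p q by auto
  have "cyc_act F (Suc d) (embed p (G (Suc d))) (q # w) =
      swap_coeff F (axial \<mu> p q) * cyc_act F d (embed p (\<lambda>u. G (Suc d) (q # u))) w" for d
  proof -
    have "cyc_act F (Suc d) (embed p (G (Suc d))) (q # w) =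
        cyc_act F d (\<lambda>u. swap_coeff F (axial \<mu> p q) * embed p (\<lambda>u. G (Suc d) (q # u)) u) w"
      unfolding cyc_act.simps
    proof (rule cyc_act_cong)
      show "ballot w" using w by (simp add: words_def)
      fix u assume "ballot u" "count_list u = count_list w"
      then have u: "u \<in> words (add_box (del_box \<mu> q) p)"
        using w q by (simp add: words_def del_add_box_commute)
      have "add_box (del_box \<mu> q) p p \<noteq> 0" by (simp add: add_box_def)
      then have "u \<noteq> []" using u by (auto simp: words_def dest: fun_cong[of _ _ p])
      then obtain x u' where ux: "u = x # u'" by (cases u) auto
      have "swap_top F (embed p (G (Suc d))) (q # x # u') =
          (if x = p \<and> ballot (p # q # u')
           then swap_coeff F (axial (count_list (q # u')) p q) * G (Suc d) (q # u') else 0)"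
        using q by (auto simp: swap_top_def embed_def)
      moreover have "ballot (p # q # u') \<and> count_list (q # u') = \<mu>" if "x = p"
      proof -
        from u have "add_box (count_list u') p = add_box (del_box \<mu> q) p" "ballot u'"
          by (auto simp: words_def ux that count_list_Cons)
        then have "count_list u' = del_box \<mu> q" by (metis del_add_box)
        with q' p anti \<open>ballot u'\<close> show ?thesis
          by (auto simp: count_list_Cons add_del_box intro: addable_del_box)
      qed
      ultimately show "swap_top F (embed p (G (Suc d))) (q # u) =
          swap_coeff F (axial \<mu> p q) * embed p (\<lambda>u. G (Suc d) (q # u)) u"
        by (auto simp: ux embed_def)
    qed
    then show ?thesis by (simp only: cyc_act_scale)
  qed
  then show ?thesis
    unfolding coset_sum_def sum.lessThan_Suc_shift using q(1) by (simp add: embed_def sum_distrib_left)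
qed

lemma axial_nonzero:
  assumes "antimono \<mu>" "p \<in> addable \<mu>" "q \<in> removable \<mu>"
  shows "axial \<mu> p q \<noteq> 0"
proof -
  consider "p < q" | "p = q" | "Suc q = p" | "Suc q < p" by linarith
  note cases = this
  have mono: "r \<le> s \<Longrightarrow> \<mu> s \<le> \<mu> r" for r s using assms(1) by (simp add: antimono_def)
  have lt: "\<mu> (Suc q) < \<mu> q" using assms(3) by (simp add: removable_def)
  show "axial \<mu> p q \<noteq> 0"
    using cases mono[of p q] mono[of "Suc q" p] lt by (cases) (auto simp: axial_def content_def del_box_def)
qed

text \<open>
  Distinct boxes that can be added to the same diagram have contents that differ by at least 2, so
  Young's off-diagonal coefficients do not vanish.
\<close>

lemma axial_off_diagonal:
  assumes "antimono \<mu>" "p \<in> addable (del_box \<mu> q)" "q \<in> removable \<mu>" "p \<noteq> q"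
  shows "2 \<le> \<bar>axial \<mu> p q\<bar>"
proof -
  have mono: "r \<le> s \<Longrightarrow> \<mu> s \<le> \<mu> r" for r s using assms(1) by (simp add: antimono_def)
  have lt: "\<mu> (Suc q) < \<mu> q" using assms(3) by (simp add: removable_def)
  consider "p < q" | "q < p" using assms(4) by linarith
  then show ?thesis
  proof cases
    case 1
    then show ?thesis using mono[of p q] lt by (auto simp: axial_def content_def del_box_def)
  next
    case 2
    then have "\<mu> p \<le> \<mu> (Suc q)" using mono by simp
    moreover have "\<mu> p \<noteq> \<mu> q - 1 \<or> p \<noteq> Suc q"
      using assms(2,4) 2 by (auto simp: mem_addable del_box_def)
    ultimately show ?thesis using 2 lt by (auto simp: axial_def content_def del_box_def)
  qed
qed

lemma swap_coeff_nonzero: "2 \<le> \<bar>a\<bar> \<Longrightarrow> swap_coeff F a \<noteq> 0"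
proof (cases F)
  case Seminormal
  assume a: "2 \<le> \<bar>a\<bar>"
  have "1 + 1 / of_int a = (of_int (a + 1) / of_int a :: complex)"
    using a by (simp add: field_simps)
  also have "\<dots> \<noteq> 0" using a by (auto simp del: of_int_add)
  finally show ?thesis using Seminormal by simp
next
  case Orthogonal
  assume a: "2 \<le> \<bar>a\<bar>"
  have "1 \<noteq> a\<^sup>2" using a by (auto simp: power2_eq_1_iff eq_commute[of 1])
  then have "1 \<noteq> (real_of_int a)\<^sup>2" by (simp flip: of_int_power)
  then show ?thesis using Orthogonal a by simp
qed

section \<open>Inversion of the coset sums\<close>

text \<open>
  Multiplied by the common denominator, the function \<open>c0 + (\<Sum>j\<in>J. c j / (z - y j))\<close> of \<open>z\<close> becomes a
  polynomial of degree at most \<open>card J\<close> with the roots \<open>x i\<close>; so it is \<open>0\<close>. Its value at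
  \<open>y j\<close> is a nonzero multiple of \<open>c j\<close>.
\<close>

lemma cauchy_kernel:
  fixes x :: "'i \<Rightarrow> complex"
  assumes "finite I" "finite J" "card J < card I" "inj_on x I" "inj_on y J"
    and ne: "\<And>i j. i \<in> I \<Longrightarrow> j \<in> J \<Longrightarrow> x i \<noteq> y j"
    and zero: "\<And>i. i \<in> I \<Longrightarrow> c0 + (\<Sum>j\<in>J. c j / (x i - y j)) = 0"
  shows "c0 = 0 \<and> (\<forall>j\<in>J. c j = 0)"
proof -
  define R where "R K = (\<Prod>j\<in>K. [:- y j, 1:])" for K
  define P where "P = smult c0 (R J) + (\<Sum>j\<in>J. smult (c j) (R (J - {j})))"
  have polyR: "poly (R K) z = (\<Prod>j\<in>K. z - y j)" for K z by (simp add: R_def poly_prod)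
  have degR: "degree (R K) \<le> card J" if "K \<subseteq> J" for K
  proof -
    have "degree (R K) \<le> (\<Sum>j\<in>K. degree [:- y j, 1:])"
      unfolding R_def using finite_subset[OF that assms(2)] degree_prod_sum_le[of K "\<lambda>j. [:- y j, 1:]"]
      by (simp add: o_def)
    also have "\<dots> = card K" by simp
    also have "\<dots> \<le> card J" by (rule card_mono[OF assms(2) that])
    finally show ?thesis .
  qed
  have deg: "degree P \<le> card J"
    unfolding P_def
    by (intro degree_add_le degree_sum_le assms(2) order.trans[OF degree_smult_le] degR) auto
  have root: "poly P (x i) = 0" if i: "i \<in> I" for i
  proof -
    have "poly P (x i) = (\<Prod>j\<in>J. x i - y j) * (c0 + (\<Sum>j\<in>J. c j / (x i - y j)))"
    proof -
      have "c j * (\<Prod>k\<in>J - {j}. x i - y k) = (\<Prod>j\<in>J. x i - y j) * (c j / (x i - y j))"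
        if "j \<in> J" for j
        using ne[OF i that] that assms(2) by (simp add: prod.remove[of J j])
      then show ?thesis
        by (simp add: P_def poly_sum polyR sum_distrib_left algebra_simps)
    qed
    then show ?thesis using zero[OF i] by simp
  qed
  have "P = 0"
  proof (rule ccontr)
    assume "P \<noteq> 0"
    then have "card {z. poly P z = 0} \<le> degree P" "finite {z. poly P z = 0}"
      by (auto simp: card_poly_roots_bound poly_roots_finite)
    moreover have "x ` I \<subseteq> {z. poly P z = 0}" using root by auto
    ultimately have "card (x ` I) \<le> card J" using deg by (meson card_mono order.trans)
    then show False using assms by (simp add: card_image)
  qed
  have c: "c j = 0" if j: "j \<in> J" for j
  proof -
    have "poly P (y j) = c j * (\<Prod>k\<in>J - {j}. y j - y k)"
    proof -
      have "(\<Sum>l\<in>J. c l * (\<Prod>k\<in>J - {l}. y j - y k)) =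
          (\<Sum>l\<in>J. if l = j then c j * (\<Prod>k\<in>J - {j}. y j - y k) else 0)"
      proof (intro sum.cong refl)
        fix l assume "l \<in> J"
        show "c l * (\<Prod>k\<in>J - {l}. y j - y k) = (if l = j then c j * (\<Prod>k\<in>J - {j}. y j - y k) else 0)"
          using j assms(2) by (auto intro!: prod_zero bexI[of _ j])
      qed
      moreover have "(\<Prod>k\<in>J. y j - y k) = 0" using j assms(2) by (auto intro!: prod_zero bexI[of _ j])
      ultimately show ?thesis using j assms(2) by (simp add: P_def poly_sum polyR)
    qed
    moreover have "(\<Prod>k\<in>J - {j}. y j - y k) \<noteq> 0"
      using assms(2,5) j by (auto dest: inj_onD)
    ultimately show ?thesis using \<open>P = 0\<close> by simp
  qed
  obtain i where "i \<in> I" using assms(3) by fastforce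
  then show ?thesis using zero[of i] c by simp
qed

text \<open>
  Row \<open>None\<close> of \<open>B\<close> extracts the term \<open>a\<close>, and row \<open>Some y\<close> the coefficient \<open>b y\<close>.
\<close>

lemma corner_matrix_left_inverse:
  assumes \<mu>: "young \<mu> m"
  shows "\<exists>B :: nat option \<Rightarrow> nat \<Rightarrow> complex. \<forall>j \<in> insert None (Some ` removable \<mu>). \<forall>a b.
    (\<Sum>p\<in>addable \<mu>. B j p * (a + (\<Sum>y\<in>removable \<mu>. b y / of_int (axial \<mu> p y)))) =
    (case j of None \<Rightarrow> a | Some y \<Rightarrow> b y)"
proof -
  \<comment> \<open>\<open>None\<close> indexes the column of ones.\<close>
  let ?J = "insert None (Some ` removable \<mu>)"
  let ?A = "\<lambda>p j. case j of None \<Rightarrow> 1 :: complex | Some y \<Rightarrow> 1 / of_int (axial \<mu> p y)"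
  have anti: "antimono \<mu>" using \<mu> by (simp add: young_def)
  have fin: "finite (removable \<mu>)" "finite (addable \<mu>)"
    using \<mu> finite_removable finite_addable by blast+
  have split: "(\<Sum>j\<in>?J. ?A p j * c j) = c None + (\<Sum>y\<in>removable \<mu>. c (Some y) / of_int (axial \<mu> p y))"
    for c p
    using fin by (subst sum.insert) (auto simp: sum.reindex)
  have "\<exists>B. \<forall>j\<in>?J. \<forall>j'\<in>?J. (\<Sum>p\<in>addable \<mu>. B j p * ?A p j') = of_bool (j = j')"
  proof (rule left_inverse_matrix)
    fix c assume c: "\<And>p. p \<in> addable \<mu> \<Longrightarrow> (\<Sum>j\<in>?J. ?A p j * c j) = 0"
    have "c None = 0 \<and> (\<forall>y\<in>removable \<mu>. c (Some y) = 0)"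
    proof (rule cauchy_kernel[of "addable \<mu>" "removable \<mu>" "\<lambda>p. of_int (content \<mu> p)"
          "\<lambda>y. of_int (content (del_box \<mu> y) y)"])
      show "card (removable \<mu>) < card (addable \<mu>)" using card_addable[OF \<mu>] by simp
      show "inj_on (\<lambda>p. of_int (content \<mu> p) :: complex) (addable \<mu>)"
      proof (rule linorder_inj_onI)
        fix r s :: nat assume "r < s"
        then have "content \<mu> r \<noteq> content \<mu> s" using youngD[OF \<mu>, of r s] by (simp add: content_def)
        then show "of_int (content \<mu> r) \<noteq> (of_int (content \<mu> s) :: complex)" by simp
      qed auto
      show "inj_on (\<lambda>y. of_int (content (del_box \<mu> y) y) :: complex) (removable \<mu>)"
      proof (rule linorder_inj_onI)
        fix r s :: nat assume "r < s" "r \<in> removable \<mu>"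
        then have "content (del_box \<mu> r) r \<noteq> content (del_box \<mu> s) s"
          using youngD[OF \<mu>, of r s] \<open>r \<in> removable \<mu>\<close> by (simp add: content_def del_box_def removable_def)
        then show "of_int (content (del_box \<mu> r) r) \<noteq> (of_int (content (del_box \<mu> s) s) :: complex)" by simp
      qed auto
      fix p assume p: "p \<in> addable \<mu>"
      show "of_int (content \<mu> p) \<noteq> (of_int (content (del_box \<mu> y) y) :: complex)" if "y \<in> removable \<mu>" for y
        using axial_nonzero[OF anti p that] by (simp add: axial_def)
      show "c None + (\<Sum>y\<in>removable \<mu>. c (Some y) / (of_int (content \<mu> p) - of_int (content (del_box \<mu> y) y))) = 0"
        using c[OF p] unfolding split by (simp add: axial_def)
    qed (use fin in auto)
    then show "\<forall>j\<in>?J. c j = 0" by auto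
  qed (use fin in auto)
  then obtain B where
    B: "\<And>j j'. j \<in> ?J \<Longrightarrow> j' \<in> ?J \<Longrightarrow> (\<Sum>p\<in>addable \<mu>. B j p * ?A p j') = of_bool (j = j')"
    by blast
  show ?thesis
  proof (intro exI[of _ B] ballI allI)
    fix j a and b :: "nat \<Rightarrow> complex" assume j: "j \<in> ?J"
    let ?c = "\<lambda>j. case j of None \<Rightarrow> a | Some y \<Rightarrow> b y"
    have "(\<Sum>p\<in>addable \<mu>. B j p * (a + (\<Sum>y\<in>removable \<mu>. b y / of_int (axial \<mu> p y)))) =
        (\<Sum>p\<in>addable \<mu>. B j p * (\<Sum>j'\<in>?J. ?A p j' * ?c j'))"
      by (subst split) simp
    also have "\<dots> = (\<Sum>j'\<in>?J. (\<Sum>p\<in>addable \<mu>. B j p * ?A p j') * ?c j')"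
      unfolding sum_distrib_left sum_distrib_right by (subst sum.swap) (simp only: mult.assoc)
    also have "\<dots> = (\<Sum>j'\<in>?J. if j' = j then ?c j else 0)"
      using B[OF j] by (intro sum.cong) auto
    also have "\<dots> = ?c j" using j fin by simp
    finally show "(\<Sum>p\<in>addable \<mu>. B j p * (a + (\<Sum>y\<in>removable \<mu>. b y / of_int (axial \<mu> p y)))) = ?c j" .
  qed
qed

text \<open>
  In the induction step, let \<open>\<mu>\<close> have \<open>m + 1\<close> boxes and \<open>D\<close> words. There are three contributions: at most
  \<open>(m + 2) D\<close> divisions by off-diagonal coefficients, one for each input; \<open>D\<close> multiplications
  by the left inverse of the corner matrix, of at most \<open>3 (m + 1) + 1\<close> operations each; and the recursive calls
  for all \<open>\<mu>\<close> minus a box, which add up to \<open>2 (m + 1)\<^sup>2 D\<close>. These bounds add up to \<open>2 (m + 2)\<^sup>2 D\<close>.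
\<close>

lemma costs_coset_sum:
  fixes G :: "nat \<Rightarrow> nat list \<Rightarrow> 'f \<Rightarrow> complex"
  assumes "young \<mu> m"
  shows "costs {\<lambda>f. coset_sum F (Suc m) p (\<lambda>d u. G d u f) w | p w. p \<in> addable \<mu> \<and> w \<in> words (add_box \<mu> p)}
    {G d u | d u. d \<le> m \<and> u \<in> words \<mu>} (2 * (Suc m)\<^sup>2 * card (words \<mu>))"
  using assms
proof (induction m arbitrary: \<mu> G)
  case 0
  then have \<mu>: "\<mu> = (\<lambda>_. 0)" by (simp add: young_0)
  have 1: "words \<mu> = {[]}" by (simp add: \<mu> words_0)
  have a: "0 \<in> addable \<mu>" by (simp add: addable_def)
  have "[0] \<in> words (add_box \<mu> 0)" by (auto simp: words_def count_list_Cons addable_def \<mu> fun_eq_iff add_box_def)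
  moreover have "(\<lambda>f. coset_sum F (Suc 0) 0 (\<lambda>d u. G d u f) [0]) = G 0 []"
    using coset_sum_same_row[OF 0 _ order.refl, of "[]" F 0] 1 by (auto simp: \<mu> fun_eq_iff)
  ultimately have "G 0 [] \<in> {\<lambda>f. coset_sum F (Suc 0) p (\<lambda>d u. G d u f) w | p w.
      p \<in> addable \<mu> \<and> w \<in> words (add_box \<mu> p)}"
    using a by (intro CollectI exI[of _ 0] exI[of _ "[0]"]) simp
  then have "{G 0 []} \<subseteq> {\<lambda>f. coset_sum F (Suc 0) p (\<lambda>d u. G d u f) w | p w.
      p \<in> addable \<mu> \<and> w \<in> words (add_box \<mu> p)}"
    by (simp only: insert_subset empty_subsetI simp_thms)
  moreover have "{G d u | d u. d \<le> 0 \<and> u \<in> words \<mu>} = {G 0 []}" by (auto simp: 1)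
  ultimately show ?case by (simp only: costs_free)
next
  case (Suc m)
  let ?d = "card (words \<mu>)" let ?R = "removable \<mu>" let ?A = "addable \<mu>"
  define V where "V p w = (\<lambda>f. coset_sum F (Suc (Suc m)) p (\<lambda>d u. G d u f) w)" for p w
  define H where "H q p w = (\<lambda>f. coset_sum F (Suc m) p (\<lambda>d u. G (Suc d) (q # u) f) w)" for q p w
  define S where "S = {V p w | p w. p \<in> ?A \<and> w \<in> words (add_box \<mu> p)}"
  have anti: "antimono \<mu>" using Suc.prems by (simp add: young_def)
  have fin: "finite ?A" "finite ?R" "finite (words \<mu>)"
    using Suc.prems finite_addable finite_removable finite_words by blast+
  have add_box_fin: "finite (words (add_box \<mu> p))" if "p \<in> ?A" for p
    using finite_words young_add_box[OF Suc.prems that] by blast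
  \<comment> \<open>\<open>T1\<close> and \<open>T2\<close> are the coset sums \<open>H q p w\<close> for the smaller diagrams, for \<open>q \<noteq> p\<close> and for \<open>q = p\<close>; \<open>T2\<close> also
    contains the vector of the trivial coset. \<open>T3\<close> is the result of the recursive calls.\<close>
  define T1 where "T1 = (\<lambda>(p, w). if hd w = p then {} else {H (hd w) p (tl w)})"
  define T2 where "T2 = (\<lambda>w. \<Union>j\<in>insert None (Some ` ?R). {case j of None \<Rightarrow> G 0 w | Some y \<Rightarrow> H y y w})"
  define T3 where "T3 = (\<lambda>y. {G (Suc d) (y # u) | d u. d \<le> m \<and> u \<in> words (del_box \<mu> y)})"

  obtain B :: "nat option \<Rightarrow> nat \<Rightarrow> complex" where
    B: "\<And>j a b. j \<in> insert None (Some ` ?R) \<Longrightarrow>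
       (\<Sum>p\<in>?A. B j p * (a + (\<Sum>y\<in>?R. b y / of_int (axial \<mu> p y)))) =
       (case j of None \<Rightarrow> a | Some y \<Rightarrow> b y)"
    using corner_matrix_left_inverse[OF Suc.prems] by metis
  have "costs S (\<Union>i\<in>(SIGMA p:?A. words (add_box \<mu> p)). T1 i) (Suc (Suc m) * ?d)"
  proof (rule costs_UN_le[where k = 1])
    show "finite (SIGMA p:?A. words (add_box \<mu> p))" using fin add_box_fin by auto
    show "card (SIGMA p:?A. words (add_box \<mu> p)) * 1 \<le> Suc (Suc m) * ?d"
      using fin add_box_fin sum_card_words_add_box[OF Suc.prems] by (simp add: card_SigmaI)
    fix i assume "i \<in> (SIGMA p:?A. words (add_box \<mu> p))"
    then obtain p w where i: "i = (p, w)" "p \<in> ?A" "w \<in> words (add_box \<mu> p)" by auto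
    have y: "young (add_box \<mu> p) (Suc (Suc m))" using young_add_box[OF Suc.prems i(2)] .
    then have "length w = Suc (Suc m)" using length_words i(3) by blast
    then obtain q w' where w: "w = q # w'" by (cases w) auto
    show "costs S (T1 i) 1"
    proof (cases "q = p")
      case True
      then show ?thesis by (simp add: T1_def i w costs_free)
    next
      case False
      let ?c = "swap_coeff F (axial \<mu> p q)"
      have q: "q \<in> removable (add_box \<mu> p)" "w' \<in> words (del_box (add_box \<mu> p) q)"
        using i(3) Cons_in_words[OF y] by (auto simp: w)
      then have "q \<in> ?R" "p \<in> addable (del_box \<mu> q)"
        using corner_swap[OF anti, of p q] i(2) False by auto
      then have "?c \<noteq> 0"
        using axial_off_diagonal[OF anti] False by (intro swap_coeff_nonzero) auto
      moreover have "V p w f = ?c * H q p w' f" for f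
        unfolding V_def H_def w using coset_sum_other_row[OF Suc.prems i(2) False q] .
      ultimately have "H q p w' = (\<lambda>f. 0 + (\<Sum>_\<in>{()}. inverse ?c * V p w f))"
        by (simp add: fun_eq_iff)
      then have "T1 i = {\<lambda>f. 0 + (\<Sum>_\<in>{()}. inverse ?c * V p w f)}"
        using False by (simp add: T1_def i(1) w)
      moreover have "costs S {\<lambda>f. 0 + (\<Sum>_\<in>{()}. inverse ?c * V p w f)} (card {()})"
        by (rule costs_sum) (use i in \<open>auto simp: S_def\<close>)
      ultimately show ?thesis by simp
    qed
  qed
  moreover have "costs S (\<Union>w\<in>words \<mu>. T2 w) ((3 * Suc m + 1) * ?d)"
  proof (rule costs_UN_le[where k = "3 * Suc m + 1"])
    fix w assume w: "w \<in> words \<mu>"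
    show "costs S (T2 w) (3 * Suc m + 1)"
      unfolding T2_def
    proof (rule costs_UN_le[where k = "card ?A"])
      have "card (insert None (Some ` ?R)) = Suc (card ?R)"
        using fin(2) by (subst card_insert_disjoint) (auto simp: card_image)
      then show "card (insert None (Some ` ?R)) * card ?A \<le> 3 * Suc m + 1"
        using corners_bound[OF Suc.prems] by (simp only: card_addable[OF Suc.prems] power2_eq_square)
      fix j assume j: "j \<in> insert None (Some ` ?R)"
      have pw: "p # w \<in> words (add_box \<mu> p)" if "p \<in> ?A" for p
        using w that by (auto simp: words_def count_list_Cons)
      have "(\<Sum>p\<in>?A. B j p * V p (p # w) f) = (case j of None \<Rightarrow> G 0 w f | Some y \<Rightarrow> H y y w f)" for f
      proof -
        have "(\<Sum>p\<in>?A. B j p * V p (p # w) f) =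
            (\<Sum>p\<in>?A. B j p * (G 0 w f + (\<Sum>y\<in>?R. H y y w f / of_int (axial \<mu> p y))))"
          unfolding V_def H_def using coset_sum_same_row[OF Suc.prems w order.refl] by (intro sum.cong) auto
        then show ?thesis using B[OF j, of "G 0 w f" "\<lambda>y. H y y w f"] by simp
      qed
      then have "(case j of None \<Rightarrow> G 0 w | Some y \<Rightarrow> H y y w) =
          (\<lambda>f. 0 + (\<Sum>p\<in>?A. B j p * V p (p # w) f))"
        by (auto simp: fun_eq_iff split: option.split)
      moreover have "costs S {\<lambda>f. 0 + (\<Sum>p\<in>?A. B j p * V p (p # w) f)} (card ?A)"
        by (rule costs_sum) (use pw fin in \<open>auto simp: S_def\<close>)
      ultimately show "costs S {case j of None \<Rightarrow> G 0 w | Some y \<Rightarrow> H y y w} (card ?A)" by simp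
    qed (use fin in auto)
  qed (use fin in auto)
  ultimately have S12: "costs S (\<Union> (T1 ` (SIGMA p:?A. words (add_box \<mu> p))) \<union> \<Union> (T2 ` words \<mu>))
      (Suc (Suc m) * ?d + (3 * Suc m + 1) * ?d)" (is "costs S ?T12 _")
    by (rule costs_trans[OF _ costs_mono]) auto

  have "costs (S \<union> ?T12) (\<Union>y\<in>?R. T3 y) (\<Sum>y\<in>?R. 2 * (Suc m)\<^sup>2 * card (words (del_box \<mu> y)))"
  proof (rule costs_UN[OF fin(2)])
    fix y assume y: "y \<in> ?R"
    have "costs {\<lambda>f. coset_sum F (Suc m) p (\<lambda>d u. G (Suc d) (y # u) f) w | p w.
          p \<in> addable (del_box \<mu> y) \<and> w \<in> words (add_box (del_box \<mu> y) p)}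
        {G (Suc d) (y # u) | d u. d \<le> m \<and> u \<in> words (del_box \<mu> y)} (2 * (Suc m)\<^sup>2 * card (words (del_box \<mu> y)))"
      by (rule Suc.IH[OF young_del_box[OF Suc.prems y], of "\<lambda>d u. G (Suc d) (y # u)"])
    then show "costs (S \<union> ?T12) (T3 y) (2 * (Suc m)\<^sup>2 * card (words (del_box \<mu> y)))"
      unfolding T3_def
    proof (rule costs_mono)
      show "{\<lambda>f. coset_sum F (Suc m) p (\<lambda>d u. G (Suc d) (y # u) f) w | p w.
          p \<in> addable (del_box \<mu> y) \<and> w \<in> words (add_box (del_box \<mu> y) p)} \<subseteq> S \<union> ?T12"
      proof
        fix v assume "v \<in> {\<lambda>f. coset_sum F (Suc m) p (\<lambda>d u. G (Suc d) (y # u) f) w | p w.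
          p \<in> addable (del_box \<mu> y) \<and> w \<in> words (add_box (del_box \<mu> y) p)}"
        then obtain p w where p: "p \<in> addable (del_box \<mu> y)" and w: "w \<in> words (add_box (del_box \<mu> y) p)"
          and v: "v = H y p w" unfolding H_def by blast
        show "v \<in> S \<union> ?T12"
        proof (cases "p = y")
          case True
          then have "w \<in> words \<mu>" using w add_del_box[OF y] by simp
          moreover have "v \<in> T2 w" using True y by (auto simp: T2_def v)
          ultimately show ?thesis by blast
        next
          case False
          then have pq: "p \<in> ?A" "y \<in> removable (add_box \<mu> p)" using corner_swap[OF anti, of p y] p y by auto
          have "y # w \<in> words (add_box \<mu> p)"
            using w pq(2) False Cons_in_words[OF young_add_box[OF Suc.prems pq(1)]]
            by (simp add: del_add_box_commute)
          then have "(p, y # w) \<in> (SIGMA p:?A. words (add_box \<mu> p))" using pq(1) by simp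
          moreover have "v \<in> T1 (p, y # w)" using False by (simp add: T1_def v)
          ultimately show ?thesis by blast
        qed
      qed
    qed auto
  qed
  from costs_trans[OF S12 this]
  have "costs S (?T12 \<union> (\<Union>y\<in>?R. T3 y))
      (Suc (Suc m) * ?d + (3 * Suc m + 1) * ?d + 2 * (Suc m)\<^sup>2 * ?d)"
    by (simp add: card_words_Suc[OF Suc.prems] sum_distrib_left)
  then have "costs S {G d u | d u. d \<le> Suc m \<and> u \<in> words \<mu>} (2 * (Suc (Suc m))\<^sup>2 * ?d)"
  proof (rule costs_mono)
    show "{G d u | d u. d \<le> Suc m \<and> u \<in> words \<mu>} \<subseteq> ?T12 \<union> (\<Union>y\<in>?R. T3 y)"
    proof
      fix v assume "v \<in> {G d u | d u. d \<le> Suc m \<and> u \<in> words \<mu>}"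
      then obtain d u where d: "d \<le> Suc m" and u: "u \<in> words \<mu>" and v: "v = G d u" by blast
      show "v \<in> ?T12 \<union> (\<Union>y\<in>?R. T3 y)"
      proof (cases d)
        case 0
        then have "v \<in> T2 u" by (auto simp: T2_def v)
        then show ?thesis using u by blast
      next
        case (Suc d')
        have "length u = Suc m" using length_words[OF u Suc.prems] .
        then obtain y u' where u': "u = y # u'" by (cases u) auto
        then have "y \<in> ?R" "u' \<in> words (del_box \<mu> y)" using u Cons_in_words[OF Suc.prems] by auto
        moreover from this have "v \<in> T3 y" using d by (auto simp: T3_def Suc u' v)
        ultimately show ?thesis by blast
      qed
    qed
    have "Suc (Suc m) * ?d + (3 * Suc m + 1) * ?d + 2 * (Suc m)\<^sup>2 * ?d =
        (Suc (Suc m) + (3 * Suc m + 1) + 2 * (Suc m)\<^sup>2) * ?d" by (simp only: distrib_right)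
    also have "Suc (Suc m) + (3 * Suc m + 1) + 2 * (Suc m)\<^sup>2 = 2 * (Suc (Suc m))\<^sup>2"
      by (simp add: power2_eq_square)
    finally show "Suc (Suc m) * ?d + (3 * Suc m + 1) * ?d + 2 * (Suc m)\<^sup>2 * ?d \<le> 2 * (Suc (Suc m))\<^sup>2 * ?d"
      by simp
  qed simp
  then show ?case by (simp only: S_def V_def)
qed

section \<open>Inverse Fourier transform on the symmetric group\<close>

text \<open>
  A code \<open>d # c\<close> with \<open>c \<in> codes m\<close> stands for the permutation \<open>t\<^sub>m\<^sub>+\<^sub>1\<^sub>-\<^sub>d g\<close> of \<open>{1..m + 1}\<close>, where \<open>g\<close> is the
  permutation of \<open>{1..m}\<close> with code \<open>c\<close>.
\<close>

fun codes :: "nat \<Rightarrow> nat list set" where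
  "codes 0 = {[]}"
| "codes (Suc m) = (\<Union>d\<le>m. (#) d ` codes m)"

text \<open>
  The matrix entry at \<open>(P, Q)\<close> of the permutation with the given code. Column \<open>q # Q\<close> of \<open>t\<^sub>i g\<close> arises from
  column \<open>Q\<close> of \<open>g\<close>, embedded and then moved by \<open>t\<^sub>i\<close>. Only words \<open>P\<close>, \<open>Q\<close> of the length of the code are meant.
\<close>

fun word_rep :: "young_form \<Rightarrow> nat list \<Rightarrow> nat list \<Rightarrow> nat list \<Rightarrow> complex" where
  "word_rep F [] P Q = 1"
| "word_rep F (d # c) P [] = 0"
| "word_rep F (d # c) P (q # Q) = cyc_act F d (embed q (\<lambda>u. word_rep F c u Q)) P"

lemma finite_codes: "finite (codes m)"
  by (induction m) auto

lemma sum_codes_Suc: "(\<Sum>c\<in>codes (Suc m). g c) = (\<Sum>d\<le>m. \<Sum>c\<in>codes m. g (d # c))"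
proof -
  have "(\<Sum>c\<in>codes (Suc m). g c) = (\<Sum>d\<le>m. \<Sum>c\<in>(#) d ` codes m. g c)"
    unfolding codes.simps by (rule sum.UNION_disjoint) (auto simp: finite_codes)
  then show ?thesis by (simp add: sum.reindex)
qed

lemma card_codes: "card (codes m) = fact m"
  unfolding card_eq_sum by (induction m) (simp_all only: sum_codes_Suc, auto)

definition ballots :: "nat \<Rightarrow> nat list set" where
  "ballots m = {w. ballot w \<and> length w = m}"

lemma ballots_Suc: "ballots (Suc m) = (\<Union>w\<in>ballots m. (\<lambda>p. p # w) ` addable (count_list w))"
  by (auto simp: ballots_def length_Suc_conv)

lemma ballots_young: "w \<in> ballots m \<Longrightarrow> young (count_list w) m"
  using ballot_young by (auto simp: ballots_def)

lemma finite_ballots: "finite (ballots m)"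
proof (induction m)
  case 0
  have "ballots 0 = {[]}" by (auto simp: ballots_def)
  then show ?case by simp
next
  case (Suc m)
  then show ?case unfolding ballots_Suc
    by (auto intro!: finite_UN_I finite_imageI finite_addable ballots_young)
qed

text \<open>
  The squares of the dimensions of the modules \<open>V\<^sub>\<mu>\<close> add up to \<open>m!\<close>, in the form in which
  the columns \<open>w\<close> are counted.
\<close>

lemma sum_ballots: "(\<Sum>w\<in>ballots m. card (words (count_list w))) = fact m"
proof (induction m)
  case 0
  have "ballots 0 = {[]}" by (auto simp: ballots_def)
  then show ?case by (simp add: words_0)
next
  case (Suc m)
  have "(\<Sum>w\<in>ballots (Suc m). card (words (count_list w))) =
      (\<Sum>w\<in>ballots m. \<Sum>v\<in>(\<lambda>p. p # w) ` addable (count_list w). card (words (count_list v)))"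
    unfolding ballots_Suc
    by (intro sum.UNION_disjoint) (auto simp: finite_ballots intro!: finite_imageI finite_addable ballots_young)
  also have "\<dots> = (\<Sum>w\<in>ballots m. Suc m * card (words (count_list w)))"
    using sum_card_words_add_box[OF ballots_young]
    by (intro sum.cong) (auto simp: sum.reindex inj_on_def count_list_Cons)
  also have "\<dots> = fact (Suc m)"
    by (simp only: sum_distrib_left[symmetric] Suc.IH fact_Suc of_nat_id)
  finally show ?case .
qed

lemma word_rep_transform:
  "(\<Sum>c\<in>codes (Suc m). h c * word_rep F c w (p # Q)) =
   coset_sum F (Suc m) p (\<lambda>d u. \<Sum>c\<in>codes m. h (d # c) * word_rep F c u Q) w"
proof -
  have "embed p (\<lambda>u. \<Sum>c\<in>codes m. h (d # c) * word_rep F c u Q) =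
      (\<lambda>u. \<Sum>c\<in>codes m. h (d # c) * embed p (\<lambda>u. word_rep F c u Q) u)" for d
    by (auto simp: embed_def fun_eq_iff split: list.split)
  then show ?thesis
    unfolding sum_codes_Suc coset_sum_def lessThan_Suc_atMost
    by (simp add: cyc_act_linear finite_codes)
qed

text \<open>
  For every column \<open>Q\<close> the coset sums are inverted, which yields the transforms of the functions \<open>h (d # c)\<close>
  of \<open>c\<close> on all \<open>m + 1\<close> cosets. For the number \<open>N m\<close> of operations this means
  \<open>N (m + 1) \<le> 2 (m + 1)\<^sup>2 m! + (m + 1) N m\<close>.
\<close>

lemma costs_symmetric_group:
  fixes h :: "nat list \<Rightarrow> 'f \<Rightarrow> complex"
  shows "costs {\<lambda>f. \<Sum>c\<in>codes m. h c f * word_rep F c P Q | P Q. Q \<in> ballots m \<and> P \<in> words (count_list Q)}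
    (h ` codes m) (2 * m\<^sup>2 * fact m)"
proof (induction m arbitrary: h)
  case 0
  have "[] \<in> ballots 0" "[] \<in> words (count_list [])" by (auto simp: ballots_def words_def)
  then have "h ` codes 0 \<subseteq>
      {\<lambda>f. \<Sum>c\<in>codes 0. h c f * word_rep F c P Q | P Q. Q \<in> ballots 0 \<and> P \<in> words (count_list Q)}"
    by auto
  then show ?case by (rule costs_free)
next
  case (Suc m)
  let ?S = "{\<lambda>f. \<Sum>c\<in>codes (Suc m). h c f * word_rep F c P Q | P Q.
    Q \<in> ballots (Suc m) \<and> P \<in> words (count_list Q)}"
  define G where "G Q d u = (\<lambda>f. \<Sum>c\<in>codes m. h (d # c) f * word_rep F c u Q)" for Q d u
  define T where "T Q = {G Q d u | d u. d \<le> m \<and> u \<in> words (count_list Q)}" for Q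
  have "costs ?S (\<Union>Q\<in>ballots m. T Q) (\<Sum>Q\<in>ballots m. 2 * (Suc m)\<^sup>2 * card (words (count_list Q)))"
  proof (rule costs_UN[OF finite_ballots])
    fix Q assume Q: "Q \<in> ballots m"
    show "costs ?S (T Q) (2 * (Suc m)\<^sup>2 * card (words (count_list Q)))"
      unfolding T_def
    proof (rule costs_mono[OF costs_coset_sum[OF ballots_young[OF Q], of F "G Q"]])
      show "{\<lambda>f. coset_sum F (Suc m) p (\<lambda>d u. G Q d u f) w | p w.
          p \<in> addable (count_list Q) \<and> w \<in> words (add_box (count_list Q) p)} \<subseteq> ?S"
      proof
        fix v assume "v \<in> {\<lambda>f. coset_sum F (Suc m) p (\<lambda>d u. G Q d u f) w | p w.
          p \<in> addable (count_list Q) \<and> w \<in> words (add_box (count_list Q) p)}"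
        then obtain p w where p: "p \<in> addable (count_list Q)" and w: "w \<in> words (add_box (count_list Q) p)"
          and v: "v = (\<lambda>f. coset_sum F (Suc m) p (\<lambda>d u. G Q d u f) w)" by blast
        have "p # Q \<in> ballots (Suc m)" "w \<in> words (count_list (p # Q))"
          using Q p w by (auto simp: ballots_def count_list_Cons)
        moreover have "v = (\<lambda>f. \<Sum>c\<in>codes (Suc m). h c f * word_rep F c w (p # Q))"
          by (simp only: v word_rep_transform G_def)
        ultimately show "v \<in> ?S" by blast
      qed
    qed auto
  qed
  then have 1: "costs ?S (\<Union>Q\<in>ballots m. T Q) (2 * (Suc m)\<^sup>2 * fact m)"
    by (simp only: sum_distrib_left[symmetric] sum_ballots)
  have "costs (?S \<union> (\<Union>Q\<in>ballots m. T Q)) (\<Union>d\<le>m. (\<lambda>c. h (d # c)) ` codes m)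
      (\<Sum>d\<le>m. 2 * m\<^sup>2 * fact m)"
  proof (rule costs_UN)
    fix d assume d: "d \<in> {..m}"
    show "costs (?S \<union> (\<Union>Q\<in>ballots m. T Q)) ((\<lambda>c. h (d # c)) ` codes m) (2 * m\<^sup>2 * fact m)"
    proof (rule costs_mono[OF Suc.IH[of "\<lambda>c. h (d # c)"]])
      show "{\<lambda>f. \<Sum>c\<in>codes m. h (d # c) f * word_rep F c P Q | P Q.
          Q \<in> ballots m \<and> P \<in> words (count_list Q)} \<subseteq> ?S \<union> (\<Union>Q\<in>ballots m. T Q)"
        using d unfolding T_def G_def by blast
    qed auto
  qed simp
  from costs_trans[OF 1 this]
  show ?case
  proof (rule costs_mono)
    show "h ` codes (Suc m) \<subseteq> (\<Union>Q\<in>ballots m. T Q) \<union> (\<Union>d\<le>m. (\<lambda>c. h (d # c)) ` codes m)"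
      by auto
    have "2 * (Suc m)\<^sup>2 * fact m + (\<Sum>d\<le>m. 2 * m\<^sup>2 * fact m) = 2 * (Suc m + m\<^sup>2) * fact (Suc m)"
      by (simp add: power2_eq_square algebra_simps)
    also have "\<dots> \<le> 2 * (Suc m)\<^sup>2 * fact (Suc m)"
      by (intro mult_right_mono mult_left_mono) (auto simp: power2_eq_square)
    finally show "2 * (Suc m)\<^sup>2 * fact m + (\<Sum>d\<le>m. 2 * m\<^sup>2 * fact m) \<le> 2 * (Suc m)\<^sup>2 * fact (Suc m)" .
  qed simp
qed

section \<open>Codes as permutations\<close>

text \<open>
  The product of the transpositions whose action is \<^const>\<open>cyc_act\<close>: \<open>cyc (m + 1) d\<close> is \<open>t\<^sub>m\<^sub>+\<^sub>1\<^sub>-\<^sub>d\<close>.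
\<close>

fun cyc :: "nat \<Rightarrow> nat \<Rightarrow> nat \<Rightarrow> nat" where
  "cyc m 0 = id"
| "cyc m (Suc d) = cyc (m - 1) d \<circ> transpose (m - 1) m"

fun perm :: "nat list \<Rightarrow> nat \<Rightarrow> nat" where
  "perm [] = id"
| "perm (d # c) = cyc (Suc (length c)) d \<circ> perm c"

lemma length_codes: "c \<in> codes m \<Longrightarrow> length c = m"
  by (induction m arbitrary: c) auto

lemma permutes_mono: "p permutes {1..m} \<Longrightarrow> m \<le> n \<Longrightarrow> p permutes {1..n :: nat}"
  by (rule permutes_subset) auto

lemma cyc_permutes: "d < m \<Longrightarrow> cyc m d permutes {1..m}"
proof (induction d arbitrary: m)
  case 0
  then show ?case by (simp add: permutes_def)
next
  case (Suc d)
  have "cyc (m - 1) d permutes {1..m}"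
    by (rule permutes_mono[OF Suc.IH]) (use Suc.prems in auto)
  moreover have "transpose (m - 1) m permutes {1..m}"
    by (rule permutes_swap_id) (use Suc.prems in auto)
  ultimately show ?case by (simp only: cyc.simps permutes_compose)
qed

lemma cyc_top: "d < m \<Longrightarrow> cyc m d m = m - d"
  by (induction d arbitrary: m) auto

lemma perm_permutes: "c \<in> codes m \<Longrightarrow> perm c permutes {1..m}"
proof (induction m arbitrary: c)
  case 0
  then show ?case by (auto simp: permutes_def)
next
  case (Suc m)
  then obtain d c' where c: "c = d # c'" "d \<le> m" "c' \<in> codes m" by auto
  have "perm c' permutes {1..Suc m}" by (rule permutes_mono[OF Suc.IH[OF c(3)]]) simp
  moreover have "cyc (Suc m) d permutes {1..Suc m}" using c by (intro cyc_permutes) auto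
  ultimately show ?case by (simp only: c(1) perm.simps length_codes[OF c(3)] permutes_compose)
qed

text \<open>
  The first letter \<open>d\<close> of a code of length \<open>m + 1\<close> is determined by the image \<open>m + 1 - d\<close> of \<open>m + 1\<close>.
\<close>

lemma inj_perm: "inj_on perm (codes m)"
proof (induction m)
  case (Suc m)
  show ?case
  proof (rule inj_onI)
    fix c e assume "c \<in> codes (Suc m)" "e \<in> codes (Suc m)" and eq: "perm c = perm e"
    then obtain d c' d' e' where c: "c = d # c'" "d \<le> m" "c' \<in> codes m"
      and e: "e = d' # e'" "d' \<le> m" "e' \<in> codes m" by auto
    have len: "length c' = m" "length e' = m" using c e length_codes by auto
    have "perm c' (Suc m) = Suc m" "perm e' (Suc m) = Suc m"
      using perm_permutes[OF c(3)] perm_permutes[OF e(3)] by (auto simp: permutes_def)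
    then have "perm c (Suc m) = Suc m - d" "perm e (Suc m) = Suc m - d'"
      using c e by (simp_all add: len cyc_top)
    then have "Suc m - d = Suc m - d'" by (simp only: eq)
    then have d: "d = d'" using c(2) e(2) by linarith
    have "inj (cyc (Suc m) d)" using cyc_permutes[of d "Suc m"] c(2) by (simp add: permutes_inj)
    moreover have "cyc (Suc m) d \<circ> perm c' = cyc (Suc m) d \<circ> perm e'"
      using eq by (simp add: c e d len)
    ultimately have "perm c' = perm e'" by (simp add: fun.inj_map_strong fun_eq_iff inj_eq)
    then show "c = e" using Suc.IH c e d by (simp add: inj_on_def)
  qed
qed simp

lemma bij_perm: "bij_betw perm (codes m) {p. p permutes {1..m}}"
proof -
  have "perm ` codes m = {p. p permutes {1..m}}"
  proof (rule card_subset_eq)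
    show "finite {p. p permutes {1..m}}" by (rule finite_permutations) simp
    show "card (perm ` codes m) = card {p. p permutes {1..m}}"
      by (subst card_permutations[of _ m]) (auto simp: card_image[OF inj_perm] card_codes)
  qed (use perm_permutes in blast)
  then show ?thesis using inj_perm by (simp add: bij_betw_def)
qed

definition perm_map :: "nat \<Rightarrow> (nat \<Rightarrow> nat) \<Rightarrow> (nat \<rightharpoonup> nat)" where
  "perm_map N p = (\<lambda>j. Some (p j)) |` {1..N}"

lemma perm_map_comp: "q permutes {1..N} \<Longrightarrow> perm_map N p \<circ>\<^sub>m perm_map N q = perm_map N (p \<circ> q)"
  using permutes_in_image[of q "{1..N}"]
  by (auto simp: perm_map_def map_comp_def restrict_map_def fun_eq_iff)

lemma perm_map_id: "perm_map N id = idem N"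
  by (simp add: perm_map_def idem_def)

lemma perm_map_adj: "perm_map N (transpose i (Suc i)) = adj_transp N i"
  by (simp add: perm_map_def adj_transp_def)

lemma bij_perm_map: "bij_betw (perm_map N) {p. p permutes {1..N}} (symgrp N)"
proof (rule bij_betw_byWitness[where f' = "\<lambda>s j. if j \<in> {1..N} then the (s j) else j"])
  show "\<forall>p\<in>{p. p permutes {1..N}}. (\<lambda>j. if j \<in> {1..N} then the (perm_map N p j) else j) = p"
    by (auto simp: perm_map_def permutes_def fun_eq_iff)
  show "\<forall>s\<in>symgrp N. perm_map N (\<lambda>j. if j \<in> {1..N} then the (s j) else j) = s"
  proof
    fix s assume "s \<in> symgrp N"
    then have dom: "dom s = {1..N}" by (simp add: symgrp_def)
    show "perm_map N (\<lambda>j. if j \<in> {1..N} then the (s j) else j) = s"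
    proof
      fix j
      show "perm_map N (\<lambda>j. if j \<in> {1..N} then the (s j) else j) j = s j"
      proof (cases "j \<in> dom s")
        case True
        then obtain y where "s j = Some y" by auto
        then show ?thesis using dom True by (simp add: perm_map_def)
      next
        case False
        then have "s j = None" by (simp add: domIff)
        then show ?thesis using dom False by (simp add: perm_map_def)
      qed
    qed
  qed
  show "perm_map N ` {p. p permutes {1..N}} \<subseteq> symgrp N"
  proof
    fix s assume "s \<in> perm_map N ` {p. p permutes {1..N}}"
    then obtain p where s: "s = perm_map N p" and p: "p permutes {1..N}" by auto
    have "ran s = p ` {1..N}" by (auto simp: s perm_map_def ran_def restrict_map_def)
    then have "ran s = {1..N}" using permutes_image[OF p] by simp
    moreover have "dom s = {1..N}" by (auto simp: s perm_map_def)
    moreover have "inj_on s {1..N}"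
      using permutes_inj[OF p] by (auto simp: s perm_map_def inj_on_def)
    ultimately show "s \<in> symgrp N" by (simp add: symgrp_def)
  qed
  show "(\<lambda>s j. if j \<in> {1..N} then the (s j) else j) ` symgrp N \<subseteq> {p. p permutes {1..N}}"
  proof
    fix p assume "p \<in> (\<lambda>s j. if j \<in> {1..N} then the (s j) else j) ` symgrp N"
    then obtain s where p: "p = (\<lambda>j. if j \<in> {1..N} then the (s j) else j)"
      and s: "inj_on s (dom s)" "dom s = {1..N}" "ran s = {1..N}" by (auto simp: symgrp_def)
    have some: "s j = Some (p j)" if "j \<in> {1..N}" for j
    proof -
      have "j \<in> dom s" using that s(2) by simp
      then show ?thesis using that by (auto simp: p)
    qed
    have "inj_on p {1..N}"
    proof (rule inj_onI)
      fix x y assume "x \<in> {1..N}" "y \<in> {1..N}" "p x = p y"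
      then have "s x = s y" "x \<in> dom s" "y \<in> dom s" using some[of x] some[of y] s(2) by auto
      then show "x = y" using s(1) by (auto dest: inj_onD)
    qed
    moreover have "p ` {1..N} \<subseteq> {1..N}"
    proof
      fix z assume "z \<in> p ` {1..N}"
      then obtain j where "j \<in> {1..N}" "z = p j" by auto
      then have "z \<in> ran s" using some[of j] by (auto intro: ranI)
      then show "z \<in> {1..N}" using s by simp
    qed
    ultimately have "bij_betw p {1..N} {1..N}"
      by (simp add: bij_betw_def endo_inj_surj)
    moreover have "p j = j" if "j \<notin> {1..N}" for j using that by (simp only: p if_False)
    ultimately show "p \<in> {p. p permutes {1..N}}" using bij_imp_permutes by blast
  qed
qed

lemma bij_codes_symgrp: "bij_betw (\<lambda>c. perm_map m (perm c)) (codes m) (symgrp m)"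
  using bij_betw_trans[OF bij_perm bij_perm_map] by (simp add: o_def)

section \<open>Words as tableaux\<close>

definition boxes :: "(nat \<Rightarrow> nat) \<Rightarrow> (nat \<times> nat) set" where
  "boxes \<mu> = {(r, c). c < \<mu> r}"

definition standard :: "(nat \<Rightarrow> nat) \<Rightarrow> nat \<Rightarrow> tableau \<Rightarrow> bool" where
  "standard \<mu> m T \<longleftrightarrow> bij_betw T (boxes \<mu>) {1..m} \<and> (\<forall>b. b \<notin> boxes \<mu> \<longrightarrow> T b = 0) \<and>
     (\<forall>r c c'. c < c' \<and> c' < \<mu> r \<longrightarrow> T (r, c) < T (r, c')) \<and>
     (\<forall>r r' c. r < r' \<and> c < \<mu> r \<and> c < \<mu> r' \<longrightarrow> T (r, c) < T (r', c))"

text \<open>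
  The largest entry is put at the end of the row given by the first letter.
\<close>

fun tableau_of :: "nat list \<Rightarrow> tableau" where
  "tableau_of [] = (\<lambda>_. 0)"
| "tableau_of (r # w) = (tableau_of w)((r, count_list w r) := Suc (length w))"

definition shape_of :: "nat list \<Rightarrow> nat \<Rightarrow> nat" where
  "shape_of lam r = (if r < length lam then lam ! r else 0)"

lemma diagram_boxes: "diagram lam = boxes (shape_of lam)"
  by (auto simp: diagram_def boxes_def shape_of_def split: if_splits)

lemma std_tableaux_standard: "std_tableaux lam = {T. standard (shape_of lam) (sum_list lam) T}"
  unfolding std_tableaux_def standard_def diagram_boxes
  by (rule Collect_cong) (auto simp: boxes_def; meson less_trans)

lemma boxes_add_box: "boxes (add_box \<mu> p) = insert (p, \<mu> p) (boxes \<mu>)"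
  by (auto simp: boxes_def add_box_def split: if_splits)

lemma tableau_of_le: "tableau_of w b \<le> length w"
  by (induction w) (auto intro: le_SucI)

lemma tableau_of_outside: "count_list w r \<le> c \<Longrightarrow> tableau_of w (r, c) = 0"
  by (induction w) (auto simp: count_list.simps(2) split: if_splits)

lemma tableau_of_box: "tableau_of (X @ r # u) (r, count_list u r) = Suc (length u)"
  by (induction X) (auto simp: count_list.simps(2) count_list_append)

lemma tableau_of_boxD:
  assumes "tableau_of w b = Suc k"
  shows "\<exists>X r u. w = X @ r # u \<and> b = (r, count_list u r) \<and> length u = k"
  using assms
proof (induction w)
  case (Cons x w)
  show ?case
  proof (cases "b = (x, count_list w x)")
    case True
    then show ?thesis using Cons.prems by (intro exI[of _ "[]"]) auto
  next
    case False
    then obtain X r u where "w = X @ r # u" "b = (r, count_list u r)" "length u = k"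
      using Cons by auto
    then show ?thesis by (intro exI[of _ "x # X"]) auto
  qed
qed simp

text \<open>
  The position of the largest entry determines the first letter, and erasing it gives the tableau of
  the remaining word.
\<close>

lemma tableau_of_inj: "tableau_of w = tableau_of w' \<Longrightarrow> length w = length w' \<Longrightarrow> w = w'"
proof (induction w arbitrary: w')
  case (Cons x u)
  then obtain x' u' where w': "w' = x' # u'" "length u' = length u" by (cases w') auto
  have "tableau_of (x' # u') (x, count_list u x) = Suc (length u)"
    using Cons.prems(1) tableau_of_box[of "[]" x u] by (metis append_Nil w'(1))
  then obtain X r u'' where "x' # u' = X @ r # u''" "(x, count_list u x) = (r, count_list u'' r)"
    "length u'' = length u" using tableau_of_boxD by blast
  then have x: "x = x'" "count_list u x' = count_list u' x'"
    using w'(2) by (cases X; auto)+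
  have "tableau_of u = (tableau_of (x # u))((x, count_list u x) := 0)"
    using tableau_of_outside[of u x "count_list u x"] by auto
  also have "\<dots> = (tableau_of (x' # u'))((x', count_list u' x') := 0)"
    unfolding Cons.prems(1) w'(1) by (simp only: x)
  also have "\<dots> = tableau_of u'" using tableau_of_outside[of u' x' "count_list u' x'"] by auto
  finally show ?case using Cons.IH w' x by simp
qed simp

lemma standard_tableau_of: "ballot w \<Longrightarrow> standard (count_list w) (length w) (tableau_of w)"
proof (induction w)
  case Nil
  then show ?case by (simp add: standard_def boxes_def bij_betw_def)
next
  case (Cons p w)
  let ?\<mu> = "count_list w"
  have st: "standard ?\<mu> (length w) (tableau_of w)" and p: "p \<in> addable ?\<mu>" using Cons by auto
  have mono: "r \<le> s \<Longrightarrow> ?\<mu> s \<le> ?\<mu> r" for r s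
    using youngD[OF ballot_young] Cons.prems by auto
  have new: "(p, ?\<mu> p) \<notin> boxes ?\<mu>" by (simp add: boxes_def)
  have "bij_betw (tableau_of (p # w)) (boxes ?\<mu> \<union> {(p, ?\<mu> p)}) ({1..length w} \<union> {Suc (length w)})"
  proof (rule bij_betw_combine)
    show "bij_betw (tableau_of (p # w)) (boxes ?\<mu>) {1..length w}"
      using st new by (subst bij_betw_cong[of _ _ "tableau_of w"]) (auto simp: standard_def)
  qed (auto simp: bij_betw_def)
  also have "{1..length w} \<union> {Suc (length w)} = {1..length (p # w)}" by auto
  also have "boxes ?\<mu> \<union> {(p, ?\<mu> p)} = boxes (count_list (p # w))"
    by (simp add: count_list_Cons boxes_add_box)
  finally have bij: "bij_betw (tableau_of (p # w)) (boxes (count_list (p # w))) {1..length (p # w)}" .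
  show ?case
    unfolding standard_def
  proof (intro conjI bij allI impI)
    fix b assume "b \<notin> boxes (count_list (p # w))"
    then show "tableau_of (p # w) b = 0"
      using st by (cases b) (auto simp: count_list_Cons boxes_add_box standard_def)
  next
    fix r c c' assume "c < c' \<and> c' < count_list (p # w) r"
    then show "tableau_of (p # w) (r, c) < tableau_of (p # w) (r, c')"
      using st tableau_of_le[of w "(r, c)"]
      by (auto simp: count_list_Cons add_box_def standard_def less_Suc_eq split: if_splits)
  next
    fix r r' c assume *: "r < r' \<and> c < count_list (p # w) r \<and> c < count_list (p # w) r'"
    then have "(r, c) \<noteq> (p, ?\<mu> p)"
      using mono[of r r'] by (auto simp: count_list_Cons add_box_def split: if_splits)
    then have "tableau_of (p # w) (r, c) = tableau_of w (r, c)" "c < ?\<mu> r"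
      using * by (auto simp: count_list_Cons add_box_def less_Suc_eq split: if_splits)
    then show "tableau_of (p # w) (r, c) < tableau_of (p # w) (r', c)"
      using st * tableau_of_le[of w "(r, c)"]
      by (auto simp: count_list_Cons add_box_def standard_def less_Suc_eq less_Suc_eq_le split: if_splits)
  qed
qed

text \<open>
  The largest entry of a standard tableau lies at a corner, and erasing it leaves a standard tableau.
\<close>

lemma standard_imp_tableau_of: "young \<mu> m \<Longrightarrow> standard \<mu> m T \<Longrightarrow> T \<in> tableau_of ` words \<mu>"
proof (induction m arbitrary: \<mu> T)
  case 0
  then have "\<mu> = (\<lambda>_. 0)" by (simp add: young_0)
  with 0 have "T = tableau_of []" by (auto simp: standard_def boxes_def)
  then show ?case using \<open>\<mu> = _\<close> by (auto simp: words_0)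
next
  case (Suc m)
  have st: "bij_betw T (boxes \<mu>) {1..Suc m}" "\<And>b. b \<notin> boxes \<mu> \<Longrightarrow> T b = 0"
    "\<And>r c c'. c < c' \<Longrightarrow> c' < \<mu> r \<Longrightarrow> T (r, c) < T (r, c')"
    "\<And>r r' c. r < r' \<Longrightarrow> c < \<mu> r \<Longrightarrow> c < \<mu> r' \<Longrightarrow> T (r, c) < T (r', c)"
    using Suc.prems(2) by (auto simp: standard_def)
  have le: "T b \<le> Suc m" for b
    using st(1) st(2)[of b] by (cases "b \<in> boxes \<mu>") (auto simp: bij_betw_def)
  have "Suc m \<in> T ` boxes \<mu>" using st(1) by (simp add: bij_betw_def)
  then obtain r c where rc: "c < \<mu> r" "T (r, c) = Suc m" by (auto simp: boxes_def)
  have c: "Suc c = \<mu> r"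
  proof (rule ccontr)
    assume "Suc c \<noteq> \<mu> r"
    then show False using st(3)[of c "Suc c" r] rc le[of "(r, Suc c)"] by simp
  qed
  have r: "r \<in> removable \<mu>"
  proof (rule ccontr)
    assume "r \<notin> removable \<mu>"
    then have "c < \<mu> (Suc r)" using c by (simp add: removable_def)
    then show False using st(4)[of r "Suc r" c] rc le[of "(Suc r, c)"] by simp
  qed
  let ?T = "T((r, c) := 0)" let ?\<mu> = "del_box \<mu> r"
  have dr: "?\<mu> r = c" using c by (simp add: del_box_def)
  have b: "boxes \<mu> = insert (r, c) (boxes ?\<mu>)"
    using boxes_add_box[of ?\<mu> r] by (simp add: add_del_box[OF r] dr)
  have new: "(r, c) \<notin> boxes ?\<mu>" using dr by (simp add: boxes_def)
  have sub: "c' < ?\<mu> r' \<Longrightarrow> c' < \<mu> r' \<and> (r', c') \<noteq> (r, c)" for r' c'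
    using dr c by (auto simp: del_box_def split: if_splits)
  have "standard ?\<mu> m ?T"
    unfolding standard_def
  proof (intro conjI allI impI)
    have "bij_betw T (boxes \<mu> - {(r, c)}) ({1..Suc m} - {T (r, c)})"
      by (rule bij_betw_DiffI[OF st(1)]) (use rc in \<open>auto simp: bij_betw_def boxes_def\<close>)
    moreover have "boxes \<mu> - {(r, c)} = boxes ?\<mu>" using b new by auto
    moreover have "{1..Suc m} - {T (r, c)} = {1..m}" using rc by auto
    ultimately have "bij_betw T (boxes ?\<mu>) {1..m}" by simp
    then show "bij_betw ?T (boxes ?\<mu>) {1..m}"
      by (subst bij_betw_cong[of _ _ T]) (use new in auto)
  next
    fix b' assume "b' \<notin> boxes ?\<mu>"
    then show "?T b' = 0" using st(2) b by auto
  next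
    fix r' c1 c2 assume "c1 < c2 \<and> c2 < ?\<mu> r'"
    then show "?T (r', c1) < ?T (r', c2)" using st(3)[of c1 c2 r'] sub[of c1 r'] sub[of c2 r'] by auto
  next
    fix r1 r2 c' assume "r1 < r2 \<and> c' < ?\<mu> r1 \<and> c' < ?\<mu> r2"
    then show "?T (r1, c') < ?T (r2, c')" using st(4)[of r1 r2 c'] sub[of c' r1] sub[of c' r2] by auto
  qed
  then obtain w where w: "w \<in> words ?\<mu>" "?T = tableau_of w"
    using Suc.IH[OF young_del_box[OF Suc.prems(1) r]] by auto
  have "length w = m" using length_words[OF w(1) young_del_box[OF Suc.prems(1) r]] .
  moreover have "count_list w r = c" using w(1) dr by (auto simp: words_def)
  ultimately have "tableau_of (r # w) = T" using rc by (auto simp: fun_eq_iff simp flip: w(2))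
  moreover have "r # w \<in> words \<mu>" using Cons_in_words[OF Suc.prems(1)] r w(1) by simp
  ultimately show ?case by (metis imageI)
qed

lemma young_shape_of:
  assumes "partition_of lam k"
  shows "young (shape_of lam) k"
proof -
  have mono: "sorted_wrt (\<ge>) lam" and nz: "0 \<notin> set lam" and sum: "sum_list lam = k"
    using assms by (auto simp: partition_of_def)
  have supp: "{r. shape_of lam r \<noteq> 0} = {..<length lam}"
    using nz by (auto simp: shape_of_def) (metis nth_mem neq0_conv)
  have "shape_of lam (Suc r) \<le> shape_of lam r" for r
    using sorted_wrt_nth_less[OF mono, of r "Suc r"] by (auto simp: shape_of_def)
  then have "antimono (shape_of lam)" by (simp add: antimono_iff_le_Suc)
  moreover have "sum (shape_of lam) {..<length lam} = k"
    using sum by (simp add: shape_of_def sum_list_sum_nth atLeast0LessThan)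
  ultimately show ?thesis by (simp only: young_def supp finite_lessThan simp_thms)
qed

lemma exists_partition:
  assumes "young \<mu> k"
  obtains lam where "partition_of lam k" "shape_of lam = \<mu>"
proof -
  let ?L = "LEAST r. \<mu> r = 0"
  have "\<exists>r. \<mu> r = 0"
  proof (rule ccontr)
    assume "\<nexists>r. \<mu> r = 0"
    then have "{r. \<mu> r \<noteq> 0} = UNIV" by auto
    then show False using assms by (simp add: young_def)
  qed
  then have L: "\<mu> ?L = 0" by (rule LeastI_ex)
  have supp: "\<mu> r \<noteq> 0 \<longleftrightarrow> r < ?L" for r
    using youngD[OF assms, of ?L r] L not_less_Least[of r "\<lambda>r. \<mu> r = 0"] by (cases "r < ?L") auto
  let ?lam = "map \<mu> [0..<?L]"
  have "sorted_wrt (\<ge>) ?lam"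
    unfolding sorted_wrt_iff_nth_less using youngD[OF assms] by (auto intro: less_imp_le)
  moreover have "0 \<notin> set ?lam" using supp by (auto simp: image_iff)
  moreover have "sum_list ?lam = k"
  proof -
    have "{r. \<mu> r \<noteq> 0} = {..<?L}" using supp by auto
    then show ?thesis using assms
      by (simp add: young_def interv_sum_list_conv_sum_set_nat atLeast0LessThan)
  qed
  ultimately have "partition_of ?lam k" by (simp add: partition_of_def)
  moreover have "shape_of ?lam = \<mu>"
  proof
    fix r show "shape_of ?lam r = \<mu> r" using supp[of r] by (auto simp: shape_of_def)
  qed
  ultimately show ?thesis by (rule that)
qed

lemma tableau_of_bij:
  assumes "partition_of lam k"
  shows "bij_betw tableau_of (words (shape_of lam)) (std_tableaux lam)"
proof -
  have y: "young (shape_of lam) k" and s: "sum_list lam = k"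
    using assms young_shape_of by (auto simp: partition_of_def)
  have "inj_on tableau_of (words (shape_of lam))"
    using length_words[OF _ y] by (intro inj_onI) (auto intro: tableau_of_inj)
  moreover have "tableau_of ` words (shape_of lam) = std_tableaux lam"
  proof
    show "tableau_of ` words (shape_of lam) \<subseteq> std_tableaux lam"
    proof
      fix T assume "T \<in> tableau_of ` words (shape_of lam)"
      then obtain w where w: "T = tableau_of w" "w \<in> words (shape_of lam)" by auto
      then show "T \<in> std_tableaux lam"
        using standard_tableau_of[of w] length_words[OF w(2) y] by (simp add: std_tableaux_standard s words_def)
    qed
    show "std_tableaux lam \<subseteq> tableau_of ` words (shape_of lam)"
      using standard_imp_tableau_of[OF y] by (auto simp: std_tableaux_standard s)
  qed
  ultimately show ?thesis by (simp add: bij_betw_def)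
qed


section \<open>Young's matrices on words\<close>

lemma ballot_append_cong:
  "ballot (X @ w) \<Longrightarrow> ballot w' \<Longrightarrow> count_list w' = count_list w \<Longrightarrow> ballot (X @ w')"
proof (induction X)
  case (Cons x X)
  have "count_list (X @ w') = count_list (X @ w)"
    using Cons.prems(3) by (auto simp: count_list_append fun_eq_iff)
  then show ?case using Cons by simp
qed simp

lemma words_append_cong:
  assumes "X @ w \<in> words \<mu>" "ballot w'" "count_list w' = count_list w"
  shows "X @ w' \<in> words \<mu>"
proof -
  have "count_list (X @ w') = count_list (X @ w)"
    using assms(3) by (auto simp: count_list_append fun_eq_iff)
  then show ?thesis using assms ballot_append_cong by (auto simp: words_def)
qed

lemma words_suffix_ballot: "X @ w \<in> words \<mu> \<Longrightarrow> ballot w"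
  by (induction X arbitrary: \<mu>) (auto simp: words_def)

lemma tableau_of_swap:
  assumes "x \<noteq> y"
  shows "tableau_of (X @ y # x # u) = transpose (Suc (length u)) (Suc (Suc (length u))) \<circ> tableau_of (X @ x # y # u)"
proof (induction X)
  case Nil
  show ?case
  proof
    fix b
    show "tableau_of ([] @ y # x # u) b =
        (transpose (Suc (length u)) (Suc (Suc (length u))) \<circ> tableau_of ([] @ x # y # u)) b"
      using assms tableau_of_le[of u b] by (auto simp: count_list.simps(2) transpose_def)
  qed
next
  case (Cons z X)
  have "count_list (X @ y # x # u) z = count_list (X @ x # y # u) z"
    by (simp add: count_list_append count_list.simps(2))
  then show ?case using Cons by (auto simp: fun_eq_iff transpose_def)
qed

lemma content_of_tableau_of:
  assumes "partition_of lam k" "X @ r # u \<in> words (shape_of lam)"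
  shows "content_of lam (tableau_of (X @ r # u)) (Suc (length u)) = content (count_list u) r"
  unfolding content_of_def
proof (rule the_equality)
  let ?w = "X @ r # u"
  have inj: "inj_on (tableau_of ?w) (diagram lam)"
    using tableau_of_bij[OF assms(1)] assms(2) unfolding std_tableaux_standard standard_def diagram_boxes
    by (auto simp: bij_betw_def)
  have "count_list ?w r = shape_of lam r" using assms(2) by (simp add: words_def)
  then have d: "(r, count_list u r) \<in> diagram lam"
    by (simp add: diagram_boxes boxes_def count_list_append count_list.simps(2))
  then show "\<exists>r' c. (r', c) \<in> diagram lam \<and> tableau_of ?w (r', c) = Suc (length u) \<and>
      content (count_list u) r = int c - int r'"
    using tableau_of_box by (intro exI[of _ r] exI[of _ "count_list u r"]) (auto simp: content_def)
  fix a assume "\<exists>r' c. (r', c) \<in> diagram lam \<and> tableau_of ?w (r', c) = Suc (length u) \<and> a = int c - int r'"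
  then obtain r' c where "(r', c) \<in> diagram lam" "tableau_of ?w (r', c) = Suc (length u)" "a = int c - int r'"
    by blast
  moreover from this have "(r', c) = (r, count_list u r)"
    using inj d tableau_of_box by (metis inj_onD)
  ultimately show "a = content (count_list u) r" by (simp add: content_def)
qed

lemma axial_word: "axial (count_list (y # u)) x y = content (count_list (y # u)) x - content (count_list u) y"
  by (simp add: axial_def count_list_Cons del_add_box)

text \<open>
  Both words have the same length, so the letters at the positions of the two transposed entries can be
  compared. If these letters agree for \<open>V\<close>, then the transposed tableau is not standard, because the two
  entries are neighbours in a row.
\<close>

lemma young_entry_word:
  assumes lam: "partition_of lam k" and P: "X @ x # y # u \<in> words (shape_of lam)"
    and V: "V \<in> words (shape_of lam)"
  shows "young_entry F lam (Suc (length u)) (tableau_of (X @ x # y # u)) (tableau_of V) =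
    (if V = X @ x # y # u then 1 / of_int (axial (count_list (y # u)) x y)
     else if x \<noteq> y \<and> V = X @ y # x # u then swap_coeff F (axial (count_list (x # u)) y x) else 0)"
proof -
  let ?i = "Suc (length u)" let ?P = "X @ x # y # u"
  have y: "young (shape_of lam) k" using lam by (rule young_shape_of)
  have len: "length V = length ?P" using length_words[OF V y] length_words[OF P y] by simp
  define Y where "Y = take (length X) V"
  define Z where "Z = drop (length X) V"
  have "length Z = Suc (Suc (length u))" using len by (simp add: Z_def)
  then obtain x' y' u' where du: "Z = x' # y' # u'" "length u' = length u"
    by (auto simp: length_Suc_conv)
  have VY: "V = Y @ x' # y' # u'"
    using append_take_drop_id[of "length X" V] by (simp only: Y_def du flip: Z_def)
  have lY: "length Y = length X" using len by (simp add: Y_def)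
  have c1: "content_of lam (tableau_of V) ?i = content (count_list u') y'"
    using content_of_tableau_of[OF lam, of "Y @ [x']" y' u'] V by (simp add: VY du)
  have c2: "content_of lam (tableau_of V) (Suc ?i) = content (count_list (y' # u')) x'"
    using content_of_tableau_of[OF lam, of Y x' "y' # u'"] V by (simp add: VY du)
  let ?a = "axial (count_list (y' # u')) x' y'"
  have fourier_entry: "young_entry F lam ?i (tableau_of ?P) (tableau_of V) = 1 / of_int ?a * of_bool (tableau_of ?P = tableau_of V) +
      swap_coeff F ?a * of_bool (tableau_of ?P = transpose ?i (Suc ?i) \<circ> tableau_of V)"
    by (simp add: young_entry_def c1 c2 axial_word Let_def)
  have same: "tableau_of ?P = tableau_of V \<longleftrightarrow> V = ?P" using tableau_of_inj len by metis
  have swap: "tableau_of ?P = transpose ?i (Suc ?i) \<circ> tableau_of V \<longleftrightarrow> x \<noteq> y \<and> V = X @ y # x # u"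
  proof (cases "x' = y'")
    case True
    have "tableau_of ?P \<noteq> transpose ?i (Suc ?i) \<circ> tableau_of V"
    proof
      assume e: "tableau_of ?P = transpose ?i (Suc ?i) \<circ> tableau_of V"
      let ?c = "count_list u' y'"
      have "tableau_of V (y', ?c) = ?i" "tableau_of V (y', Suc ?c) = Suc ?i"
        using tableau_of_box[of "Y @ [x']" y' u'] tableau_of_box[of Y x' "y' # u'"] True
        by (simp_all add: VY du count_list.simps(2))
      then have "tableau_of ?P (y', ?c) = Suc ?i" "tableau_of ?P (y', Suc ?c) = ?i" by (simp_all add: e)
      moreover have "Suc ?c < shape_of lam y'"
      proof -
        have "count_list V y' = shape_of lam y'" using V by (simp add: words_def)
        then show ?thesis using True by (simp add: VY count_list_append count_list.simps(2))
      qed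
      moreover have "standard (shape_of lam) k (tableau_of ?P)"
        using standard_tableau_of[of ?P] length_words[OF P y] P by (simp add: words_def)
      ultimately show False unfolding standard_def by (metis lessI less_asym)
    qed
    then show ?thesis using True lY by (auto simp: VY)
  next
    case False
    have "transpose ?i (Suc ?i) \<circ> tableau_of V = tableau_of (Y @ y' # x' # u')"
      using tableau_of_swap[OF False, of Y u'] by (simp add: VY du)
    moreover have "tableau_of ?P = tableau_of (Y @ y' # x' # u') \<longleftrightarrow> ?P = Y @ y' # x' # u'"
      using tableau_of_inj[of ?P "Y @ y' # x' # u'"] lY du by auto
    ultimately show ?thesis using False lY by (auto simp: VY)
  qed
  show ?thesis
    unfolding fourier_entry same swap by (auto simp: VY lY)
qed

text \<open>
  The adjacent transposition acts on a word through the suffix that starts with the larger of the two entries.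
\<close>

lemma young_adj_act:
  assumes lam: "partition_of lam k" and P: "X @ x # y # u \<in> words (shape_of lam)"
  shows "(\<Sum>V\<in>words (shape_of lam). young_entry F lam (Suc (length u)) (tableau_of (X @ x # y # u)) (tableau_of V) * v V) =
    swap_top F (\<lambda>w. v (X @ w)) (x # y # u)"
proof -
  let ?W = "words (shape_of lam)" let ?P = "X @ x # y # u" let ?Q = "X @ y # x # u"
  let ?a = "1 / of_int (axial (count_list (y # u)) x y) * v ?P"
  let ?b = "if x \<noteq> y \<and> ballot (y # x # u) then swap_coeff F (axial (count_list (x # u)) y x) * v ?Q else 0"
  have fin: "finite ?W" using finite_words young_shape_of[OF lam] by blast
  have Q: "?Q \<in> ?W \<longleftrightarrow> ballot (y # x # u)"
  proof
    show "?Q \<in> ?W \<Longrightarrow> ballot (y # x # u)" by (rule words_suffix_ballot)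
    show "?Q \<in> ?W" if "ballot (y # x # u)"
      by (rule words_append_cong[OF P that]) (simp add: count_list_Cons add_box_commute[of _ x y])
  qed
  have "(\<Sum>V\<in>?W. young_entry F lam (Suc (length u)) (tableau_of ?P) (tableau_of V) * v V) =
      (\<Sum>V\<in>?W. (if V = ?P then ?a else 0) + (if V = ?Q then ?b else 0))"
  proof (intro sum.cong refl)
    fix V assume V: "V \<in> ?W"
    show "young_entry F lam (Suc (length u)) (tableau_of ?P) (tableau_of V) * v V =
        (if V = ?P then ?a else 0) + (if V = ?Q then ?b else 0)"
    proof (cases "V = ?Q \<and> x \<noteq> y")
      case True
      then have "ballot (y # x # u)" using V Q by metis
      then show ?thesis
        unfolding young_entry_word[OF lam P V] using True by (simp del: ballot.simps)
    next
      case False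
      then have "(if V = ?Q then ?b else 0) = 0" and "(x \<noteq> y \<and> V = ?Q) = False" by auto
      then show ?thesis
        unfolding young_entry_word[OF lam P V] by (simp only: if_False) simp
    qed
  qed
  also have "\<dots> = ?a + ?b"
    using fin P Q by (simp add: sum.distrib sum.delta)
  finally show ?thesis by (simp add: swap_top_def)
qed

lemma young_rep_idem:
  assumes "partition_of lam N" "young_rep F N lam \<rho>"
    and "P \<in> words (shape_of lam)" "Q \<in> words (shape_of lam)"
  shows "\<rho> (idem N) (tableau_of P) (tableau_of Q) = of_bool (P = Q)"
proof -
  have "\<forall>T\<in>std_tableaux lam. \<forall>U\<in>std_tableaux lam. \<rho> (idem N) T U = of_bool (T = U)"
    using assms(2) unfolding young_rep_def by (elim conjE)
  moreover have "tableau_of P \<in> std_tableaux lam" "tableau_of Q \<in> std_tableaux lam"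
    using bij_betwE[OF tableau_of_bij[OF assms(1)]] assms(3,4) by auto
  ultimately have "\<rho> (idem N) (tableau_of P) (tableau_of Q) = of_bool (tableau_of P = tableau_of Q)" by blast
  also have "tableau_of P = tableau_of Q \<longleftrightarrow> P = Q"
    using bij_betw_imp_inj_on[OF tableau_of_bij[OF assms(1)]] assms(3,4) by (auto dest: inj_onD)
  finally show ?thesis .
qed

lemma young_rep_mult:
  assumes "partition_of lam N" "young_rep F N lam \<rho>" "s \<in> symgrp N" "t \<in> symgrp N"
    and "P \<in> words (shape_of lam)" "Q \<in> words (shape_of lam)"
  shows "\<rho> (s \<circ>\<^sub>m t) (tableau_of P) (tableau_of Q) =
    (\<Sum>V\<in>words (shape_of lam). \<rho> s (tableau_of P) (tableau_of V) * \<rho> t (tableau_of V) (tableau_of Q))"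
proof -
  have "\<forall>s\<in>symgrp N. \<forall>t\<in>symgrp N. \<forall>T\<in>std_tableaux lam. \<forall>U\<in>std_tableaux lam.
        \<rho> (s \<circ>\<^sub>m t) T U = (\<Sum>V\<in>std_tableaux lam. \<rho> s T V * \<rho> t V U)"
    using assms(2) unfolding young_rep_def by (elim conjE)
  moreover have "tableau_of P \<in> std_tableaux lam" "tableau_of Q \<in> std_tableaux lam"
    using bij_betwE[OF tableau_of_bij[OF assms(1)]] assms(5,6) by auto
  ultimately have "\<rho> (s \<circ>\<^sub>m t) (tableau_of P) (tableau_of Q) =
      (\<Sum>V\<in>std_tableaux lam. \<rho> s (tableau_of P) V * \<rho> t V (tableau_of Q))" using assms(3,4) by blast
  also have "\<dots> = (\<Sum>V\<in>words (shape_of lam). \<rho> s (tableau_of P) (tableau_of V) * \<rho> t (tableau_of V) (tableau_of Q))"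
    by (rule sum.reindex_bij_betw[OF tableau_of_bij[OF assms(1)], symmetric])
  finally show ?thesis .
qed

lemma young_rep_adj:
  assumes "partition_of lam N" "young_rep F N lam \<rho>" "1 \<le> i" "i < N"
    and "P \<in> words (shape_of lam)" "Q \<in> words (shape_of lam)"
  shows "\<rho> (adj_transp N i) (tableau_of P) (tableau_of Q) = young_entry F lam i (tableau_of P) (tableau_of Q)"
proof -
  have "\<forall>i. 1 \<le> i \<and> i < N \<longrightarrow> (\<forall>T\<in>std_tableaux lam. \<forall>U\<in>std_tableaux lam.
      \<rho> (adj_transp N i) T U = young_entry F lam i T U)"
    using assms(2) unfolding young_rep_def by (elim conjE)
  moreover have "tableau_of P \<in> std_tableaux lam" "tableau_of Q \<in> std_tableaux lam"
    using bij_betwE[OF tableau_of_bij[OF assms(1)]] assms(5,6) by auto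
  ultimately show ?thesis using assms(3,4) by blast
qed

text \<open>
  Induction on the number of factors, with the prefix \<open>X\<close> growing: once the rightmost transposition has been
  applied, the other factors act on the suffix \<open>w\<close> without its first letter.
\<close>

lemma young_cyc_act:
  assumes lam: "partition_of lam N" and rep: "young_rep F N lam \<rho>"
    and P: "X @ w \<in> words (shape_of lam)" and d: "d < length w"
  shows "(\<Sum>V\<in>words (shape_of lam). \<rho> (perm_map N (cyc (length w) d)) (tableau_of (X @ w)) (tableau_of V) * v V) =
    cyc_act F d (\<lambda>w'. v (X @ w')) w"
  using P d
proof (induction d arbitrary: X w v)
  case 0
  let ?W = "words (shape_of lam)"
  have fin: "finite ?W" using finite_words young_shape_of[OF lam] by blast
  have "(\<Sum>V\<in>?W. \<rho> (perm_map N id) (tableau_of (X @ w)) (tableau_of V) * v V) = (\<Sum>V\<in>?W. if V = X @ w then v V else 0)"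
    using young_rep_idem[OF lam rep 0(1)] by (intro sum.cong) (auto simp: perm_map_id)
  also have "\<dots> = v (X @ w)" using fin 0(1) by simp
  finally show ?case unfolding cyc.simps cyc_act.simps .
next
  case (Suc d)
  let ?W = "words (shape_of lam)"
  have y: "young (shape_of lam) N" using lam by (rule young_shape_of)
  obtain q w' where w: "w = q # w'" using Suc.prems(2) by (cases w) auto
  let ?i = "length w'"
  have i: "d < ?i" "Suc ?i \<le> N" using Suc.prems length_words[OF Suc.prems(1) y] by (auto simp: w)
  define v' where "v' V = (\<Sum>U\<in>?W. \<rho> (adj_transp N ?i) (tableau_of V) (tableau_of U) * v U)" for V
  have cyc: "perm_map N (cyc (length w) (Suc d)) = perm_map N (cyc ?i d) \<circ>\<^sub>m adj_transp N ?i"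
  proof -
    have "transpose ?i (Suc ?i) permutes {1..N}" by (rule permutes_swap_id) (use i in auto)
    then show ?thesis by (simp add: w perm_map_comp flip: perm_map_adj)
  qed
  have in_symgrp: "perm_map N (cyc ?i d) \<in> symgrp N" "adj_transp N ?i \<in> symgrp N"
  proof -
    have "cyc ?i d permutes {1..N}" by (rule permutes_mono[OF cyc_permutes]) (use i in auto)
    moreover have "transpose ?i (Suc ?i) permutes {1..N}" by (rule permutes_swap_id) (use i in auto)
    ultimately show "perm_map N (cyc ?i d) \<in> symgrp N" "adj_transp N ?i \<in> symgrp N"
      using bij_perm_map by (auto simp: bij_betw_def simp flip: perm_map_adj)
  qed
  have mult: "\<rho> (perm_map N (cyc (length w) (Suc d))) (tableau_of (X @ w)) (tableau_of V) =
      (\<Sum>U\<in>?W. \<rho> (perm_map N (cyc ?i d)) (tableau_of (X @ w)) (tableau_of U) * \<rho> (adj_transp N ?i) (tableau_of U) (tableau_of V))"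
    if V: "V \<in> ?W" for V
    unfolding cyc by (rule young_rep_mult[OF lam rep in_symgrp Suc.prems(1) V])
  have "(\<Sum>V\<in>?W. \<rho> (perm_map N (cyc (length w) (Suc d))) (tableau_of (X @ w)) (tableau_of V) * v V) =
      (\<Sum>V\<in>?W. \<Sum>U\<in>?W. \<rho> (perm_map N (cyc ?i d)) (tableau_of (X @ w)) (tableau_of U) * \<rho> (adj_transp N ?i) (tableau_of U) (tableau_of V) * v V)"
    by (intro sum.cong refl) (simp only: mult sum_distrib_right)
  also have "\<dots> = (\<Sum>U\<in>?W. \<rho> (perm_map N (cyc ?i d)) (tableau_of (X @ w)) (tableau_of U) * v' U)"
    unfolding v'_def sum_distrib_left by (subst sum.swap) (simp only: mult.assoc)
  also have "\<dots> = cyc_act F d (\<lambda>w''. v' ((X @ [q]) @ w'')) w'"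
    using Suc.IH[of "X @ [q]" w'] Suc.prems(1) i by (simp add: w)
  also have "\<dots> = cyc_act F d (\<lambda>w''. swap_top F (\<lambda>w. v (X @ w)) (q # w'')) w'"
  proof (rule cyc_act_cong)
    show "ballot w'" using words_suffix_ballot[OF Suc.prems(1)] by (simp add: w)
    fix w'' assume w'': "ballot w''" "count_list w'' = count_list w'"
    have V: "(X @ [q]) @ w'' \<in> ?W"
      by (rule words_append_cong[OF _ w'']) (use Suc.prems(1) in \<open>simp add: w\<close>)
    then have "length w'' = ?i" using length_words[OF V y] length_words[OF Suc.prems(1) y] by (simp add: w)
    then obtain z u where w''u: "w'' = z # u" "?i = Suc (length u)" using i by (cases w'') auto
    have "v' ((X @ [q]) @ w'') =
        (\<Sum>U\<in>?W. young_entry F lam (Suc (length u)) (tableau_of (X @ q # z # u)) (tableau_of U) * v U)"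
    proof -
      have "\<rho> (adj_transp N ?i) (tableau_of ((X @ [q]) @ w'')) (tableau_of U) =
          young_entry F lam (Suc (length u)) (tableau_of (X @ q # z # u)) (tableau_of U)" if "U \<in> ?W" for U
        using young_rep_adj[OF lam rep, of ?i] i V that by (simp add: w''u)
      then show ?thesis unfolding v'_def by (intro sum.cong) auto
    qed
    also have "\<dots> = swap_top F (\<lambda>w. v (X @ w)) (q # z # u)"
      using V by (intro young_adj_act[OF lam]) (simp add: w''u)
    finally show "v' ((X @ [q]) @ w'') = swap_top F (\<lambda>w. v (X @ w)) (q # w'')" by (simp add: w''u)
  qed
  finally show ?case by (simp only: w cyc_act.simps)
qed

text \<open>
  The induction needs permutations of \<open>{1..m}\<close> as elements of \<open>S\<^sub>N\<close> for all \<open>m \<le> N\<close>, hence the prefixes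
  \<open>X\<close> and \<open>Y\<close>. In this way only the one representation \<open>\<rho>\<close> of \<open>S\<^sub>N\<close> is involved, and restrictions of
  representations do not have to be identified.
\<close>

lemma young_rep_word:
  assumes lam: "partition_of lam N" and rep: "young_rep F N lam \<rho>" and c: "c \<in> codes m"
    and P: "X @ P \<in> words (shape_of lam)" "length P = m"
    and Q: "Y @ Q \<in> words (shape_of lam)" "length Q = m"
  shows "\<rho> (perm_map N (perm c)) (tableau_of (X @ P)) (tableau_of (Y @ Q)) = (if X = Y then word_rep F c P Q else 0)"
  using c P Q
proof (induction m arbitrary: c X P Y Q)
  case 0
  then have "c = []" "P = []" "Q = []" "X \<in> words (shape_of lam)" "Y \<in> words (shape_of lam)" by auto
  then show ?case using young_rep_idem[OF lam rep, of X Y] by (simp only: perm.simps perm_map_id) simp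
next
  case (Suc m)
  let ?W = "words (shape_of lam)"
  have y: "young (shape_of lam) N" using lam by (rule young_shape_of)
  obtain d c' where c: "c = d # c'" "d \<le> m" "c' \<in> codes m" using Suc.prems(1) by auto
  have lc: "length c' = m" using length_codes[OF c(3)] .
  obtain q Q' where Q: "Q = q # Q'" "length Q' = m" using Suc.prems(5) by (cases Q) auto
  have N: "Suc m \<le> N" using length_words[OF Suc.prems(2) y] Suc.prems(3) by simp
  have p1: "perm c' permutes {1..N}" by (rule permutes_mono[OF perm_permutes[OF c(3)]]) (use N in auto)
  have p2: "cyc (Suc m) d permutes {1..N}" by (rule permutes_mono[OF cyc_permutes]) (use N c in auto)
  have comp: "perm_map N (perm c) = perm_map N (cyc (Suc m) d) \<circ>\<^sub>m perm_map N (perm c')"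
    using p1 by (simp only: c(1) lc perm.simps perm_map_comp)
  have sg: "perm_map N (cyc (Suc m) d) \<in> symgrp N" "perm_map N (perm c') \<in> symgrp N"
    using bij_perm_map p1 p2 by (auto simp: bij_betw_def)
  have "\<rho> (perm_map N (perm c)) (tableau_of (X @ P)) (tableau_of (Y @ Q)) =
      (\<Sum>V\<in>?W. \<rho> (perm_map N (cyc (length P) d)) (tableau_of (X @ P)) (tableau_of V) * \<rho> (perm_map N (perm c')) (tableau_of V) (tableau_of (Y @ Q)))"
    unfolding comp Suc.prems(3) by (rule young_rep_mult[OF lam rep sg Suc.prems(2,4)])
  also have "\<dots> = cyc_act F d (\<lambda>w. \<rho> (perm_map N (perm c')) (tableau_of (X @ w)) (tableau_of (Y @ Q))) P"
    using c Suc.prems by (intro young_cyc_act[OF lam rep]) auto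
  also have "\<dots> = cyc_act F d (\<lambda>w. if X = Y then embed q (\<lambda>u. word_rep F c' u Q') w else 0) P"
  proof (rule cyc_act_cong)
    show "ballot P" using words_suffix_ballot[OF Suc.prems(2)] .
    fix w assume w: "ballot w" "count_list w = count_list P"
    have V: "X @ w \<in> ?W" by (rule words_append_cong[OF Suc.prems(2) w])
    then have "length w = Suc m"
      using length_words[OF V y] length_words[OF Suc.prems(2) y] Suc.prems(3) by simp
    then obtain x u where xu: "w = x # u" "length u = m" by (cases w) auto
    have "\<rho> (perm_map N (perm c')) (tableau_of ((X @ [x]) @ u)) (tableau_of ((Y @ [q]) @ Q')) =
        (if X @ [x] = Y @ [q] then word_rep F c' u Q' else 0)"
      by (rule Suc.IH[OF c(3)]) (use V xu Q Suc.prems in auto)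
    then show "\<rho> (perm_map N (perm c')) (tableau_of (X @ w)) (tableau_of (Y @ Q)) =
        (if X = Y then embed q (\<lambda>u. word_rep F c' u Q') w else 0)"
      by (auto simp: xu Q embed_def)
  qed
  also have "\<dots> = (if X = Y then word_rep F c P Q else 0)"
    by (simp add: cyc_act_0 c Q)
  finally show ?case .
qed

section \<open>Rooks between two given sets\<close>

definition partial_bij :: "(nat \<rightharpoonup> nat) \<Rightarrow> nat set \<Rightarrow> nat set \<Rightarrow> bool" where
  "partial_bij s A B \<longleftrightarrow> inj_on s (dom s) \<and> dom s = A \<and> ran s = B"

lemma partial_bijI:
  assumes "\<And>x. x \<in> A \<Longrightarrow> \<exists>y. s x = Some y" "\<And>y. y \<in> B \<Longrightarrow> \<exists>x. s x = Some y"
    and "\<And>x y. s x = Some y \<Longrightarrow> x \<in> A \<and> y \<in> B"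
    and "\<And>x x' y. s x = Some y \<Longrightarrow> s x' = Some y \<Longrightarrow> x = x'"
  shows "partial_bij s A B"
proof -
  have "dom s = A" "ran s = B" using assms(1-3) by (auto simp: ran_def)
  moreover have "inj_on s (dom s)" using assms(4) by (auto simp: inj_on_def)
  ultimately show ?thesis by (simp add: partial_bij_def)
qed

lemma partial_bijD:
  assumes "partial_bij s A B"
  shows "x \<in> A \<Longrightarrow> \<exists>y. s x = Some y" "y \<in> B \<Longrightarrow> \<exists>x. s x = Some y"
    and "s x = Some y \<Longrightarrow> x \<in> A" "s x = Some y \<Longrightarrow> y \<in> B"
    and "s x = Some y \<Longrightarrow> s x' = Some y \<Longrightarrow> x = x'"
proof -
  have inj: "inj_on s (dom s)" and d: "dom s = A" and r: "ran s = B"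
    using assms by (auto simp: partial_bij_def)
  show "x \<in> A \<Longrightarrow> \<exists>y. s x = Some y" using d by auto
  show "y \<in> B \<Longrightarrow> \<exists>x. s x = Some y" using r by (auto simp: ran_def)
  show "s x = Some y \<Longrightarrow> x \<in> A" using d by auto
  show "s x = Some y \<Longrightarrow> y \<in> B" using r by (auto intro: ranI)
  show "x = x'" if "s x = Some y" "s x' = Some y"
    by (rule inj_onD[OF inj]) (use that in auto)
qed

lemma partial_bij_comp:
  assumes s: "partial_bij s B C" and t: "partial_bij t A B"
  shows "partial_bij (s \<circ>\<^sub>m t) A C"
proof (rule partial_bijI)
  show "\<exists>z. (s \<circ>\<^sub>m t) x = Some z" if "x \<in> A" for x
    using partial_bijD(1)[OF t that] partial_bijD(4)[OF t] partial_bijD(1)[OF s] by fastforce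
  show "\<exists>x. (s \<circ>\<^sub>m t) x = Some z" if "z \<in> C" for z
    using partial_bijD(2)[OF s that] partial_bijD(3)[OF s] partial_bijD(2)[OF t]
    by (metis map_comp_simps(2))
  show "x \<in> A \<and> z \<in> C" if "(s \<circ>\<^sub>m t) x = Some z" for x z
    using that partial_bijD(3)[OF t] partial_bijD(4)[OF s] by (auto simp: map_comp_Some_iff)
  show "x = x'" if "(s \<circ>\<^sub>m t) x = Some z" "(s \<circ>\<^sub>m t) x' = Some z" for x x' z
    using that partial_bijD(5)[OF t] partial_bijD(5)[OF s] by (auto simp: map_comp_Some_iff)
qed

lemma pinv_eq:
  assumes "partial_bij s A B"
  shows "pinv s y = Some x \<longleftrightarrow> s x = Some y"
proof
  note inj = partial_bijD(5)[OF assms]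
  show "pinv s y = Some x" if "s x = Some y"
  proof -
    have "(THE x. s x = Some y) = x" using that inj by blast
    then show ?thesis using that by (simp add: pinv_def ranI)
  qed
  show "s x = Some y" if "pinv s y = Some x"
  proof -
    have "y \<in> ran s" and x: "x = (THE x. s x = Some y)" using that by (auto simp: pinv_def split: if_splits)
    then obtain x' where x': "s x' = Some y" by (auto simp: ran_def)
    then have "(THE x. s x = Some y) = x'" using inj by blast
    then show ?thesis using x x' by simp
  qed
qed

lemma partial_bij_pinv:
  assumes "partial_bij s A B"
  shows "partial_bij (pinv s) B A"
proof (rule partial_bijI; unfold pinv_eq[OF assms])
  show "\<exists>y. s y = Some x" if "x \<in> B" for x by (rule partial_bijD(2)[OF assms that])
  show "\<exists>x. s y = Some x" if "y \<in> A" for y by (rule partial_bijD(1)[OF assms that])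
  show "x \<in> B \<and> y \<in> A" if "s y = Some x" for x y using partial_bijD(3,4)[OF assms that] by simp
  show "x = x'" if "s y = Some x" "s y = Some x'" for x x' y using that by simp
qed

lemma pinv_comp:
  assumes "partial_bij s A B"
  shows "pinv s \<circ>\<^sub>m s = Some |` A" and "s \<circ>\<^sub>m pinv s = Some |` B"
proof -
  have 1: "pinv s \<circ>\<^sub>m s = Some |` A" if s: "partial_bij s A B" for s A B
  proof
    fix x
    show "(pinv s \<circ>\<^sub>m s) x = (Some |` A) x"
    proof (cases "s x")
      case None
      then have "x \<notin> A" using partial_bijD(1)[OF s] by fastforce
      then show ?thesis using None by simp
    next
      case (Some y)
      then have "x \<in> A" "pinv s y = Some x" using partial_bijD(3)[OF s] pinv_eq[OF s] by auto
      then show ?thesis using Some by simp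
    qed
  qed
  then show "pinv s \<circ>\<^sub>m s = Some |` A" using assms .
  have "pinv (pinv s) = s"
  proof
    fix x show "pinv (pinv s) x = s x"
      using pinv_eq[OF partial_bij_pinv[OF assms], of x] pinv_eq[OF assms] by (metis option.exhaust)
  qed
  then show "s \<circ>\<^sub>m pinv s = Some |` B" using 1[OF partial_bij_pinv[OF assms]] by simp
qed

lemma map_comp_assoc_left: "s \<circ>\<^sub>m (t \<circ>\<^sub>m u) = (s \<circ>\<^sub>m t) \<circ>\<^sub>m u"
  by (auto simp: map_comp_def fun_eq_iff split: option.splits)

lemma map_comp_Some_left: "ran s \<subseteq> A \<Longrightarrow> (Some |` A) \<circ>\<^sub>m s = s"
  by (auto simp: map_comp_def fun_eq_iff restrict_map_def ran_def split: option.splits)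

lemma map_comp_Some_right: "dom s \<subseteq> A \<Longrightarrow> s \<circ>\<^sub>m (Some |` A) = s"
  by (auto simp: map_comp_def fun_eq_iff restrict_map_def split: option.splits)
    (metis domIff subsetD)

lemma partial_bij_order_bij:
  assumes "finite a"
  shows "partial_bij (order_bij a) {1..card a} a"
proof -
  let ?l = "sorted_list_of_set a"
  have l: "set ?l = a" "distinct ?l" "length ?l = card a" using assms by auto
  have dom: "dom (order_bij a) = {1..card a}" by (auto simp: order_bij_def)
  moreover have "ran (order_bij a) = a"
  proof
    show "ran (order_bij a) \<subseteq> a"
    proof
      fix y assume "y \<in> ran (order_bij a)"
      then obtain j where "order_bij a j = Some y" by (auto simp: ran_def)
      then have "y = ?l ! (j - 1)" "1 \<le> j" "j \<le> card a"
        by (auto simp: order_bij_def restrict_map_def split: if_splits)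
      then show "y \<in> a" using l nth_mem[of "j - 1" ?l] by auto
    qed
    show "a \<subseteq> ran (order_bij a)"
    proof
      fix y assume "y \<in> a"
      then obtain i where "i < card a" "?l ! i = y" using l by (metis in_set_conv_nth)
      then have "order_bij a (Suc i) = Some y" by (auto simp: order_bij_def)
      then show "y \<in> ran (order_bij a)" by (rule ranI)
    qed
  qed
  moreover have "inj_on (order_bij a) {1..card a}"
  proof (rule inj_onI)
    fix i j assume ij: "i \<in> {1..card a}" "j \<in> {1..card a}" "order_bij a i = order_bij a j"
    then have "?l ! (i - 1) = ?l ! (j - 1)" by (simp add: order_bij_def)
    then have "i - 1 = j - 1" using l ij nth_eq_iff_index_eq[OF l(2), of "i - 1" "j - 1"] by auto
    then show "i = j" using ij by auto
  qed
  ultimately show ?thesis by (simp add: partial_bij_def)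
qed

definition rooks_between :: "nat set \<Rightarrow> nat set \<Rightarrow> (nat \<rightharpoonup> nat) set" where
  "rooks_between a b = {s. partial_bij s b a}"

lemma rook_iff: "s \<in> rook n \<longleftrightarrow> partial_bij s (dom s) (ran s) \<and> dom s \<subseteq> {1..n} \<and> ran s \<subseteq> {1..n}"
  by (auto simp: rook_def partial_bij_def)

text \<open>
  The argument of the representation in \<^const>\<open>induced_block\<close>.
\<close>

definition to_symgrp :: "(nat \<rightharpoonup> nat) \<Rightarrow> (nat \<rightharpoonup> nat)" where
  "to_symgrp s = pinv (order_bij (ran s)) \<circ>\<^sub>m (s \<circ>\<^sub>m order_bij (dom s))"

lemma symgrp_partial_bij: "symgrp k = {s. partial_bij s {1..k} {1..k}}"
  by (auto simp: symgrp_def partial_bij_def)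

lemma bij_to_symgrp:
  assumes "finite a" "finite b" "card a = k" "card b = k"
  shows "bij_betw to_symgrp (rooks_between a b) (symgrp k)"
proof (rule bij_betw_byWitness[where f' = "\<lambda>g. order_bij a \<circ>\<^sub>m (g \<circ>\<^sub>m pinv (order_bij b))"])
  have a: "partial_bij (order_bij a) {1..k} a" and b: "partial_bij (order_bij b) {1..k} b"
    using partial_bij_order_bij[OF assms(1)] partial_bij_order_bij[OF assms(2)] assms(3,4) by simp_all
  have sh: "to_symgrp s = pinv (order_bij a) \<circ>\<^sub>m (s \<circ>\<^sub>m order_bij b)" if "partial_bij s b a" for s
    using that by (simp add: to_symgrp_def partial_bij_def)
  show "\<forall>s\<in>rooks_between a b. order_bij a \<circ>\<^sub>m (to_symgrp s \<circ>\<^sub>m pinv (order_bij b)) = s"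
  proof
    fix s assume "s \<in> rooks_between a b"
    then have s: "partial_bij s b a" by (simp add: rooks_between_def)
    have "order_bij a \<circ>\<^sub>m (to_symgrp s \<circ>\<^sub>m pinv (order_bij b)) =
        (order_bij a \<circ>\<^sub>m pinv (order_bij a)) \<circ>\<^sub>m (s \<circ>\<^sub>m (order_bij b \<circ>\<^sub>m pinv (order_bij b)))"
      by (simp only: sh[OF s] map_comp_assoc_left)
    also have "\<dots> = s"
      using s by (simp add: pinv_comp[OF a] pinv_comp[OF b] partial_bij_def map_comp_Some_left map_comp_Some_right)
    finally show "order_bij a \<circ>\<^sub>m (to_symgrp s \<circ>\<^sub>m pinv (order_bij b)) = s" .
  qed
  have ext: "partial_bij (order_bij a \<circ>\<^sub>m (g \<circ>\<^sub>m pinv (order_bij b))) b a" if "partial_bij g {1..k} {1..k}" for g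
    by (rule partial_bij_comp[OF a partial_bij_comp[OF that partial_bij_pinv[OF b]]])
  show "\<forall>g\<in>symgrp k. to_symgrp (order_bij a \<circ>\<^sub>m (g \<circ>\<^sub>m pinv (order_bij b))) = g"
  proof
    fix g assume "g \<in> symgrp k"
    then have g: "partial_bij g {1..k} {1..k}" by (simp add: symgrp_partial_bij)
    have "to_symgrp (order_bij a \<circ>\<^sub>m (g \<circ>\<^sub>m pinv (order_bij b))) =
        (pinv (order_bij a) \<circ>\<^sub>m order_bij a) \<circ>\<^sub>m (g \<circ>\<^sub>m (pinv (order_bij b) \<circ>\<^sub>m order_bij b))"
      unfolding sh[OF ext[OF g]] by (simp only: map_comp_assoc_left)
    also have "\<dots> = g"
      using g by (simp add: pinv_comp[OF a] pinv_comp[OF b] partial_bij_def map_comp_Some_left map_comp_Some_right)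
    finally show "to_symgrp (order_bij a \<circ>\<^sub>m (g \<circ>\<^sub>m pinv (order_bij b))) = g" .
  qed
  show "to_symgrp ` rooks_between a b \<subseteq> symgrp k"
  proof
    fix g assume "g \<in> to_symgrp ` rooks_between a b"
    then obtain s where s: "partial_bij s b a" and g: "g = to_symgrp s" by (auto simp: rooks_between_def)
    show "g \<in> symgrp k"
      unfolding g sh[OF s] symgrp_partial_bij mem_Collect_eq
      by (rule partial_bij_comp[OF partial_bij_pinv[OF a] partial_bij_comp[OF s b]])
  qed
  show "(\<lambda>g. order_bij a \<circ>\<^sub>m (g \<circ>\<^sub>m pinv (order_bij b))) ` symgrp k \<subseteq> rooks_between a b"
    using ext by (auto simp: rooks_between_def symgrp_partial_bij)
qed

definition subset_pairs :: "nat \<Rightarrow> (nat set \<times> nat set) set" where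
  "subset_pairs n = {(a, b). a \<subseteq> {1..n} \<and> b \<subseteq> {1..n} \<and> card a = card b}"

lemma finite_subset_pairs: "finite (subset_pairs n)"
  by (rule finite_subset[of _ "Pow {1..n} \<times> Pow {1..n}"]) (auto simp: subset_pairs_def)

lemma card_dom_ran: "partial_bij s b a \<Longrightarrow> card a = card b"
proof -
  assume s: "partial_bij s b a"
  have "bij_betw (\<lambda>x. the (s x)) b a"
  proof (rule bij_betw_imageI)
    show "inj_on (\<lambda>x. the (s x)) b"
    proof (rule inj_onI)
      fix x y assume "x \<in> b" "y \<in> b" "the (s x) = the (s y)"
      moreover obtain u v where "s x = Some u" "s y = Some v"
        using partial_bijD(1)[OF s] \<open>x \<in> b\<close> \<open>y \<in> b\<close> by blast
      ultimately show "x = y" using partial_bijD(5)[OF s, of x u y] by simp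
    qed
    show "(\<lambda>x. the (s x)) ` b = a"
    proof
      show "(\<lambda>x. the (s x)) ` b \<subseteq> a"
      proof
        fix y assume "y \<in> (\<lambda>x. the (s x)) ` b"
        then obtain x where "x \<in> b" "y = the (s x)" by auto
        moreover from this obtain u where "s x = Some u" using partial_bijD(1)[OF s] by blast
        ultimately show "y \<in> a" using partial_bijD(4)[OF s] by simp
      qed
      show "a \<subseteq> (\<lambda>x. the (s x)) ` b"
      proof
        fix y assume "y \<in> a"
        then obtain x where "s x = Some y" using partial_bijD(2)[OF s] by blast
        then show "y \<in> (\<lambda>x. the (s x)) ` b" using partial_bijD(3)[OF s] by force
      qed
    qed
  qed
  then show ?thesis by (simp add: bij_betw_same_card)
qed

lemma rook_Union: "rook n = (\<Union>(a, b)\<in>subset_pairs n. rooks_between a b)"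
proof (intro equalityI subsetI)
  fix s assume "s \<in> rook n"
  then have "partial_bij s (dom s) (ran s)" "(ran s, dom s) \<in> subset_pairs n"
    using card_dom_ran by (auto simp: rook_iff subset_pairs_def)
  then show "s \<in> (\<Union>(a, b)\<in>subset_pairs n. rooks_between a b)" by (auto simp: rooks_between_def)
next
  fix s assume "s \<in> (\<Union>(a, b)\<in>subset_pairs n. rooks_between a b)"
  then obtain a b where "(a, b) \<in> subset_pairs n" "partial_bij s b a" by (auto simp: rooks_between_def)
  then show "s \<in> rook n" by (auto simp: subset_pairs_def rook_def partial_bij_def)
qed

lemma card_rooks_between: "finite a \<Longrightarrow> finite b \<Longrightarrow> card a = card b \<Longrightarrow> card (rooks_between a b) = fact (card b)"
  using bij_betw_same_card[OF bij_to_symgrp[of a b "card b"]]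
    bij_betw_same_card[OF bij_codes_symgrp[of "card b"]] card_codes by simp

lemma finite_subset_pair: "(a, b) \<in> subset_pairs n \<Longrightarrow> finite a \<and> finite b"
  by (auto simp: subset_pairs_def intro: finite_subset)

text \<open>
  The rooks with range \<open>a\<close> and domain \<open>b\<close> are in bijection with a symmetric group.
\<close>

lemma card_rook: "card (rook n) = (\<Sum>(a, b)\<in>subset_pairs n. fact (card b))"
proof -
  have fin: "finite (rooks_between a b)" if "(a, b) \<in> subset_pairs n" for a b
    by (rule finite_subset[OF _ finite_rook[of n]]) (use that rook_Union in auto)
  have "card (rook n) = (\<Sum>i\<in>subset_pairs n. card (case i of (a, b) \<Rightarrow> rooks_between a b))"
    unfolding rook_Union
  proof (rule card_UN_disjoint[OF finite_subset_pairs])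
    show "\<forall>i\<in>subset_pairs n. finite (case i of (a, b) \<Rightarrow> rooks_between a b)" using fin by auto
    show "\<forall>i\<in>subset_pairs n. \<forall>j\<in>subset_pairs n. i \<noteq> j \<longrightarrow>
        (case i of (a, b) \<Rightarrow> rooks_between a b) \<inter> (case j of (a, b) \<Rightarrow> rooks_between a b) = {}"
      by (auto simp: rooks_between_def partial_bij_def)
  qed
  also have "\<dots> = (\<Sum>(a, b)\<in>subset_pairs n. fact (card b))"
  proof (intro sum.cong refl)
    fix i assume i: "i \<in> subset_pairs n"
    obtain a b where ab: "i = (a, b)" by (cases i)
    have "finite a \<and> finite b" by (rule finite_subset_pair[of a b n]) (use i ab in simp)
    moreover have "card a = card b" using i by (simp add: ab subset_pairs_def)
    ultimately show "card (case i of (a, b) \<Rightarrow> rooks_between a b) = (case i of (a, b) \<Rightarrow> fact (card b))"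
      unfolding ab prod.case by (intro card_rooks_between) auto
  qed
  finally show ?thesis .
qed

section \<open>Coefficients in the floor basis from the Fourier transform\<close>

text \<open>
  For \<open>s \<in> rook n\<close> this agrees with \<^const>\<open>floor_coords\<close> on \<^term>\<open>rook_algebra n\<close>. It is a linear form in
  all \<open>f\<close>, so that identities between values hold as equations of functions.
\<close>

definition floor_coord :: "nat \<Rightarrow> (nat \<rightharpoonup> nat) \<Rightarrow> ((nat \<rightharpoonup> nat) \<Rightarrow> complex) \<Rightarrow> complex" where
  "floor_coord n s f = (\<Sum>t\<in>{t \<in> rook n. s \<subseteq>\<^sub>m t}. f t)"

lemma fourier_floor_coord:
  "fourier n k \<rho> f I J = (\<Sum>s\<in>rook n. floor_coord n s f * induced_block k \<rho> s I J)"
proof -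
  \<comment> \<open>Only the values of \<open>f\<close> on rooks matter, and for \<open>f'\<close> the coordinates in the floor basis exist.\<close>
  define f' where "f' s = (if s \<in> rook n then f s else 0)" for s
  have f': "f' \<in> rook_algebra n" by (simp add: f'_def rook_algebra_def)
  have "fourier n k \<rho> f I J = fourier n k \<rho> f' I J" by (simp add: fourier_def f'_def)
  also have "\<dots> = (\<Sum>s\<in>rook n. floor_coords n f' s * induced_block k \<rho> s I J)"
    by (simp only: fourier_eq_induced_rep[OF f'] induced_rep_def)
  also have "\<dots> = (\<Sum>s\<in>rook n. floor_coord n s f * induced_block k \<rho> s I J)"
    using floor_coords_eq(3)[OF f'] by (intro sum.cong) (auto simp: floor_coord_def f'_def intro!: sum.cong)
  finally show ?thesis .
qed

definition fourier_entry :: "nat \<Rightarrow> (nat list \<Rightarrow> (nat \<rightharpoonup> nat) \<Rightarrow> tableau \<Rightarrow> tableau \<Rightarrow> complex) \<Rightarrow>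
    nat list \<times> (nat set \<times> tableau) \<times> (nat set \<times> tableau) \<Rightarrow> ((nat \<rightharpoonup> nat) \<Rightarrow> complex) \<Rightarrow> complex" where
  "fourier_entry n \<rho> = (\<lambda>(lam, I, J) f. fourier n (sum_list lam) (\<rho> lam) f I J)"

text \<open>
  The block at \<open>(a, b)\<close> is the Fourier transform on \<open>S\<^sub>k\<close> of the coefficients of the rooks from \<open>b\<close> to \<open>a\<close>,
  carried over to \<open>S\<^sub>k\<close>, whose elements are enumerated by codes.
\<close>

lemma fourier_entry_words:
  assumes rep: "\<And>k lam. partition_of lam k \<Longrightarrow> young_rep F k lam (\<rho> lam)"
    and ab: "(a, b) \<in> subset_pairs n" "card b = k"
    and lam: "partition_of lam k" "P \<in> words (shape_of lam)" "Q \<in> words (shape_of lam)"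
    and h: "\<And>c. c \<in> codes k \<Longrightarrow> h c = the_inv_into (rooks_between a b) to_symgrp (perm_map k (perm c))"
  shows "fourier_entry n \<rho> (lam, (a, tableau_of P), (b, tableau_of Q)) f = (\<Sum>c\<in>codes k. floor_coord n (h c) f * word_rep F c P Q)"
proof -
  have fin: "finite a" "finite b" "card a = k" using ab finite_subset_pair[OF ab(1)] by (auto simp: subset_pairs_def)
  have bij: "bij_betw to_symgrp (rooks_between a b) (symgrp k)" by (rule bij_to_symgrp) (use fin ab in auto)
  have sub: "rooks_between a b \<subseteq> rook n" using ab(1) rook_Union by auto
  have sum: "sum_list lam = k" using lam(1) by (simp add: partition_of_def)
  have len: "length P = k" "length Q = k" using length_words young_shape_of[OF lam(1)] lam by blast+
  have bij': "bij_betw h (codes k) (rooks_between a b)"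
  proof -
    have "bij_betw (the_inv_into (rooks_between a b) to_symgrp \<circ> (\<lambda>c. perm_map k (perm c))) (codes k) (rooks_between a b)"
      by (rule bij_betw_trans[OF bij_codes_symgrp bij_betw_the_inv_into[OF bij]])
    then show ?thesis using h by (subst bij_betw_cong[where g = "\<lambda>c. the_inv_into (rooks_between a b) to_symgrp (perm_map k (perm c))"]) (auto simp: o_def)
  qed
  have to_symgrp: "to_symgrp (h c) = perm_map k (perm c)" if "c \<in> codes k" for c
    using h[OF that] bij bij_betwE[OF bij_codes_symgrp] that
    by (simp add: f_the_inv_into_f_bij_betw)
  have "fourier_entry n \<rho> (lam, (a, tableau_of P), (b, tableau_of Q)) f =
      (\<Sum>s\<in>rook n. floor_coord n s f * induced_block k (\<rho> lam) s (a, tableau_of P) (b, tableau_of Q))"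
    by (simp add: fourier_entry_def sum fourier_floor_coord)
  also have "\<dots> = (\<Sum>s\<in>rooks_between a b. floor_coord n s f * \<rho> lam (to_symgrp s) (tableau_of P) (tableau_of Q))"
  proof (rule sum.mono_neutral_cong_right[OF finite_rook sub])
    show "\<forall>s\<in>rook n - rooks_between a b. floor_coord n s f * induced_block k (\<rho> lam) s (a, tableau_of P) (b, tableau_of Q) = 0"
      by (auto simp: induced_block_def rook_iff rooks_between_def)
    fix s assume "s \<in> rooks_between a b"
    then show "floor_coord n s f * induced_block k (\<rho> lam) s (a, tableau_of P) (b, tableau_of Q) =
        floor_coord n s f * \<rho> lam (to_symgrp s) (tableau_of P) (tableau_of Q)"
      using ab by (simp add: induced_block_def to_symgrp_def rooks_between_def partial_bij_def rk_def)
  qed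
  also have "\<dots> = (\<Sum>c\<in>codes k. floor_coord n (h c) f * \<rho> lam (to_symgrp (h c)) (tableau_of P) (tableau_of Q))"
    by (rule sum.reindex_bij_betw[OF bij', symmetric])
  also have "\<dots> = (\<Sum>c\<in>codes k. floor_coord n (h c) f * word_rep F c P Q)"
    using young_rep_word[OF lam(1) rep[OF lam(1)], of _ k "[]" P "[]" Q] lam len
    by (intro sum.cong) (auto simp: to_symgrp)
  finally show ?thesis .
qed

lemma costs_coords_between:
  assumes rep: "\<And>k lam. partition_of lam k \<Longrightarrow> young_rep F k lam (\<rho> lam)"
    and ab: "(a, b) \<in> subset_pairs n"
  shows "costs (fourier_entry n \<rho> ` fourier_entries n) (floor_coord n ` rooks_between a b) (2 * n\<^sup>2 * fact (card b))"
proof -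
  define k where "k = card b"
  have k: "card a = k" "card b = k" "k \<le> n" "finite a" "finite b" "a \<subseteq> {1..n}" "b \<subseteq> {1..n}"
    using ab finite_subset_pair[OF ab] card_mono[of "{1..n}" b] by (auto simp: subset_pairs_def k_def)
  define h where "h c = the_inv_into (rooks_between a b) to_symgrp (perm_map k (perm c))" for c
  have bij: "bij_betw to_symgrp (rooks_between a b) (symgrp k)" by (rule bij_to_symgrp) (use k in auto)
  have "h ` codes k = rooks_between a b"
    using bij_betw_trans[OF bij_codes_symgrp bij_betw_the_inv_into[OF bij]]
    by (simp add: h_def bij_betw_def o_def)
  then have img: "(\<lambda>c. floor_coord n (h c)) ` codes k = floor_coord n ` rooks_between a b"
    by (simp flip: image_image)
  have "costs {\<lambda>f. \<Sum>c\<in>codes k. floor_coord n (h c) f * word_rep F c P Q | P Q. Q \<in> ballots k \<and> P \<in> words (count_list Q)}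
      ((\<lambda>c. floor_coord n (h c)) ` codes k) (2 * k\<^sup>2 * fact k)"
    by (rule costs_symmetric_group)
  then show ?thesis
  proof (rule costs_mono)
    show "{\<lambda>f. \<Sum>c\<in>codes k. floor_coord n (h c) f * word_rep F c P Q | P Q. Q \<in> ballots k \<and> P \<in> words (count_list Q)}
        \<subseteq> fourier_entry n \<rho> ` fourier_entries n"
    proof
      fix v assume "v \<in> {\<lambda>f. \<Sum>c\<in>codes k. floor_coord n (h c) f * word_rep F c P Q | P Q.
        Q \<in> ballots k \<and> P \<in> words (count_list Q)}"
      then obtain P Q where PQ: "Q \<in> ballots k" "P \<in> words (count_list Q)"
        and v: "v = (\<lambda>f. \<Sum>c\<in>codes k. floor_coord n (h c) f * word_rep F c P Q)" by blast
      obtain lam where lam: "partition_of lam k" "shape_of lam = count_list Q"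
        using exists_partition[OF ballots_young[OF PQ(1)]] by blast
      have Q: "Q \<in> words (shape_of lam)" and P: "P \<in> words (shape_of lam)"
        using PQ lam by (auto simp: words_def ballots_def)
      have "v = fourier_entry n \<rho> (lam, (a, tableau_of P), (b, tableau_of Q))"
        unfolding v using fourier_entry_words[OF rep ab k(2) lam(1) P Q h_def] by (auto simp: fun_eq_iff)
      moreover have "(lam, (a, tableau_of P), (b, tableau_of Q)) \<in> fourier_entries n"
        using k lam P Q bij_betwE[OF tableau_of_bij[OF lam(1)]]
        by (auto simp: fourier_entries_def induced_index_def partition_of_def)
      ultimately show "v \<in> fourier_entry n \<rho> ` fourier_entries n" by blast
    qed
    show "floor_coord n ` rooks_between a b \<subseteq> (\<lambda>c. floor_coord n (h c)) ` codes k" using img by simp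
    show "2 * k\<^sup>2 * fact k \<le> 2 * n\<^sup>2 * fact (card b)"
      using k by (intro mult_mono power_mono) auto
  qed
qed

text \<open>
  The costs \<open>2 n\<^sup>2 k!\<close> for the pairs of subsets with \<open>k\<close> elements add up by \<open>card_rook\<close>.
\<close>

lemma costs_coords:
  assumes rep: "\<And>k lam. partition_of lam k \<Longrightarrow> young_rep F k lam (\<rho> lam)"
  shows "costs (fourier_entry n \<rho> ` fourier_entries n) (floor_coord n ` rook n) (2 * n\<^sup>2 * card (rook n))"
proof -
  have "costs (fourier_entry n \<rho> ` fourier_entries n) (\<Union>i\<in>subset_pairs n. floor_coord n ` (case i of (a, b) \<Rightarrow> rooks_between a b))
      (\<Sum>i\<in>subset_pairs n. case i of (a, b) \<Rightarrow> 2 * n\<^sup>2 * fact (card b))"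
    using costs_coords_between[OF rep] by (intro costs_UN finite_subset_pairs) (auto split: prod.split)
  moreover have "(\<Union>i\<in>subset_pairs n. floor_coord n ` (case i of (a, b) \<Rightarrow> rooks_between a b)) = floor_coord n ` rook n"
    unfolding rook_Union by (auto simp: image_iff)
  moreover have "(\<Sum>i\<in>subset_pairs n. case i of (a, b) \<Rightarrow> 2 * n\<^sup>2 * fact (card b)) = 2 * n\<^sup>2 * card (rook n)"
    unfolding card_rook by (simp add: sum_distrib_left case_prod_unfold)
  ultimately show ?thesis by simp
qed

section \<open>Moebius inversion\<close>

text \<open>
  The sum of \<open>f\<close> over the extensions of \<open>s\<close> by points greater than \<open>x\<close>. It interpolates between
  the coefficients in the floor basis (\<open>x = 0\<close>) and \<open>f\<close> itself (\<open>x = n\<close>).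
\<close>

definition partial_coord :: "nat \<Rightarrow> nat \<Rightarrow> (nat \<rightharpoonup> nat) \<Rightarrow> ((nat \<rightharpoonup> nat) \<Rightarrow> complex) \<Rightarrow> complex" where
  "partial_coord n x s f = (\<Sum>t\<in>{t \<in> rook n. s \<subseteq>\<^sub>m t \<and> dom t \<inter> {1..x} \<subseteq> dom s}. f t)"

lemma partial_coord_0: "partial_coord n 0 = floor_coord n"
  by (simp add: fun_eq_iff partial_coord_def floor_coord_def)

lemma partial_coord_n:
  assumes "s \<in> rook n"
  shows "partial_coord n n s = (\<lambda>f. f s)"
proof -
  have "{t \<in> rook n. s \<subseteq>\<^sub>m t \<and> dom t \<inter> {1..n} \<subseteq> dom s} = {s}"
  proof -
    have "t = s" if t: "t \<in> rook n" "s \<subseteq>\<^sub>m t" "dom t \<inter> {1..n} \<subseteq> dom s" for t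
    proof -
      have "dom t \<subseteq> dom s" using t by (auto simp: rook_def)
      then have "t \<subseteq>\<^sub>m s" using t(2) by (auto simp: map_le_def) (metis domI subsetD)
      then show ?thesis using t(2) by (rule map_le_antisym)
    qed
    then show ?thesis using assms by auto
  qed
  then show ?thesis by (simp add: partial_coord_def fun_eq_iff)
qed

lemma rook_extend:
  assumes "s \<in> rook n" "x \<in> {1..n}" "x \<notin> dom s" "y \<in> {1..n} - ran s"
  shows "s(x \<mapsto> y) \<in> rook n"
proof -
  have "inj_on (s(x \<mapsto> y)) (insert x (dom s))"
    using assms by (auto simp: rook_def inj_on_def ran_def split: if_splits) 
  moreover have "ran (s(x \<mapsto> y)) = insert y (ran s)" using assms(3) by (auto simp: domIff)
  ultimately show ?thesis using assms by (auto simp: rook_def)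
qed

text \<open>
  An extension of \<open>s\<close> by points greater than \<open>x\<close> which is defined at \<open>x + 1\<close>, with value \<open>y\<close>, is an extension
  of \<open>s(x + 1 \<mapsto> y)\<close>; these have to be subtracted.
\<close>

lemma partial_coord_Suc:
  assumes s: "s \<in> rook n" and x: "Suc x \<le> n"
  shows "partial_coord n (Suc x) s f = partial_coord n x s f +
    (\<Sum>y\<in>(if Suc x \<in> dom s then {} else {1..n} - ran s). -1 * partial_coord n x (s(Suc x \<mapsto> y)) f)"
proof (cases "Suc x \<in> dom s")
  case True
  have "{1..Suc x} = insert (Suc x) {1..x}" by auto
  then have "dom t \<inter> {1..Suc x} \<subseteq> dom s \<longleftrightarrow> dom t \<inter> {1..x} \<subseteq> dom s" for t :: "nat \<rightharpoonup> nat" using True by auto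
  then show ?thesis using True by (simp add: partial_coord_def)
next
  case False
  let ?Y = "{1..n} - ran s"
  let ?A = "\<lambda>x s. {t \<in> rook n. s \<subseteq>\<^sub>m t \<and> dom t \<inter> {1..x} \<subseteq> dom s}"
  have fin: "finite (?A x s)" for x s using finite_rook[of n] by simp
  have ext: "s(Suc x \<mapsto> y) \<subseteq>\<^sub>m t \<longleftrightarrow> s \<subseteq>\<^sub>m t \<and> t (Suc x) = Some y" for y t
    using False by (auto simp: map_le_def domIff)
  have "?A x s = ?A (Suc x) s \<union> (\<Union>y\<in>?Y. ?A x (s(Suc x \<mapsto> y)))" (is "?L = ?R")
  proof (intro equalityI subsetI)
    fix t assume t: "t \<in> ?L"
    show "t \<in> ?R"
    proof (cases "Suc x \<in> dom t")
      case True
      then obtain y where y: "t (Suc x) = Some y" by auto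
      have "y \<notin> ran s"
      proof
        assume "y \<in> ran s"
        then obtain z where z: "s z = Some y" by (auto simp: ran_def)
        note z
        moreover have "z \<in> dom s" using z by auto
        ultimately have "t z = Some y" using t by (simp add: map_le_def)
        moreover have "partial_bij t (dom t) (ran t)" using t by (simp add: rook_iff)
        ultimately have "z = Suc x" using y partial_bijD(5) by blast
        then show False using z False by auto
      qed
      moreover have "y \<in> {1..n}" using t y by (auto simp: rook_def intro: ranI)
      moreover have "t \<in> ?A x (s(Suc x \<mapsto> y))" using t y ext by auto
      ultimately show ?thesis by blast
    next
      case False
      then have "dom t \<inter> {1..Suc x} = dom t \<inter> {1..x}" by (auto simp: le_Suc_eq)
      then show ?thesis using t by auto
    qed
  next
    fix t assume "t \<in> ?R"
    then show "t \<in> ?L"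
    proof
      assume "t \<in> (\<Union>y\<in>?Y. ?A x (s(Suc x \<mapsto> y)))"
      then show ?thesis by (auto simp: ext)
    qed auto
  qed
  then have "partial_coord n x s f = (\<Sum>t\<in>?A (Suc x) s \<union> (\<Union>y\<in>?Y. ?A x (s(Suc x \<mapsto> y))). f t)"
    by (simp add: partial_coord_def)
  also have "\<dots> = (\<Sum>t\<in>?A (Suc x) s. f t) + (\<Sum>t\<in>(\<Union>y\<in>?Y. ?A x (s(Suc x \<mapsto> y))). f t)"
  proof (rule sum.union_disjoint)
    show "finite (\<Union>y\<in>?Y. ?A x (s(Suc x \<mapsto> y)))" using fin by blast
    show "?A (Suc x) s \<inter> (\<Union>y\<in>?Y. ?A x (s(Suc x \<mapsto> y))) = {}" using False by (auto simp: ext)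
  qed (rule fin)
  also have "(\<Sum>t\<in>(\<Union>y\<in>?Y. ?A x (s(Suc x \<mapsto> y))). f t) = (\<Sum>y\<in>?Y. \<Sum>t\<in>?A x (s(Suc x \<mapsto> y)). f t)"
    by (intro sum.UNION_disjoint) (auto simp: ext finite_rook)
  finally show ?thesis using False by (simp add: partial_coord_def sum_negf)
qed

lemma costs_moebius_step:
  assumes "Suc x \<le> n"
  shows "costs (partial_coord n x ` rook n) (partial_coord n (Suc x) ` rook n) (n * card (rook n))"
proof -
  have "costs (partial_coord n x ` rook n) (\<Union>s\<in>rook n. {partial_coord n (Suc x) s}) (n * card (rook n))"
  proof (rule costs_UN_le[where k = n])
    fix s assume s: "s \<in> rook n"
    let ?Y = "if Suc x \<in> dom s then {} else {1..n} - ran s"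
    have c: "costs (partial_coord n x ` rook n) {\<lambda>f. partial_coord n x s f +
        (\<Sum>y\<in>?Y. -1 * partial_coord n x (s(Suc x \<mapsto> y)) f)} (card ?Y)"
    proof (rule costs_sum)
      fix y assume "y \<in> ?Y"
      then have "s(Suc x \<mapsto> y) \<in> rook n" using s assms by (intro rook_extend) (auto split: if_splits)
      then show "partial_coord n x (s(Suc x \<mapsto> y)) \<in> partial_coord n x ` rook n" by blast
    qed (use s in auto)
    have eq: "(\<lambda>f. partial_coord n x s f + (\<Sum>y\<in>?Y. -1 * partial_coord n x (s(Suc x \<mapsto> y)) f)) =
        partial_coord n (Suc x) s"
      by (rule ext) (rule partial_coord_Suc[OF s assms, symmetric])
    have "card ?Y \<le> card {1..n}" by (rule card_mono) auto
    then show "costs (partial_coord n x ` rook n) {partial_coord n (Suc x) s} n"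
      by (intro costs_mono[OF c[unfolded eq]]) auto
  qed (auto simp: finite_rook)
  then show ?thesis by (simp only: UNION_singleton_eq_range)
qed

lemma costs_moebius:
  "costs (floor_coord n ` rook n) ((\<lambda>s f. f s) ` rook n) (n\<^sup>2 * card (rook n))"
proof -
  have "x \<le> n \<Longrightarrow> costs (floor_coord n ` rook n) (partial_coord n x ` rook n) (x * (n * card (rook n)))" for x
  proof (induction x)
    case 0
    then show ?case by (simp add: partial_coord_0 costs_free)
  next
    case (Suc x)
    have "costs (floor_coord n ` rook n) (partial_coord n x ` rook n \<union> partial_coord n (Suc x) ` rook n)
        (x * (n * card (rook n)) + n * card (rook n))"
    proof (rule costs_trans)
      show "costs (floor_coord n ` rook n) (partial_coord n x ` rook n) (x * (n * card (rook n)))"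
        using Suc by simp
      show "costs (floor_coord n ` rook n \<union> partial_coord n x ` rook n) (partial_coord n (Suc x) ` rook n) (n * card (rook n))"
        by (rule costs_mono[OF costs_moebius_step[OF Suc.prems]]) auto
    qed
    then show ?case by (rule costs_mono) auto
  qed
  from this[of n] have "costs (floor_coord n ` rook n) (partial_coord n n ` rook n) (n * (n * card (rook n)))" by simp
  moreover have "partial_coord n n ` rook n = (\<lambda>s f. f s) ` rook n"
    by (rule image_cong) (auto simp: partial_coord_n)
  ultimately show ?thesis by (simp add: power2_eq_square mult.assoc)
qed

section \<open>The number of operations\<close>

text \<open>
  Already the idempotents are \<open>2\<^sup>n\<close> in number.
\<close>

lemma card_rook_ge: "2 ^ n \<le> card (rook n)"
proof -
  have "partial_bij (Some |` A) A A" for A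
    by (rule partial_bijI) (auto simp: restrict_map_def split: if_splits)
  then have "Some |` A \<in> rook n" if "A \<subseteq> {1..n}" for A
    using that by (auto simp only: rook_def partial_bij_def)
  then have "(\<lambda>A. Some |` A) ` Pow {1..n} \<subseteq> rook n" by blast
  moreover have "inj_on (\<lambda>A. Some |` A :: nat \<rightharpoonup> nat) (Pow {1..n})"
  proof (rule inj_onI)
    fix A B :: "nat set" assume "Some |` A = (Some |` B :: nat \<rightharpoonup> nat)"
    then have "dom (Some |` A :: nat \<rightharpoonup> nat) = dom (Some |` B :: nat \<rightharpoonup> nat)" by simp
    then show "A = B" by simp
  qed
  ultimately have "card (Pow {1..n}) \<le> card (rook n)" by (intro card_inj_on_le[OF _ _ finite_rook])
  then show ?thesis by (simp add: card_Pow)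
qed

lemma inverse_fourier_within_bound:
  assumes rep: "\<And>k lam. partition_of lam k \<Longrightarrow> young_rep F k lam (\<rho> lam)"
  shows "inverse_fourier_within n \<rho> (3 * n\<^sup>2 * card (rook n))"
proof -
  let ?S = "fourier_entry n \<rho> ` fourier_entries n"
  have "costs ?S (floor_coord n ` rook n \<union> (\<lambda>s f. f s) ` rook n) (2 * n\<^sup>2 * card (rook n) + n\<^sup>2 * card (rook n))"
    by (rule costs_trans[OF costs_coords[OF rep] costs_mono[OF costs_moebius]]) auto
  then have "costs ((\<lambda>i f. fourier_entry n \<rho> i f) ` fourier_entries n) ((\<lambda>s f. f s) ` rook n) (3 * n\<^sup>2 * card (rook n))"
    by (rule costs_mono) (auto simp: algebra_simps)
  from costs_program[OF this]
  obtain P where P: "length P \<le> 3 * n\<^sup>2 * card (rook n)" "program_ok (fourier_entries n) P"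
    and out: "\<forall>u\<in>(\<lambda>s f. f s) ` rook n. \<exists>w. operand_ok (fourier_entries n) (length P) w \<and>
      (\<forall>f. operand_value (\<lambda>i. fourier_entry n \<rho> i f) (run (\<lambda>i. fourier_entry n \<rho> i f) P) w = u f)"
    by blast
  from out have "\<forall>s\<in>rook n. \<exists>w. operand_ok (fourier_entries n) (length P) w \<and>
      (\<forall>f. operand_value (\<lambda>i. fourier_entry n \<rho> i f) (run (\<lambda>i. fourier_entry n \<rho> i f) P) w = f s)" by simp
  from bchoice[OF this] obtain out where
    "\<forall>s\<in>rook n. operand_ok (fourier_entries n) (length P) (out s) \<and>
      (\<forall>f. operand_value (\<lambda>i. fourier_entry n \<rho> i f) (run (\<lambda>i. fourier_entry n \<rho> i f) P) (out s) = f s)" ..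
  moreover have "(\<lambda>i. fourier_entry n \<rho> i f) = (\<lambda>(lam, I, J). fourier n (sum_list lam) (\<rho> lam) f I J)" for f
    by (auto simp: fourier_entry_def)
  ultimately show ?thesis
    unfolding inverse_fourier_within_def Let_def using P by (intro exI[of _ P] exI[of _ out]) auto
qed

theorem theorem5p2:
  fixes F :: young_form
    and \<rho> :: "nat list \<Rightarrow> (nat \<rightharpoonup> nat) \<Rightarrow> tableau \<Rightarrow> tableau \<Rightarrow> complex"
  assumes "\<And>k lam. partition_of lam k \<Longrightarrow> young_rep F k lam (\<rho> lam)"
  shows "\<exists>N :: nat \<Rightarrow> nat.
           (\<lambda>n. real (N n)) \<in>
             O(\<lambda>n. real (card (rook n)) * (ln (real (card (rook n))))\<^sup>2) \<and>
           (\<forall>n. inverse_fourier_within n \<rho> (N n))"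
proof (intro exI[of _ "\<lambda>n. 3 * n\<^sup>2 * card (rook n)"] conjI allI)
  show "(\<lambda>n. real (3 * n\<^sup>2 * card (rook n))) \<in>
      O(\<lambda>n. real (card (rook n)) * (ln (real (card (rook n))))\<^sup>2)"
  proof (rule bigoI[where c = "3 / (ln 2)\<^sup>2"], rule always_eventually, rule allI)
    fix n
    let ?R = "real (card (rook n))"
    have "real (2 ^ n) \<le> ?R" using card_rook_ge[of n] by (simp only: of_nat_le_iff)
    then have "2 ^ n \<le> ?R" by simp
    moreover have "(0 :: real) < 2 ^ n" by simp
    ultimately have "ln (2 ^ n) \<le> ln ?R" by (simp only: ln_le_cancel_iff less_le_trans[of 0 "2 ^ n" ?R])
    then have "real n * ln 2 \<le> ln ?R" by (simp add: ln_realpow)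
    then have "(real n * ln 2)\<^sup>2 \<le> (ln ?R)\<^sup>2" by (intro power_mono) auto
    then have "(real n)\<^sup>2 \<le> (ln ?R)\<^sup>2 / (ln 2)\<^sup>2" by (simp add: power_mult_distrib field_simps)
    then have "3 * ?R * (real n)\<^sup>2 \<le> 3 * ?R * ((ln ?R)\<^sup>2 / (ln 2)\<^sup>2)" by (intro mult_left_mono) auto
    then show "norm (real (3 * n\<^sup>2 * card (rook n))) \<le> 3 / (ln 2)\<^sup>2 * norm (?R * (ln ?R)\<^sup>2)"
      by (simp add: mult_ac)
  qed
  show "inverse_fourier_within n \<rho> (3 * n\<^sup>2 * card (rook n))" for n
    by (rule inverse_fourier_within_bound[OF assms])
qed

end
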